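(* Let $\theta\in\mathbb R\setminus\mathbb Q$, let $K\subset\mathbb C$ be a compact connected set with $0\in K$, $K\neq\{0\}$ and $\mathbb C\setminus K$ connected, and let $f$ be holomorphic and one-to-one on an open neighborhood $U$ of $K$, with $f(0)=0$, $f'(0)=e^{2\pi i\theta}$ and $f(K)=K=f^{-1}(K)$ (where $f^{-1}:f(U)\to U$ is the inverse branch). Assume that the external-circle correspondence (described in the context) holds for $(f,K)$ and that the germ of $f$ at $0$ is not holomorphically linearizable. Then for every $r>0$, $$\lim_{N\to\infty}\sup_{z\in K}\frac1N\,\#\{0\le j<N:\ |f^j(z)|\ge r\}=0.$$
   Context: External-circle correspondence for $(f,K)$: let $\mathbb D$ be the open unit disk, $\widehat{\mathbb C}$ the Riemann sphere, and let $h:\widehat{\mathbb C}\setminus\overline{\mathbb D}\to\widehat{\mathbb C}\setminus K$, $h(\infty)=\infty$, be the normalized exterior Riemann map (a conformal bijection). The map $h^{-1}\circ f\circ h$, defined on some annulus $\{1<|\zeta|<1+\epsilon\}$, extends analytically across the unit circle and restricts to an orientation-preserving analytic diffeomorphism of the unit circle, whose rotation number is irrational (with a consistently oriented parametrization it agrees with $\theta$ modulo $1$). The germ of $f$ at $0$ is holomorphically linearizable if there is a holomorphic germ $\chi$ at $0$ with $\chi(0)=0$, $\chi'(0)\ne0$ and $\chi^{-1}\circ f\circ\chi(z)=e^{2\pi i\theta}z$ near $0$. *)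

theory Defs
  imports "HOL-Complex_Analysis.Complex_Analysis"
begin

text \<open>The Riemann sphere is avoided: a conformal bijection between the exteriors (in the sphere) of
  the closed unit disk and of \<open>K\<close> fixing infinity is the same as a holomorphic bijection between
  the finite parts that tends to infinity at infinity. The last conjunct is the usual
  normalization by a positive derivative at infinity.\<close>

definition exterior_riemann_map :: "complex set \<Rightarrow> (complex \<Rightarrow> complex) \<Rightarrow> bool" where
  "exterior_riemann_map K h \<longleftrightarrow>
     h holomorphic_on {\<zeta>. 1 < norm \<zeta>} \<and>
     bij_betw h {\<zeta>. 1 < norm \<zeta>} (- K) \<and>
     filterlim h at_infinity at_infinity \<and>
     (\<exists>c::real. 0 < c \<and> ((\<lambda>\<zeta>. h \<zeta> / \<zeta>) \<longlongrightarrow> of_real c) at_infinity)"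

text \<open>The circle is \<open>sphere 0 1\<close>, parametrized counterclockwise by \<open>x \<mapsto> cis (2 * pi * x)\<close>.\<close>

definition circle_lift :: "(complex \<Rightarrow> complex) \<Rightarrow> (real \<Rightarrow> real) \<Rightarrow> bool" where
  "circle_lift g F \<longleftrightarrow>
     continuous_on UNIV F \<and> (\<forall>x. g (cis (2 * pi * x)) = cis (2 * pi * F x))"

definition analytic_circle_diffeo :: "(complex \<Rightarrow> complex) \<Rightarrow> bool" where
  "analytic_circle_diffeo g \<longleftrightarrow>
     g analytic_on sphere 0 1 \<and>
     bij_betw g (sphere 0 1) (sphere 0 1) \<and>
     (\<exists>k. k analytic_on sphere 0 1 \<and> (\<forall>\<zeta>\<in>sphere 0 1. k (g \<zeta>) = \<zeta>))"

definition circle_orientation_preserving :: "(complex \<Rightarrow> complex) \<Rightarrow> bool" where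
  "circle_orientation_preserving g \<longleftrightarrow> (\<exists>F. circle_lift g F \<and> strict_mono F)"

text \<open>The rotation number is a class modulo 1; \<open>\<rho>\<close> below is any real representative, one for
  each choice of lift.\<close>

definition has_rotation_number :: "(complex \<Rightarrow> complex) \<Rightarrow> real \<Rightarrow> bool" where
  "has_rotation_number g \<rho> \<longleftrightarrow>
     (\<exists>F. circle_lift g F \<and> (\<forall>x. (\<lambda>n. ((F ^^ n) x - x) / real n) \<longlonglongrightarrow> \<rho>))"

text \<open>The two conditions \<open>h \<zeta> \<in> U\<close> and \<open>f (h \<zeta>) \<notin> K\<close> say that \<open>h\<inverse> \<circ> f \<circ> h\<close> is defined at \<open>\<zeta>\<close>,
  where \<open>U\<close> is the domain of \<open>f\<close>. The function \<open>g\<close> is its extension across the circle.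
  Near 0 and on the circle alike, rotation is measured counterclockwise, so that the
  rotation number is \<open>\<theta>\<close> rather than \<open>-\<theta>\<close> modulo 1.\<close>

definition external_circle_correspondence ::
  "real \<Rightarrow> (complex \<Rightarrow> complex) \<Rightarrow> complex set \<Rightarrow> complex set \<Rightarrow> bool" where
  "external_circle_correspondence \<theta> f U K \<longleftrightarrow>
     (\<exists>h \<epsilon> g. exterior_riemann_map K h \<and> 0 < \<epsilon> \<and>
        (\<forall>\<zeta>. 1 < norm \<zeta> \<and> norm \<zeta> < 1 + \<epsilon> \<longrightarrow>
            h \<zeta> \<in> U \<and> f (h \<zeta>) \<notin> K \<and>
            g \<zeta> = inv_into {\<zeta>. 1 < norm \<zeta>} h (f (h \<zeta>))) \<and>
        g holomorphic_on {\<zeta>. 1 - \<epsilon> < norm \<zeta> \<and> norm \<zeta> < 1 + \<epsilon>} \<and>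
        analytic_circle_diffeo g \<and>
        circle_orientation_preserving g \<and>
        (\<exists>\<rho>. has_rotation_number g \<rho> \<and> \<rho> \<notin> \<rat> \<and> (\<exists>m::int. \<rho> = \<theta> + of_int m)))"

text \<open>The germ \<open>\<psi>\<close> is the inverse germ of \<open>\<phi>\<close>.\<close>

definition germ_linearizable :: "real \<Rightarrow> (complex \<Rightarrow> complex) \<Rightarrow> bool" where
  "germ_linearizable \<theta> f \<longleftrightarrow>
     (\<exists>\<phi> \<psi>. \<phi> analytic_on {0} \<and> \<phi> 0 = 0 \<and> deriv \<phi> 0 \<noteq> 0 \<and>
        \<psi> analytic_on {0} \<and> (\<forall>\<^sub>F z in nhds 0. \<psi> (\<phi> z) = z) \<and>
        (\<forall>\<^sub>F z in nhds 0. \<psi> (f (\<phi> z)) = cis (2 * pi * \<theta>) * z))"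

end

theory Submission
  imports Defs
begin

text \<open>
  Let \<open>\<phi>\<close> be holomorphic near \<open>K\<close>. The main point is that the Birkhoff averages of \<open>\<phi>\<close> along \<open>f\<close> converge to \<open>\<phi> 0\<close>
  uniformly on \<open>K\<close>. In the exterior coordinate \<open>f\<close> extends to an analytic circle
  diffeomorphism \<open>g\<close> with irrational rotation number. Denjoy's distortion estimate along the return times \<open>q < Q\<close> gives a
  closed curve around \<open>K\<close>, at height comparable to \<open>\<bar>x - g\<^sup>q x\<bar>\<close> above the circle, whose
  points all have orbits that follow one another, after a time shift of at most \<open>Q\<close>, during
  \<open>L Q\<close> iterations. Along such an orbit the discs of Whitney size have disjoint images within
  each block of \<open>Q\<close> iterates; by Bloch's theorem and an area count the sum of the derivatives of
  \<open>f\<^sup>j \<circ> h\<close> is of order \<open>sqrt Q\<close>, so the Birkhoff averages are almost constant on the curve, and by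
  the maximum principle inside it, where they take the value \<open>\<phi> 0\<close> at 0.

  Since \<open>f\<close> is not linearizable, 0 is a boundary point of \<open>K\<close>. As \<open>K\<close> is full, 0 is then a peak
  point for the functions holomorphic near \<open>K\<close>, and averaging a function that peaks at 0
  bounds the time an orbit spends away from 0.
\<close>

section \<open>Circle diffeomorphisms with irrational rotation number\<close>

text \<open>The boundary of \<open>K\<close> can be wild, so near the circle the Riemann map is used
  only through being bounded and injective. A Cauchy estimate for each term of a Birkhoff sum of
  length \<open>N\<close> would allow a variation of order \<open>N\<close> along a path of one
  Whitney length, which is useless. The gain comes from disjointness: discs with disjoint images in
  a bounded set have square-summable radii, and Cauchy-Schwarz turns a block of \<open>Q\<close>
  terms into \<open>sqrt Q\<close>. Matching two orbits costs a shift of at most \<open>Q\<close>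
  out of \<open>L Q\<close> steps. Hence the order of choices: first \<open>L\<close> large, which
  makes the shift cheap, then \<open>Q\<close> large. Every geometric constant may depend on
  \<open>L\<close> but not on \<open>Q\<close>, and this uniformity is what Denjoy's bound provides.

  For the last part, the basic square root function has value 1/2 at 0 but is only bounded by 4
  elsewhere, so it need not peak at 0. Summing \<open>n\<close> of them at separated scales gives
  \<open>n / 2\<close> at 0 and a maximal excess of \<open>4 + n \<epsilon>\<close>, which is small
  relative to \<open>n\<close>.\<close>

locale circle_map =
  fixes P P' :: "real \<Rightarrow> real" and \<rho> \<kappa> :: real
  assumes P_deriv: "\<And>x. (P has_real_derivative P' x) (at x)"
    and P'_pos: "\<And>x. 0 < P' x"
    and P_shift: "\<And>x. P (x + 1) = P x + 1"
    and P_rot: "\<And>x. (\<lambda>n. ((P ^^ n) x - x) / real n) \<longlonglongrightarrow> \<rho>"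
    and \<rho>_irr: "\<rho> \<notin> \<rat>"
    and P'_lip: "\<And>x y. \<bar>ln (P' x) - ln (P' y)\<bar> \<le> \<kappa> * \<bar>x - y\<bar>"
begin

definition DP :: "nat \<Rightarrow> real \<Rightarrow> real" where
  "DP j x = (\<Prod>i<j. P' ((P ^^ i) x))"

lemma DP_0 [simp]: "DP 0 x = 1"
  by (simp add: DP_def)

lemma DP_Suc: "DP (Suc j) x = P' ((P ^^ j) x) * DP j x"
  by (simp add: DP_def)

lemma DP_pos: "0 < DP j x"
  unfolding DP_def by (intro prod_pos) (auto simp: P'_pos)

lemma iter_deriv: "((P ^^ j) has_real_derivative DP j x) (at x)"
proof (induction j)
  case 0
  then show ?case by (simp add: id_def DERIV_ident)
next
  case (Suc j)
  have "(P \<circ> (P ^^ j) has_real_derivative P' ((P ^^ j) x) * DP j x) (at x)"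
    by (intro DERIV_chain P_deriv Suc)
  then show ?case by (simp add: DP_Suc o_def)
qed

lemma iter_strict_mono: "strict_mono (P ^^ j)"
proof -
  have "x < y \<Longrightarrow> (P ^^ j) x < (P ^^ j) y" for x y
    using DERIV_pos_imp_increasing[of x y "P ^^ j"] iter_deriv DP_pos by blast
  then show ?thesis by (simp add: strict_mono_def)
qed

lemma iter_less_iff [simp]: "(P ^^ j) x < (P ^^ j) y \<longleftrightarrow> x < y"
  using iter_strict_mono strict_mono_less by blast

lemma iter_le_iff [simp]: "(P ^^ j) x \<le> (P ^^ j) y \<longleftrightarrow> x \<le> y"
  using iter_strict_mono strict_mono_less_eq by blast

lemma iter_continuous: "continuous_on S (P ^^ j)"
  by (meson DERIV_isCont continuous_at_imp_continuous_on iter_deriv)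

lemma P_shift_int: "P (x + of_int s) = P x + of_int s"
proof -
  have nat: "P (x + of_nat n) = P x + of_nat n" for n x
  proof (induction n)
    case (Suc n)
    show ?case using P_shift[of "x + of_nat n"] Suc by (simp add: algebra_simps)
  qed simp
  show ?thesis
  proof (cases "s \<ge> 0")
    case True
    then show ?thesis using nat[of x "nat s"] by simp
  next
    case False
    then show ?thesis using nat[of "x + of_int s" "nat (-s)"] by simp
  qed
qed

lemma iter_shift: "(P ^^ j) (x + of_int s) = (P ^^ j) x + of_int s"
  by (induction j) (auto simp: P_shift_int)

lemma iter_add: "(P ^^ (i + j)) x = (P ^^ i) ((P ^^ j) x)"
  by (simp add: funpow_add)

lemma DP_add: "DP (i + j) x = DP i ((P ^^ j) x) * DP j x"
  by (induction i) (auto simp: DP_Suc funpow_add)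

lemma P'_shift: "P' (x + of_int s) = P' x"
proof -
  have "((\<lambda>y. P (y + of_int s)) has_real_derivative P' (x + of_int s)) (at x)"
    using P_deriv[of "x + of_int s"] by (simp add: DERIV_shift)
  moreover have "((\<lambda>y. P (y + of_int s)) has_real_derivative P' x) (at x)"
    unfolding P_shift_int by (auto intro!: derivative_eq_intros P_deriv)
  ultimately show ?thesis by (rule DERIV_unique)
qed

lemma DP_shift: "DP j (x + of_int s) = DP j x"
  by (induction j) (auto simp: DP_Suc iter_shift P'_shift)

lemma nonzero_translation: "k > 0 \<Longrightarrow> real k * \<rho> + of_int b \<noteq> 0"
proof
  assume "k > 0" "real k * \<rho> + of_int b = 0"
  then have "\<rho> = - of_int b / of_nat k" by (simp add: field_simps)
  then show False using \<rho>_irr by (auto simp del: minus_divide_left)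
qed

text \<open>Integer translations commute with \<open>P\<close>, so
  \<open>(P ^^ (k * n)) x + of_int (int n * b)\<close> is the \<open>n\<close>-th iterate at
  \<open>x\<close> of the map \<open>y \<mapsto> (P ^^ k) y + of_int b\<close>. This recursion
  drives the three inductions on \<open>n\<close> that follow.\<close>

lemma iter_mult_Suc:
  "(P ^^ (k * Suc n)) x + of_int (int (Suc n) * b)
    = (P ^^ k) ((P ^^ (k * n)) x + of_int (int n * b)) + of_int b"
  unfolding iter_shift by (simp add: iter_add distrib_right)

lemma iter_mult_ge:
  assumes "\<And>x. x < (P ^^ k) x + of_int b"
  shows "x \<le> (P ^^ (k * n)) x + of_int (int n * b)"
proof (induction n)
  case (Suc n)
  have "x \<le> (P ^^ (k * n)) x + of_int (int n * b)" by fact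
  also have "\<dots> < (P ^^ k) ((P ^^ (k * n)) x + of_int (int n * b)) + of_int b" by (rule assms)
  also have "\<dots> = (P ^^ (k * Suc n)) x + of_int (int (Suc n) * b)"
    by (rule iter_mult_Suc [symmetric])
  finally show ?case by simp
qed simp

lemma iter_mult_le:
  assumes "\<And>x. (P ^^ k) x + of_int b < x"
  shows "(P ^^ (k * n)) x + of_int (int n * b) \<le> x"
proof (induction n)
  case (Suc n)
  have "(P ^^ (k * Suc n)) x + of_int (int (Suc n) * b)
      = (P ^^ k) ((P ^^ (k * n)) x + of_int (int n * b)) + of_int b"
    by (rule iter_mult_Suc)
  also have "\<dots> < (P ^^ (k * n)) x + of_int (int n * b)" by (rule assms)
  also have "\<dots> \<le> x" by fact
  finally show ?case by simp
qed simp

lemma rot_subseq: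
  assumes "k > 0"
  shows "(\<lambda>n. ((P ^^ (k * n)) x + of_int (int n * b) - x) / real n) \<longlonglongrightarrow> real k * \<rho> + of_int b"
proof -
  have "(\<lambda>n. ((P ^^ (k * n)) x - x) / real (k * n)) \<longlonglongrightarrow> \<rho>"
  proof (rule filterlim_compose[OF P_rot[of x]])
    show "filterlim (\<lambda>n. k * n) sequentially sequentially"
      using assms by (metis mult.commute mult_nat_left_at_top)
  qed
  then have "(\<lambda>n. real k * (((P ^^ (k * n)) x - x) / real (k * n)) + of_int b) \<longlonglongrightarrow> real k * \<rho> + of_int b"
    by (intro tendsto_intros)
  moreover have "\<forall>\<^sub>F n in sequentially.
      real k * (((P ^^ (k * n)) x - x) / real (k * n)) + of_int b
      = ((P ^^ (k * n)) x + of_int (int n * b) - x) / real n"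
    using eventually_gt_at_top[of 0] by eventually_elim (use assms in \<open>simp add: field_simps\<close>)
  ultimately show ?thesis by (rule Lim_transform_eventually)
qed

text \<open>A zero of the displacement would be a periodic point on the circle, along which the
  translation number \<open>k \<rho> + b\<close> would be 0, against irrationality. So the
  continuous displacement keeps one sign on the line, and iterating shows that the translation
  number cannot have the opposite one.\<close>

lemma displacement_sign:
  assumes "k > 0"
  shows "(\<forall>x. x < (P ^^ k) x + of_int b) \<and> 0 < real k * \<rho> + of_int b
    \<or> (\<forall>x. (P ^^ k) x + of_int b < x) \<and> real k * \<rho> + of_int b < 0"
proof -
  define d where "d x = (P ^^ k) x + of_int b - x" for x
  have cont: "continuous_on UNIV d"
    unfolding d_def by (intro continuous_intros iter_continuous)
  have nz: "d x \<noteq> 0" for x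
  proof
    assume "d x = 0"
    then have *: "(P ^^ k) x = x - of_int b" by (simp add: d_def)
    have "(P ^^ (k * n)) x + of_int (int n * b) = x" for n
    proof (induction n)
      case (Suc n)
      have "(P ^^ (k * Suc n)) x + of_int (int (Suc n) * b)
          = (P ^^ k) ((P ^^ (k * n)) x + of_int (int n * b)) + of_int b"
        by (rule iter_mult_Suc)
      then show ?case unfolding Suc by (simp add: *)
    qed simp
    then have "(\<lambda>n::nat. 0::real) \<longlonglongrightarrow> real k * \<rho> + of_int b"
      using rot_subseq[OF assms, of x b] by simp
    then have "real k * \<rho> + of_int b = 0"
      using LIMSEQ_unique tendsto_const by blast
    then show False using nonzero_translation[OF assms] by blast
  qed
  consider "\<forall>x. d x > 0" | "\<forall>x. d x < 0"
  proof -
    have int: "is_interval (range d)"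
      using cont connected_continuous_image is_interval_connected_1 by blast
    have nz': "0 \<notin> range d"
      using nz by (metis imageE)
    have same: "0 < d y" if "0 < d x" for x y
      using int nz' that nz[of y] unfolding is_interval_1 by (meson linorder_neqE_linordered_idom less_imp_le rangeI)
    show ?thesis
    proof (cases "0 < d 0")
      case True
      then show ?thesis using same that(1) by blast
    next
      case False
      then have "d x < 0" for x using same[of x 0] nz[of x] by linarith
      then show ?thesis using that(2) by blast
    qed
  qed
  then show ?thesis
  proof cases
    case 1
    then have pos: "x < (P ^^ k) x + of_int b" for x by (simp add: d_def)
    have "0 \<le> real k * \<rho> + of_int b"
      using rot_subseq[OF assms, of 0 b]
      by (rule LIMSEQ_le_const) (use iter_mult_ge[OF pos, of 0] in auto)
    with nonzero_translation[OF assms, of b] pos show ?thesis by (simp add: less_le)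
  next
    case 2
    then have neg: "(P ^^ k) x + of_int b < x" for x by (simp add: d_def)
    have "real k * \<rho> + of_int b \<le> 0"
      using rot_subseq[OF assms, of 0 b]
      by (rule LIMSEQ_le_const2)
        (use iter_mult_le[OF neg, of _ 0] in \<open>auto intro!: divide_nonpos_nonneg exI[of _ 0]\<close>)
    with nonzero_translation[OF assms, of b] neg show ?thesis by (simp add: less_le)
  qed
qed

text \<open>After cancelling the smaller of the two times, this is \<open>displacement_sign\<close>
  applied at an orbit point. It lets later comparisons of orbit points be done by arithmetic with
  \<open>\<rho>\<close>.\<close>

lemma orbit_order:
  "(P ^^ i) x + of_int s < (P ^^ j) x + of_int t \<longleftrightarrow> real i * \<rho> + of_int s < real j * \<rho> + of_int t"
proof -
  have *: "((P ^^ i) x < (P ^^ (i + k)) x + of_int b \<longleftrightarrow> 0 < real k * \<rho> + of_int b) \<and>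
      ((P ^^ (i + k)) x + of_int b < (P ^^ i) x \<longleftrightarrow> real k * \<rho> + of_int b < 0)" for i k b
  proof (cases "k = 0")
    case False
    have "(P ^^ (i + k)) x = (P ^^ k) ((P ^^ i) x)"
      by (metis add.commute iter_add)
    then show ?thesis
      using displacement_sign[of k b] False by (metis gr0I not_less_iff_gr_or_eq)
  qed simp
  show ?thesis
  proof (cases "i \<le> j")
    case True
    then obtain k where "j = i + k" using le_Suc_ex by blast
    then show ?thesis using *[of i k "t - s"] by (simp add: algebra_simps)
  next
    case False
    then obtain k where "i = j + k" using le_Suc_ex by (metis nat_le_linear)
    then show ?thesis using *[of j k "s - t"] by (simp add: algebra_simps)
  qed
qed

lemma orbit_order_le:
  "real i * \<rho> + of_int s \<le> real j * \<rho> + of_int t \<longleftrightarrow> (P ^^ i) x + of_int s \<le> (P ^^ j) x + of_int t"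
  using orbit_order[of j x t i s] by (simp add: not_less[symmetric])

lemma distortion:
  "\<bar>ln (DP j a) - ln (DP j b)\<bar> \<le> \<kappa> * (\<Sum>i<j. \<bar>(P ^^ i) a - (P ^^ i) b\<bar>)"
proof (induction j)
  case (Suc j)
  have "ln (DP (Suc j) x) = ln (P' ((P ^^ j) x)) + ln (DP j x)" for x
    by (simp add: DP_Suc ln_mult_pos P'_pos DP_pos)
  then show ?case
    using Suc P'_lip[of "(P ^^ j) a" "(P ^^ j) b"] by (simp add: algebra_simps)
qed simp

lemma \<kappa>_nonneg: "0 \<le> \<kappa>"
  using P'_lip[of 1 0] by simp

lemma iter_mvt:
  obtains \<xi> where "\<xi> \<in> closed_segment a b" "(P ^^ j) b - (P ^^ j) a = DP j \<xi> * (b - a)"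
proof -
  consider "a < b" | "a = b" | "b < a" by linarith
  then show ?thesis
  proof cases
    case 1
    from MVT2[OF 1, of "P ^^ j" "DP j"] iter_deriv obtain z
      where "a < z" "z < b" "(P ^^ j) b - (P ^^ j) a = (b - a) * DP j z" by blast
    then show ?thesis using that[of z] 1 by (auto simp: closed_segment_eq_real_ivl)
  next
    case 2
    then show ?thesis using that[of a] by simp
  next
    case 3
    from MVT2[OF 3, of "P ^^ j" "DP j"] iter_deriv obtain z
      where "b < z" "z < a" "(P ^^ j) a - (P ^^ j) b = (a - b) * DP j z" by blast
    then show ?thesis using that[of z] 3 by (auto simp: closed_segment_eq_real_ivl algebra_simps)
  qed
qed

end


section \<open>Closest return times and Denjoy's distortion bounds\<close>

lemma sum_lessThan_add:
  fixes f :: "nat \<Rightarrow> 'a::comm_monoid_add"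
  shows "(\<Sum>j<m + n. f j) = (\<Sum>j<m. f j) + (\<Sum>j<n. f (j + m))"
  by (induction n) (simp_all add: ac_simps)

lemma sum_disjoint_intervals_le:
  fixes l r :: "'a \<Rightarrow> real"
  assumes "finite I" and sub: "\<And>i. i \<in> I \<Longrightarrow> c \<le> l i \<and> l i \<le> r i \<and> r i \<le> c + 1"
    and disj: "\<And>i j. i \<in> I \<Longrightarrow> j \<in> I \<Longrightarrow> i \<noteq> j \<Longrightarrow> r i \<le> l j \<or> r j \<le> l i"
  shows "(\<Sum>i\<in>I. r i - l i) \<le> 1"
proof -
  have "(\<Sum>i\<in>I. r i - l i) = (\<Sum>i\<in>I. measure lborel {l i<..<r i})"
    using sub by (intro sum.cong) auto
  also have "\<dots> = measure lborel (\<Union>i\<in>I. {l i<..<r i})"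
  proof (rule measure_UNION'[symmetric])
    show "pairwise (\<lambda>i j. disjnt {l i<..<r i} {l j<..<r j}) I"
      unfolding pairwise_def disjnt_def
    proof safe
      fix i j x assume "i \<in> I" "j \<in> I" "i \<noteq> j" "x \<in> {l i<..<r i}" "x \<in> {l j<..<r j}"
      with disj[of i j] show "x \<in> {}" by auto
    qed
    show "{l i<..<r i} \<in> fmeasurable lborel" if "i \<in> I" for i
      using sub[OF that] by (intro fmeasurableI) auto
  qed (use assms in auto)
  also have "\<dots> \<le> measure lborel {c..c+1}"
  proof (rule measure_mono_fmeasurable)
    show "(\<Union>i\<in>I. {l i<..<r i}) \<subseteq> {c..c + 1}"
      using sub by fastforce
    show "(\<Union>i\<in>I. {l i<..<r i}) \<in> sets lborel" using \<open>finite I\<close> by auto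
  qed (auto intro: fmeasurable_compact)
  finally show ?thesis by simp
qed

text \<open>The return times \<open>q < Q\<close> behave like consecutive denominators of convergents of \<open>\<rho>\<close>, but
  \<open>q \<rho> + p\<close> and \<open>Q \<rho> + p'\<close> are not required to have opposite signs.\<close>

locale circle_return = circle_map +
  fixes q Q :: nat and p p' :: int
  assumes q_pos: "0 < q" and q_less: "q < Q"
    and closer: "\<bar>real Q * \<rho> + of_int p'\<bar> < \<bar>real q * \<rho> + of_int p\<bar>"
    and separated: "\<And>i s. 0 < i \<Longrightarrow> i < Q \<Longrightarrow> \<bar>real q * \<rho> + of_int p\<bar> \<le> \<bar>real i * \<rho> + of_int s\<bar>"
begin

definition "\<delta> = real q * \<rho> + of_int p"

definition "G x = (P ^^ q) x + of_int p"

text \<open>The local unit of length: radii of discs, depths below the real line and distances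
  between orbit points are all measured against the gap between \<open>x\<close> and its
  \<open>q\<close>-th return.\<close>

definition "D x = \<bar>G x - x\<bar>"

lemma \<delta>_nz: "\<delta> \<noteq> 0"
  unfolding \<delta>_def using nonzero_translation q_pos by blast

lemma \<delta>_cases: obtains "0 < \<delta>" | "\<delta> < 0"
  using \<delta>_nz by linarith

lemma \<delta>_le_1: "\<bar>\<delta>\<bar> \<le> 1"
proof -
  have "\<bar>\<delta>\<bar> \<le> \<bar>real 1 * \<rho> + of_int (- \<lfloor>\<rho>\<rfloor>)\<bar>"
    unfolding \<delta>_def by (rule separated) (use q_pos q_less in auto)
  also have "\<dots> \<le> 1" by (simp add: abs_le_iff) linarith
  finally show ?thesis .
qed

lemma G_shift: "G (x + of_int s) = G x + of_int s"
  by (simp add: G_def iter_shift)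

lemma D_shift: "D (x + of_int s) = D x"
  by (simp add: D_def G_shift)

lemma iter_G: "(P ^^ j) (G x) = G ((P ^^ j) x)"
  unfolding G_def iter_shift by (simp flip: iter_add add: add.commute)

lemma G_less_iff [simp]: "G x < G y \<longleftrightarrow> x < y"
  by (simp add: G_def)

lemma G_le_iff [simp]: "G x \<le> G y \<longleftrightarrow> x \<le> y"
  by (simp add: G_def)

lemma D_continuous: "continuous_on S D"
  unfolding D_def G_def by (intro continuous_intros iter_continuous)

lemma G_orbit: "G ((P ^^ j) x) + of_int s = (P ^^ (j + q)) x + of_int (p + s)"
  unfolding G_def by (metis add.assoc add.commute iter_add of_int_add)

lemma G_orbit': "G ((P ^^ j) x + of_int s) = (P ^^ (j + q)) x + of_int (p + s)"
  by (simp only: G_shift G_orbit)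

lemma G_dir: "\<delta> > 0 \<Longrightarrow> x < G x" "\<delta> < 0 \<Longrightarrow> G x < x"
  using orbit_order[of 0 x 0 q p] orbit_order[of q x p 0 0]
  by (auto simp: G_def \<delta>_def)

lemma G_dir2: "\<delta> > 0 \<Longrightarrow> x < G (G x)" "\<delta> < 0 \<Longrightarrow> G (G x) < x"
  using G_dir[of x] G_dir[of "G x"] by linarith+

lemma D_pos: "0 < D x"
  by (rule \<delta>_cases) (use G_dir[of x] in \<open>auto simp: D_def\<close>)

lemma block_order:
  assumes "i < Q" "j < Q" "(i, s) \<noteq> (j, t)"
  shows "\<bar>\<delta>\<bar> \<le> \<bar>(real j * \<rho> + of_int t) - (real i * \<rho> + of_int s)\<bar>"
proof -
  consider "i < j" | "j < i" | "i = j" by linarith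
  then show ?thesis
  proof cases
    case 1
    then show ?thesis
      using separated[of "j - i" "t - s"] assms by (simp add: \<delta>_def of_nat_diff algebra_simps)
  next
    case 2
    then show ?thesis
      using separated[of "i - j" "s - t"] assms
      by (simp add: \<delta>_def of_nat_diff algebra_simps) linarith
  next
    case 3
    then have "s \<noteq> t" using assms by simp
    then have "1 \<le> \<bar>t - s\<bar>" by linarith
    then have "(1::real) \<le> \<bar>of_int t - of_int s\<bar>" by linarith
    then show ?thesis using 3 \<delta>_le_1 by simp
  qed
qed

text \<open>On the side of the rotation \<open>G\<close> adds \<open>\<delta>\<close>, and two orbit
  points with times below \<open>Q\<close> are at least \<open>\<bar>\<delta>\<bar>\<close> apart
  there. Transported by \<open>orbit_order_le\<close>, this says that the intervals from a point to
  its \<open>G\<close>-image overlap at most at endpoints, modulo 1.\<close>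

lemma block_separated:
  assumes "i < Q" "j < Q" "(i, s) \<noteq> (j, t)"
  shows "\<delta> > 0 \<Longrightarrow> G ((P ^^ i) x) + of_int s \<le> (P ^^ j) x + of_int t
            \<or> G ((P ^^ j) x) + of_int t \<le> (P ^^ i) x + of_int s"
    and "\<delta> < 0 \<Longrightarrow> (P ^^ i) x + of_int s \<le> G ((P ^^ j) x) + of_int t
            \<or> (P ^^ j) x + of_int t \<le> G ((P ^^ i) x) + of_int s"
  using block_order[OF assms]
  unfolding G_orbit orbit_order_le[symmetric] \<delta>_def by (auto simp: algebra_simps abs_if split: if_splits)

text \<open>The intervals between \<open>(P ^^ j) y\<close> and its \<open>G\<close>-image for
  \<open>j < Q\<close> do not overlap modulo 1, so after suitable integer translations they fit into
  one period.\<close>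

lemma block_sum_le: "(\<Sum>j<Q. \<bar>(P ^^ j) y - (P ^^ j) (G y)\<bar>) \<le> 1"
proof -
  define lo where "lo j = min ((P ^^ j) y) (G ((P ^^ j) y))" for j
  define hi where "hi j = max ((P ^^ j) y) (G ((P ^^ j) y))" for j
  define s where "s j = - \<lfloor>lo j - lo 0\<rfloor>" for j
  have disj: "hi i + of_int a \<le> lo j + of_int b \<or> hi j + of_int b \<le> lo i + of_int a"
    if "i < Q" "j < Q" "(i, a) \<noteq> (j, b)" for i j a b
  proof (rule \<delta>_cases)
    assume "0 < \<delta>"
    then show ?thesis
      using block_separated(1)[OF that, of y] G_dir(1)[of "(P ^^ i) y"] G_dir(1)[of "(P ^^ j) y"]
      unfolding lo_def hi_def by (simp add: min_def max_def)
  next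
    assume "\<delta> < 0"
    then show ?thesis
      using block_separated(2)[OF that, of y] G_dir(2)[of "(P ^^ i) y"] G_dir(2)[of "(P ^^ j) y"]
      unfolding lo_def hi_def by (auto simp add: min_def max_def)
  qed
  have "(\<Sum>j<Q. (hi j + of_int (s j)) - (lo j + of_int (s j))) \<le> 1"
  proof (rule sum_disjoint_intervals_le[where c = "lo 0"])
    fix i assume i: "i \<in> {..<Q}"
    have 1: "lo 0 \<le> lo i + of_int (s i)" "lo i + of_int (s i) < lo 0 + 1"
      unfolding s_def by linarith+
    have le: "lo i + of_int (s i) \<le> hi i + of_int (s i)" by (simp add: lo_def hi_def)
    have lh: "lo 0 < hi 0"
      by (rule \<delta>_cases) (use G_dir[of y] in \<open>auto simp: lo_def hi_def min_def max_def\<close>)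
    \<comment> \<open>The translate by 1 of interval 0 bounds interval \<open>i\<close> on the
      right, which keeps the latter inside the period starting at \<open>lo 0\<close>.\<close>
    have "(i, s i) \<noteq> (0, 1)" using 1 by auto
    then have "hi i + of_int (s i) \<le> lo 0 + 1"
      using disj[of i 0 "s i" 1] i q_less 1 lh by auto
    then show "lo 0 \<le> lo i + of_int (s i) \<and> lo i + of_int (s i) \<le> hi i + of_int (s i) \<and>
        hi i + of_int (s i) \<le> lo 0 + 1"
      using 1 le by simp
  qed (use disj in auto)
  moreover have "hi j - lo j = \<bar>(P ^^ j) y - (P ^^ j) (G y)\<bar>" for j
    by (simp add: hi_def lo_def iter_G)
  ultimately show ?thesis by simp
qed

lemma blocks_sum_le: "(\<Sum>j<L * Q. \<bar>(P ^^ j) y - (P ^^ j) (G y)\<bar>) \<le> real L"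
proof (induction L)
  case (Suc L)
  have "(\<Sum>j<Suc L * Q. \<bar>(P ^^ j) y - (P ^^ j) (G y)\<bar>)
      = (\<Sum>j<L * Q. \<bar>(P ^^ j) y - (P ^^ j) (G y)\<bar>)
        + (\<Sum>j<Q. \<bar>(P ^^ (j + L * Q)) y - (P ^^ (j + L * Q)) (G y)\<bar>)"
    using sum_lessThan_add[of _ "L * Q" Q] by (simp add: add.commute)
  also have "(\<Sum>j<Q. \<bar>(P ^^ (j + L * Q)) y - (P ^^ (j + L * Q)) (G y)\<bar>) \<le> 1"
    using block_sum_le[of "(P ^^ (L * Q)) y"] by (simp only: iter_add iter_G)
  finally show ?case using Suc by simp
qed simp

text \<open>Take the last orbit point of time below \<open>Q\<close>, over all integer translates,
  that has not passed \<open>x\<close> in the direction of \<open>G\<close>. If another such orbit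
  point follows it by less than two steps of \<open>G\<close>, extremality puts that point beyond
  \<open>x\<close>, and monotonicity of \<open>G\<close> puts it before
  \<open>G (G x)\<close>.\<close>

lemma hitting:
  obtains j s where "j < Q" "(P ^^ j) \<xi> + of_int s \<in> closed_segment x (G (G x))"
proof (cases "\<delta> > 0")
  case True
  define v where "v j = (P ^^ j) \<xi> + of_int \<lfloor>x - (P ^^ j) \<xi>\<rfloor>" for j
  have "finite (v ` {..<Q})" "v ` {..<Q} \<noteq> {}" using q_less by auto
  then have "Max (v ` {..<Q}) \<in> v ` {..<Q}" by (rule Max_in)
  then obtain j where j: "j < Q" and vj_max: "Max (v ` {..<Q}) = v j" by auto
  have max: "v i \<le> v j" if "i < Q" for i
    unfolding vj_max[symmetric] using that by (intro Max_ge) auto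
  define s where "s = \<lfloor>x - (P ^^ j) \<xi>\<rfloor>"
  have vj: "v j = (P ^^ j) \<xi> + of_int s" by (simp add: v_def s_def)
  have vx: "v j \<le> x" unfolding v_def by linarith
  have big: "x < (P ^^ i) \<xi> + of_int t" if "i < Q" "v j < (P ^^ i) \<xi> + of_int t" for i t
  proof (rule ccontr)
    assume "\<not> ?thesis"
    then have "t \<le> \<lfloor>x - (P ^^ i) \<xi>\<rfloor>" by (simp add: le_floor_iff)
    then have "(P ^^ i) \<xi> + of_int t \<le> v i" by (simp add: v_def)
    then show False using max[OF that(1)] that(2) by simp
  qed
  have GG: "G (G ((P ^^ j) \<xi> + of_int s)) = (P ^^ (j + q + q)) \<xi> + of_int (p + p + s)"
    by (simp only: G_orbit' add.assoc)
  \<comment> \<open>Time \<open>j + q\<close> is taken while it is below \<open>Q\<close>, and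
    \<open>j + q - Q\<close> otherwise. The latter moves by
    \<open>\<delta> - (Q \<rho> + p')\<close>, which lies strictly between 0 and
    \<open>2 \<delta>\<close> because \<open>Q\<close> returns closer than \<open>q\<close>; this is
    why the window reaches to the second \<open>G\<close>-image.\<close>
  obtain i t where it: "i < Q" "v j < (P ^^ i) \<xi> + of_int t" "(P ^^ i) \<xi> + of_int t < G (G (v j))"
  proof (cases "j + q < Q")
    case True
    then show ?thesis
      using that[of "j + q" "s + p"] \<open>\<delta> > 0\<close> unfolding vj GG orbit_order
      by (simp add: \<delta>_def algebra_simps)
  next
    case False
    then show ?thesis
      using that[of "j + q - Q" "s + p - p'"] \<open>\<delta> > 0\<close> j q_less closer unfolding vj GG orbit_order
      by (simp add: \<delta>_def algebra_simps of_nat_diff)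
  qed
  have "x < (P ^^ i) \<xi> + of_int t" using big it by blast
  moreover have "(P ^^ i) \<xi> + of_int t \<le> G (G x)"
    using it(3) vx by (meson G_le_iff less_le_trans less_imp_le order.trans)
  ultimately show ?thesis
    using that[of i t] it(1) by (simp add: closed_segment_eq_real_ivl)
next
  case False
  then have neg: "\<delta> < 0" using \<delta>_nz by simp
  define v where "v j = (P ^^ j) \<xi> + of_int \<lceil>x - (P ^^ j) \<xi>\<rceil>" for j
  have "finite (v ` {..<Q})" "v ` {..<Q} \<noteq> {}" using q_less by auto
  then have "Min (v ` {..<Q}) \<in> v ` {..<Q}" by (rule Min_in)
  then obtain j where j: "j < Q" and vj_min: "Min (v ` {..<Q}) = v j" by auto
  have min: "v j \<le> v i" if "i < Q" for i
    unfolding vj_min[symmetric] using that by (intro Min_le) auto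
  define s where "s = \<lceil>x - (P ^^ j) \<xi>\<rceil>"
  have vj: "v j = (P ^^ j) \<xi> + of_int s" by (simp add: v_def s_def)
  have vx: "x \<le> v j" unfolding v_def by linarith
  have big: "(P ^^ i) \<xi> + of_int t < x" if "i < Q" "(P ^^ i) \<xi> + of_int t < v j" for i t
  proof (rule ccontr)
    assume "\<not> ?thesis"
    then have "\<lceil>x - (P ^^ i) \<xi>\<rceil> \<le> t" by (simp add: ceiling_le_iff)
    then have "v i \<le> (P ^^ i) \<xi> + of_int t" by (simp add: v_def)
    then show False using min[OF that(1)] that(2) by simp
  qed
  have GG: "G (G ((P ^^ j) \<xi> + of_int s)) = (P ^^ (j + q + q)) \<xi> + of_int (p + p + s)"
    by (simp only: G_orbit' add.assoc)
  obtain i t where it: "i < Q" "(P ^^ i) \<xi> + of_int t < v j" "G (G (v j)) < (P ^^ i) \<xi> + of_int t"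
  proof (cases "j + q < Q")
    case True
    then show ?thesis
      using that[of "j + q" "s + p"] neg unfolding vj GG orbit_order
      by (simp add: \<delta>_def algebra_simps)
  next
    case False
    then show ?thesis
      using that[of "j + q - Q" "s + p - p'"] neg j q_less closer unfolding vj GG orbit_order
      by (simp add: \<delta>_def algebra_simps of_nat_diff)
  qed
  have "(P ^^ i) \<xi> + of_int t < x" using big it by blast
  moreover have "G (G x) \<le> (P ^^ i) \<xi> + of_int t"
    using it(3) vx by (meson G_le_iff le_less_trans less_imp_le order.trans)
  ultimately show ?thesis
    using that[of i t] it(1) by (auto simp: closed_segment_eq_real_ivl)
qed

lemma two_blocks_sum_le: "(\<Sum>j<L * Q. \<bar>(P ^^ j) y - (P ^^ j) (G (G y))\<bar>) \<le> 2 * real L"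
proof -
  have "(\<Sum>j<L * Q. \<bar>(P ^^ j) y - (P ^^ j) (G (G y))\<bar>)
      \<le> (\<Sum>j<L * Q. \<bar>(P ^^ j) y - (P ^^ j) (G y)\<bar> + \<bar>(P ^^ j) (G y) - (P ^^ j) (G (G y))\<bar>)"
    by (intro sum_mono) linarith
  then show ?thesis
    using blocks_sum_le[where L = L and y = y] blocks_sum_le[where L = L and y = "G y"] by (simp add: sum.distrib)
qed

text \<open>Iterates are monotone, so two points of the window never separate more than its
  endpoints, and these distances sum to at most \<open>2 L\<close> over \<open>L Q\<close> steps.
  The bound involves neither \<open>q\<close> nor \<open>Q\<close>.\<close>

lemma distortion_window:
  assumes "a \<in> closed_segment y (G (G y))" "b \<in> closed_segment y (G (G y))" "j \<le> L * Q"
  shows "\<bar>ln (DP j a) - ln (DP j b)\<bar> \<le> 2 * \<kappa> * real L"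
proof -
  have "\<bar>(P ^^ i) a - (P ^^ i) b\<bar> \<le> \<bar>(P ^^ i) y - (P ^^ i) (G (G y))\<bar>" for i
  proof (cases "y \<le> G (G y)")
    case True
    then have "y \<le> a" "a \<le> G (G y)" "y \<le> b" "b \<le> G (G y)"
      using assms(1,2) by (auto simp: closed_segment_eq_real_ivl)
    then have "(P ^^ i) a \<in> {l..u}" "(P ^^ i) b \<in> {l..u}"
      if "l = min ((P ^^ i) y) ((P ^^ i) (G (G y)))" "u = max ((P ^^ i) y) ((P ^^ i) (G (G y)))" for l u
      using that by (simp_all add: min_le_iff_disj le_max_iff_disj)
    from this[OF refl refl] show ?thesis by auto
  next
    case False
    then have "a \<le> y" "G (G y) \<le> a" "b \<le> y" "G (G y) \<le> b"
      using assms(1,2) by (auto simp: closed_segment_eq_real_ivl)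
    then have "(P ^^ i) a \<in> {l..u}" "(P ^^ i) b \<in> {l..u}"
      if "l = min ((P ^^ i) y) ((P ^^ i) (G (G y)))" "u = max ((P ^^ i) y) ((P ^^ i) (G (G y)))" for l u
      using that by (simp_all add: min_le_iff_disj le_max_iff_disj)
    from this[OF refl refl] show ?thesis by auto
  qed
  then have "(\<Sum>i<j. \<bar>(P ^^ i) a - (P ^^ i) b\<bar>) \<le> (\<Sum>i<j. \<bar>(P ^^ i) y - (P ^^ i) (G (G y))\<bar>)"
    by (intro sum_mono)
  also have "\<dots> \<le> (\<Sum>i<L * Q. \<bar>(P ^^ i) y - (P ^^ i) (G (G y))\<bar>)"
    using assms(3) by (intro sum_mono2) auto
  also have "\<dots> \<le> 2 * real L" by (rule two_blocks_sum_le)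
  finally have "\<kappa> * (\<Sum>i<j. \<bar>(P ^^ i) a - (P ^^ i) b\<bar>) \<le> \<kappa> * (2 * real L)"
    using \<kappa>_nonneg by (rule mult_left_mono)
  then show ?thesis using distortion[of j a b] by simp
qed

lemma G_in_window: "G y \<in> closed_segment y (G (G y))"
  by (rule \<delta>_cases)
    (use G_dir[of y] G_dir2[of y] in \<open>auto simp: closed_segment_eq_real_ivl\<close>)

lemma window_mono: "closed_segment y (G y) \<subseteq> closed_segment y (G (G y))"
  by (rule \<delta>_cases)
    (use G_dir[of y] G_dir2[of y] in \<open>auto simp: closed_segment_eq_real_ivl\<close>)

lemma exp_bounds:
  fixes a b c :: real
  assumes "\<bar>ln a - ln b\<bar> \<le> c" "0 < a" "0 < b"
  shows "exp (- c) * b \<le> a" "a \<le> exp c * b"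
proof -
  have "ln b - c \<le> ln a" using assms(1) by linarith
  moreover have "ln a \<le> ln b + c" using assms(1) by linarith
  ultimately have "exp (ln b - c) \<le> exp (ln a)" "exp (ln a) \<le> exp (ln b + c)" by simp_all
  then show "exp (- c) * b \<le> a" "a \<le> exp c * b"
    using assms by (simp_all add: exp_diff exp_add exp_minus field_simps)
qed

text \<open>\<open>P\<^sup>q\<close> has derivative 1 somewhere, and every orbit comes close to that point before time \<open>Q\<close>.\<close>

lemma Denjoy: "\<bar>ln (DP q x)\<bar> \<le> 4 * \<kappa>"
proof -
  have "(P ^^ q) (0 + of_int 1) - (P ^^ q) 0 = 1"
    by (simp only: iter_shift)
  then obtain x0 where x0: "DP q x0 = 1"
    using iter_mvt[of 0 1 q] by auto
  obtain j s where js: "j < Q" "(P ^^ j) x + of_int s \<in> closed_segment x0 (G (G x0))"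
    using hitting by blast
  have "\<bar>ln (DP q ((P ^^ j) x + of_int s)) - ln (DP q x0)\<bar> \<le> 2 * \<kappa> * real 1"
    by (rule distortion_window[OF js(2)]) (use q_less in auto)
  then have 1: "\<bar>ln (DP q ((P ^^ j) x))\<bar> \<le> 2 * \<kappa>" by (simp add: x0 DP_shift)
  have "\<bar>ln (DP j (G x)) - ln (DP j x)\<bar> \<le> 2 * \<kappa> * real 1"
    by (rule distortion_window[OF G_in_window]) (use js in auto)
  then have 2: "\<bar>ln (DP j ((P ^^ q) x)) - ln (DP j x)\<bar> \<le> 2 * \<kappa>"
    by (simp add: G_def DP_shift)
  \<comment> \<open>Chain rule for \<open>P ^^ (q + j)\<close> in both orders: moving from
    \<open>x\<close> to \<open>(P ^^ j) x\<close> changes \<open>ln (DP q _)\<close> by the same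
    amount by which \<open>ln (DP j _)\<close> changes from \<open>x\<close> to
    \<open>G x\<close>.\<close>
  have "ln (DP q ((P ^^ j) x)) + ln (DP j x) = ln (DP j ((P ^^ q) x)) + ln (DP q x)"
  proof -
    have "DP q ((P ^^ j) x) * DP j x = DP j ((P ^^ q) x) * DP q x"
      by (metis DP_add add.commute)
    then have "ln (DP q ((P ^^ j) x) * DP j x) = ln (DP j ((P ^^ q) x) * DP q x)" by simp
    then show ?thesis by (simp add: ln_mult_pos DP_pos)
  qed
  then show ?thesis using 1 2 by linarith
qed

lemma G_lipschitz:
  "exp (- (4 * \<kappa>)) * \<bar>a - b\<bar> \<le> \<bar>G a - G b\<bar>" "\<bar>G a - G b\<bar> \<le> exp (4 * \<kappa>) * \<bar>a - b\<bar>"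
proof -
  obtain \<xi> where \<xi>: "(P ^^ q) a - (P ^^ q) b = DP q \<xi> * (a - b)"
    using iter_mvt[of b a q] by metis
  then have eq: "\<bar>G a - G b\<bar> = DP q \<xi> * \<bar>a - b\<bar>"
    using DP_pos[of q \<xi>] by (simp add: G_def abs_mult)
  have "exp (- (4 * \<kappa>)) \<le> DP q \<xi>" "DP q \<xi> \<le> exp (4 * \<kappa>)"
    using exp_bounds[of "DP q \<xi>" 1 "4 * \<kappa>"] Denjoy[of \<xi>] DP_pos[of q \<xi>] by simp_all
  then show "exp (- (4 * \<kappa>)) * \<bar>a - b\<bar> \<le> \<bar>G a - G b\<bar>" "\<bar>G a - G b\<bar> \<le> exp (4 * \<kappa>) * \<bar>a - b\<bar>"
    unfolding eq by (intro mult_right_mono; simp)+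
qed

lemma D_iter: "D ((P ^^ j) t) = \<bar>(P ^^ j) t - (P ^^ j) (G t)\<bar>"
  by (simp add: D_def iter_G abs_minus_commute)

text \<open>By \<open>iter_G\<close>, \<open>D ((P ^^ j) t)\<close> is the length of the image of
  the interval from \<open>t\<close> to \<open>G t\<close>, hence \<open>D t\<close> times
  \<open>DP j\<close> at an intermediate point; \<open>distortion_window\<close> moves that point to
  \<open>t\<close>.\<close>

lemma DP_D_bounds:
  assumes "j \<le> L * Q"
  shows "exp (- (2 * \<kappa> * real L)) * (DP j t * D t) \<le> D ((P ^^ j) t)"
    and "D ((P ^^ j) t) \<le> exp (2 * \<kappa> * real L) * (DP j t * D t)"
proof -
  obtain \<xi> where \<xi>: "\<xi> \<in> closed_segment t (G t)" "(P ^^ j) (G t) - (P ^^ j) t = DP j \<xi> * (G t - t)"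
    using iter_mvt[of t "G t" j] by metis
  then have eq: "D ((P ^^ j) t) = DP j \<xi> * D t"
    using DP_pos[of j \<xi>] unfolding D_def iter_G[symmetric] by (simp add: abs_mult)
  have "\<bar>ln (DP j \<xi>) - ln (DP j t)\<bar> \<le> 2 * \<kappa> * real L"
    by (rule distortion_window[OF _ _ assms, of _ t]) (use \<xi>(1) window_mono in auto)
  note bd = exp_bounds[OF this DP_pos DP_pos]
  show "exp (- (2 * \<kappa> * real L)) * (DP j t * D t) \<le> D ((P ^^ j) t)"
    using mult_right_mono[OF bd(1), of "D t"] D_pos[of t] by (simp add: eq mult.assoc)
  show "D ((P ^^ j) t) \<le> exp (2 * \<kappa> * real L) * (DP j t * D t)"
    using mult_right_mono[OF bd(2), of "D t"] D_pos[of t] by (simp add: eq mult.assoc)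
qed

lemma sum_DP_D_le: "(\<Sum>j<L * Q. DP j t * D t) \<le> exp (2 * \<kappa> * real L) * real L"
proof -
  have "DP j t * D t \<le> exp (2 * \<kappa> * real L) * \<bar>(P ^^ j) t - (P ^^ j) (G t)\<bar>" if "j < L * Q" for j
    using DP_D_bounds(1)[of j L t] that unfolding D_iter by (simp add: exp_minus field_simps)
  then have "(\<Sum>j<L * Q. DP j t * D t) \<le> exp (2 * \<kappa> * real L) * (\<Sum>j<L * Q. \<bar>(P ^^ j) t - (P ^^ j) (G t)\<bar>)"
    unfolding sum_distrib_left by (intro sum_mono) auto
  also have "\<dots> \<le> exp (2 * \<kappa> * real L) * real L"
    by (intro mult_left_mono blocks_sum_le) auto
  finally show ?thesis .
qed

text \<open>A point \<open>v\<close> between \<open>y\<close> and \<open>G y\<close> cuts that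
  interval in two; \<open>D v\<close> is the length of one piece plus that of the
  \<open>G\<close>-image of the other, and \<open>G\<close> is bi-Lipschitz with constant
  \<open>exp (4 * \<kappa>)\<close>. The window consists of two such intervals, hence the squared
  constant \<open>exp (8 * \<kappa>)\<close>.\<close>

lemma D_window:
  assumes "v \<in> closed_segment x (G (G x))"
  shows "exp (- (8 * \<kappa>)) * D x \<le> D v" "D v \<le> exp (8 * \<kappa>) * D x"
proof -
  define c where "c = exp (4 * \<kappa>)"
  have c: "1 \<le> c" "exp (- (4 * \<kappa>)) = inverse c" "exp (8 * \<kappa>) = c * c" "exp (- (8 * \<kappa>)) = inverse (c * c)"
    using \<kappa>_nonneg by (simp_all add: c_def exp_minus flip: exp_add)
  have lip: "\<bar>a - b\<bar> \<le> c * \<bar>G a - G b\<bar>" "\<bar>G a - G b\<bar> \<le> c * \<bar>a - b\<bar>" for a b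
    using G_lipschitz[of a b] c(1) unfolding c(2) c_def[symmetric] by (simp_all add: field_simps)
  have near: "D y \<le> c * D v \<and> D v \<le> c * D y" if "v \<in> closed_segment y (G y)" for y v
  proof -
    have 1: "D y = \<bar>v - y\<bar> + \<bar>G y - v\<bar> \<and> D v = \<bar>G y - v\<bar> + \<bar>G v - G y\<bar>"
    proof (rule \<delta>_cases)
      assume "0 < \<delta>"
      then have "y \<le> v" "v \<le> G y" "G y \<le> G v"
        using that G_dir(1)[of y] by (simp_all add: closed_segment_eq_real_ivl)
      then show ?thesis unfolding D_def by linarith
    next
      assume "\<delta> < 0"
      then have "v \<le> y" "G y \<le> v" "G v \<le> G y"
        using that G_dir(2)[of y] by (simp_all add: closed_segment_eq_real_ivl)
      then show ?thesis unfolding D_def by linarith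
    qed
    have "\<bar>G y - v\<bar> \<le> c * \<bar>G y - v\<bar>"
      using mult_right_mono[OF c(1), of "\<bar>G y - v\<bar>"] by simp
    moreover have "\<bar>v - y\<bar> \<le> c * \<bar>G v - G y\<bar>" "\<bar>G v - G y\<bar> \<le> c * \<bar>v - y\<bar>"
      by (rule lip)+
    ultimately show ?thesis
      using 1 by (simp only: distrib_left) linarith
  qed
  have GD: "D x \<le> c * D (G x)" "D (G x) \<le> c * D x"
    using near[of "G x" x] by simp_all
  have pos: "0 < D x" "0 < D v" by (rule D_pos)+
  have "v \<in> closed_segment x (G x) \<or> v \<in> closed_segment (G x) (G (G x))"
  proof (rule \<delta>_cases)
    assume "0 < \<delta>"
    then show ?thesis
      using assms G_dir(1)[of x] G_dir2(1)[of x] by (auto simp: closed_segment_eq_real_ivl)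
  next
    assume "\<delta> < 0"
    then show ?thesis
      using assms G_dir(2)[of x] G_dir2(2)[of x] by (auto simp: closed_segment_eq_real_ivl)
  qed
  then have "D v \<le> c * (c * D x) \<and> D x \<le> c * (c * D v)"
  proof
    assume "v \<in> closed_segment x (G x)"
    then have 1: "D x \<le> c * D v" "D v \<le> c * D x" using near by auto
    have "c * D v \<le> c * (c * D v)" "c * D x \<le> c * (c * D x)"
      using c(1) pos by simp_all
    with 1 show ?thesis by linarith
  next
    assume "v \<in> closed_segment (G x) (G (G x))"
    then have 1: "D (G x) \<le> c * D v" "D v \<le> c * D (G x)" using near by auto
    have "c * D (G x) \<le> c * (c * D v)" "c * D (G x) \<le> c * (c * D x)"
      using c(1) 1 GD by simp_all
    with 1 GD show ?thesis by linarith
  qed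
  then show "exp (- (8 * \<kappa>)) * D x \<le> D v" "D v \<le> exp (8 * \<kappa>) * D x"
    using c(1) unfolding c(3,4) by (simp_all add: field_simps)
qed

text \<open>If \<open>G a\<close> does not pass \<open>b\<close>, then \<open>D a\<close> is at most
  the distance from \<open>a\<close> to \<open>b\<close>, while the step from \<open>b\<close> to
  \<open>G b\<close> lies within the image under \<open>G\<close> of the interval from
  \<open>a\<close> to \<open>b\<close>. Averaging the two bounds gives a form that can be compared
  with a sum of two radii.\<close>

lemma separated_centres:
  assumes "i < Q" "j < Q" "(i, s) \<noteq> (j, t)"
  shows "exp (- (4 * \<kappa>)) * (D ((P ^^ i) x) + D ((P ^^ j) x)) / 2
    \<le> \<bar>((P ^^ i) x + of_int s) - ((P ^^ j) x + of_int t)\<bar>"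
proof -
  define c where "c = exp (4 * \<kappa>)"
  have c: "1 \<le> c" "exp (- (4 * \<kappa>)) = inverse c"
    using \<kappa>_nonneg by (simp_all add: c_def exp_minus)
  have key: "D a \<le> c * \<bar>a - b\<bar> \<and> D b \<le> c * \<bar>a - b\<bar>"
    if "0 < \<delta> \<and> G a \<le> b \<or> \<delta> < 0 \<and> a \<le> G b" for a b
  proof -
    have 1: "\<bar>a - b\<bar> \<le> c * \<bar>a - b\<bar>"
      using mult_right_mono[OF c(1), of "\<bar>a - b\<bar>"] by simp
    have 2: "\<bar>G a - G b\<bar> \<le> c * \<bar>a - b\<bar>" using G_lipschitz(2) by (simp add: c_def)
    have "D a \<le> \<bar>a - b\<bar> \<and> D b \<le> \<bar>G a - G b\<bar> \<or> D b \<le> \<bar>a - b\<bar> \<and> D a \<le> \<bar>G a - G b\<bar>"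
      using that G_dir[of a] G_dir[of b] unfolding D_def by auto
    with 1 2 show ?thesis by linarith
  qed
  define a where "a = (P ^^ i) x + of_int s"
  define b where "b = (P ^^ j) x + of_int t"
  have "D a \<le> c * \<bar>a - b\<bar> \<and> D b \<le> c * \<bar>a - b\<bar>"
  proof (rule \<delta>_cases)
    assume "0 < \<delta>"
    then show ?thesis
      using block_separated(1)[OF assms, of x] key[of a b] key[of b a]
      by (auto simp: a_def b_def G_shift abs_minus_commute)
  next
    assume "\<delta> < 0"
    then show ?thesis
      using block_separated(2)[OF assms, of x] key[of a b] key[of b a]
      by (auto simp: a_def b_def G_shift abs_minus_commute)
  qed
  then have "D ((P ^^ i) x) + D ((P ^^ j) x) \<le> 2 * c * \<bar>a - b\<bar>"
    by (simp add: a_def b_def D_shift)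
  then show ?thesis
    using c(1) unfolding c(2) a_def b_def by (simp add: field_simps)
qed

end

context circle_map
begin

text \<open>\<open>m\<close> is the least distance from \<open>i \<rho>\<close> to the integers for
  \<open>i\<close> from 1 to \<open>M + 1\<close>; Dirichlet's theorem provides a closer time. The
  first such time \<open>Q\<close> exceeds \<open>M + 1\<close>, no positive time below it is closer
  than \<open>m\<close>, and a best time \<open>q\<close> below \<open>Q\<close> therefore has the
  required properties.\<close>

lemma exists_return_times:
  obtains q Q p p' where "circle_return P P' \<rho> \<kappa> q Q p p'" "M \<le> Q"
proof -
  define d where "d i = \<bar>real i * \<rho> - of_int (round (real i * \<rho>))\<bar>" for i :: nat
  have d_le: "d i \<le> \<bar>real i * \<rho> + of_int s\<bar>" for i s
    unfolding d_def using round_diff_minimal[of "real i * \<rho>" "- s"] by simp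
  have d_pos: "0 < d i" if "0 < i" for i
    unfolding d_def using nonzero_translation[OF that, of "- round (real i * \<rho>)"] by simp
  have fin: "finite (d ` {1..<n})" "d ` {1..<n} \<noteq> {}" if "1 < n" for n
    using that by auto
  define m where "m = Min (d ` {1..<M + 2})"
  have "m \<in> d ` {1..<M + 2}" unfolding m_def using fin[of "M + 2"] by (intro Min_in) auto
  then have "0 < m" using d_pos by auto
  then obtain N where N: "inverse (real (Suc N)) < m" using reals_Archimedean by blast
  obtain h k where hk: "0 < k" "k \<le> int (Suc N)" "\<bar>of_int k * \<rho> - of_int h\<bar> < 1 / real (Suc N)"
    using Dirichlet_approx[of "Suc N" \<rho>, OF zero_less_Suc] by blast
  have "d (nat k) < m"
    using d_le[of "nat k" "- h"] hk N by (simp add: inverse_eq_divide)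
  define Q where "Q = (LEAST i. 0 < i \<and> d i < m)"
  have Q: "0 < Q" "d Q < m"
    using LeastI[of "\<lambda>i. 0 < i \<and> d i < m" "nat k"] hk \<open>d (nat k) < m\<close> unfolding Q_def by auto
  have Q_least: "m \<le> d i" if "0 < i" "i < Q" for i
    using not_less_Least[of i "\<lambda>i. 0 < i \<and> d i < m"] that unfolding Q_def by force
  have QM: "M + 2 \<le> Q"
  proof (rule ccontr)
    assume "\<not> ?thesis"
    then have "m \<le> d Q"
      unfolding m_def using Q(1) fin[of "M + 2"] by (intro Min_le) auto
    then show False using Q(2) by simp
  qed
  define e where "e = Min (d ` {1..<Q})"
  have "e \<in> d ` {1..<Q}" unfolding e_def using fin[of Q] QM by (intro Min_in) auto
  then obtain q where "q \<in> {1..<Q}" and eq: "e = d q" by blast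
  then have q: "0 < q" "q < Q" by auto
  have e_le: "d q \<le> d i" if "0 < i" "i < Q" for i
    unfolding eq[symmetric] e_def using that fin[of Q] QM by (intro Min_le) auto
  have "circle_return P P' \<rho> \<kappa> q Q (- round (real q * \<rho>)) (- round (real Q * \<rho>))"
  proof unfold_locales
    show "0 < q" "q < Q" by fact+
    have "d Q < d q" using Q(2) Q_least[OF q(1,2)] by simp
    then show "\<bar>real Q * \<rho> + of_int (- round (real Q * \<rho>))\<bar> < \<bar>real q * \<rho> + of_int (- round (real q * \<rho>))\<bar>"
      by (simp add: d_def)
    show "\<bar>real q * \<rho> + of_int (- round (real q * \<rho>))\<bar> \<le> \<bar>real i * \<rho> + of_int s\<bar>"
      if "0 < i" "i < Q" for i s
      using e_le[OF that] d_le[of i s] by (simp add: d_def)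
  qed
  then show ?thesis using that QM by auto
qed

end

section \<open>Orbits near the circle\<close>

text \<open>Used with \<open>c = 1\<close> for lifts and with \<open>c = 0\<close> for periodic
  functions.\<close>

lemma int_translate:
  fixes \<Phi> :: "complex \<Rightarrow> complex" and n :: int
  assumes S: "\<And>w (n::int). w \<in> S \<Longrightarrow> w + of_int n \<in> S"
    and \<Phi>: "\<And>w. w \<in> S \<Longrightarrow> \<Phi> (w + 1) = \<Phi> w + c" and w: "w \<in> S"
  shows "\<Phi> (w + of_int n) = \<Phi> w + of_int n * c"
proof -
  have nat: "\<Phi> (v + of_nat k) = \<Phi> v + of_nat k * c" if "v \<in> S" for k v
  proof (induction k)
    case (Suc k)
    show ?case using \<Phi>[OF S[OF that, of "int k"]] Suc by (simp add: algebra_simps)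
  qed simp
  show ?thesis
  proof (cases "n \<ge> 0")
    case True
    then show ?thesis using nat[OF w, of "nat n"] by simp
  next
    case False
    then show ?thesis using nat[OF S[OF w, of n], of "nat (- n)"] by (simp add: algebra_simps)
  qed
qed

text \<open>\<open>F\<close> is the holomorphic extension of \<open>P\<close>. Since
  \<open>exp (2 * pi * \<i> * w)\<close> has modulus above 1 exactly for \<open>Im w < 0\<close>,
  the exterior of the disc corresponds to the lower half of the strip, whose image
  \<open>F_lower\<close> keeps below the real axis. \<open>F_deriv_lip\<close> is the complex
  counterpart of \<open>P'_lip\<close>, relative to the size of \<open>P'\<close>.\<close>

locale circle_strip = circle_map +
  fixes F :: "complex \<Rightarrow> complex" and e :: real
  assumes e_pos: "0 < e"
    and F_hol: "F holomorphic_on {w. \<bar>Im w\<bar> < e}"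
    and F_real: "\<And>x. F (of_real x) = of_real (P x)"
    and F_deriv_lip: "\<And>w x. \<bar>Im w\<bar> < e \<Longrightarrow>
          norm (deriv F w - of_real (P' x)) \<le> \<kappa> * P' x * norm (w - of_real x)"
    and F_lower: "\<And>w. - e < Im w \<Longrightarrow> Im w < 0 \<Longrightarrow> Im (F w) < 0"
    and F_shift: "\<And>w. \<bar>Im w\<bar> < e \<Longrightarrow> F (w + 1) = F w + 1"
begin

abbreviation "lower_strip \<equiv> {w. - e < Im w \<and> Im w < 0}"

lemma open_strip: "open {w. \<bar>Im w\<bar> < e}"
  by (intro open_Collect_less continuous_intros)

lemma F_field_deriv: "\<bar>Im w\<bar> < e \<Longrightarrow> (F has_field_derivative deriv F w) (at w)"
  using F_hol open_strip by (intro holomorphic_derivI[of F "{w. \<bar>Im w\<bar> < e}"]) auto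

definition dF :: "nat \<Rightarrow> complex \<Rightarrow> complex" where
  "dF j z = (\<Prod>i<j. deriv F ((F ^^ i) z))"

lemma F_iter_deriv:
  assumes "\<And>i. i < j \<Longrightarrow> \<bar>Im ((F ^^ i) z)\<bar> < e"
  shows "((F ^^ j) has_field_derivative dF j z) (at z)"
  using assms
proof (induction j)
  case 0
  then show ?case by (simp add: dF_def id_def)
next
  case (Suc j)
  have "(F \<circ> (F ^^ j) has_field_derivative deriv F ((F ^^ j) z) * dF j z) (at z)"
    by (intro DERIV_chain F_field_deriv Suc) (use Suc.prems in auto)
  then show ?case by (simp add: dF_def o_def mult.commute)
qed

lemma F_iter_real: "(F ^^ j) (of_real x) = of_real ((P ^^ j) x)"
  by (induction j) (simp_all add: F_real)

lemma F_iter_lower: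
  assumes "\<And>i. i < j \<Longrightarrow> \<bar>Im ((F ^^ i) z)\<bar> < e" "Im z < 0"
  shows "Im ((F ^^ j) z) < 0"
  using assms
proof (induction j)
  case (Suc j)
  then have "Im ((F ^^ j) z) < 0" by auto
  moreover have "\<bar>Im ((F ^^ j) z)\<bar> < e" by (rule Suc.prems(1)) simp
  ultimately show ?case by (auto intro: F_lower)
qed simp

lemma F_shift_int: "\<bar>Im w\<bar> < e \<Longrightarrow> F (w + of_int s) = F w + of_int s"
  using int_translate[of "{w. \<bar>Im w\<bar> < e}" F 1 w s] F_shift by simp

lemma F_iter_shift:
  assumes "\<And>i. i < j \<Longrightarrow> \<bar>Im ((F ^^ i) z)\<bar> < e"
  shows "(F ^^ j) (z + of_int s) = (F ^^ j) z + of_int s"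
  using assms by (induction j) (auto simp: F_shift_int)

text \<open>The bound of \<open>sum_DP_D_le\<close> for the sum of \<open>DP j t * D t\<close> over
  \<open>L Q\<close> steps. It and the next three constants are independent of \<open>q\<close> and
  \<open>Q\<close>.\<close>

definition "orbit_length_bound L = exp (2 * \<kappa> * real L) * real L"

text \<open>The first term keeps the orbit of a disc of radius \<open>rad L * D t\<close> inside the
  strip, the second bounds its accumulated distortion by \<open>exp (1 / 3)\<close>; see
  \<open>rad_bounds\<close>.\<close>

definition "rad L = min (e / (3 * (orbit_length_bound L + 1))) (1 / (6 * (\<kappa> + 1) * (orbit_length_bound L + 1)))"

text \<open>Half of \<open>rad\<close> leaves room for a ball of radius \<open>y / 2\<close> around
  a point at depth \<open>y\<close>. The second term, with its 5, makes the images of such balls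
  disjoint.\<close>

definition "height L = min (rad L / 2) (exp (- (2 * \<kappa> * real L)) * exp (- (4 * \<kappa>)) / 5)"

text \<open>Both terms serve \<open>barrier_compare\<close>. With
  \<open>b = exp (2 * \<kappa>)\<close> they are \<open>1 / (2 * b ^ 3)\<close>, which keeps
  \<open>D\<close> from collapsing between a real orbit point and the abscissa of the nearby complex
  one, and \<open>height L / (3 * b ^ 9)\<close>, which keeps connecting segments within the
  admissible depth.\<close>

definition "barrier_scale L = min (exp (- (6 * \<kappa>)) / 2) (height L * exp (- (18 * \<kappa>)) / 3)"

end

locale circle_strip_return = circle_strip + circle_return
begin

lemma orbit_length_bound_nonneg: "0 \<le> orbit_length_bound L"
  by (simp add: orbit_length_bound_def)

lemma rad_pos: "0 < rad L"
  using e_pos orbit_length_bound_nonneg[of L] \<kappa>_nonneg by (simp add: rad_def)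

lemma rad_bounds: "2 * rad L * orbit_length_bound L < e" "\<kappa> * (2 * rad L * orbit_length_bound L) \<le> 1 / 3"
proof -
  have "rad L * orbit_length_bound L \<le> e / (3 * (orbit_length_bound L + 1)) * orbit_length_bound L"
    using orbit_length_bound_nonneg by (intro mult_right_mono) (auto simp: rad_def)
  also have "\<dots> \<le> e / 3"
    using orbit_length_bound_nonneg[of L] e_pos by (simp add: field_simps)
  finally show "2 * rad L * orbit_length_bound L < e" using e_pos by simp
  have "rad L * orbit_length_bound L \<le> 1 / (6 * (\<kappa> + 1) * (orbit_length_bound L + 1)) * orbit_length_bound L"
    using orbit_length_bound_nonneg by (intro mult_right_mono) (auto simp: rad_def)
  then have "\<kappa> * (rad L * orbit_length_bound L) \<le> \<kappa> * (1 / (6 * (\<kappa> + 1) * (orbit_length_bound L + 1)) * orbit_length_bound L)"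
    using \<kappa>_nonneg by (rule mult_left_mono)
  also have "\<dots> = (\<kappa> / (\<kappa> + 1)) * (orbit_length_bound L / (orbit_length_bound L + 1)) * (1 / 6)"
    by simp
  also have "\<dots> \<le> 1 * 1 * (1 / 6)"
    using orbit_length_bound_nonneg[of L] \<kappa>_nonneg by (intro mult_mono) (auto simp: field_simps)
  finally show "\<kappa> * (2 * rad L * orbit_length_bound L) \<le> 1 / 3" by simp
qed

text \<open>Induction over all earlier times and all points of the disc at once. As long as
  \<open>F ^^ i\<close> is close to its linear part, the image of the disc stays within
  \<open>2 * DP i t * r\<close> of the real orbit; summed over time this is small against
  \<open>e\<close> and, after multiplication by \<open>\<kappa>\<close>, against 1, so the next
  derivative still has relative error at most 1/2.\<close>

lemma orbit_disc:
  assumes "j \<le> L * Q" "norm (z - of_real t) \<le> rad L * D t"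
  shows "\<And>i. i < j \<Longrightarrow> \<bar>Im ((F ^^ i) z)\<bar> < e"
    and "norm (dF j z - of_real (DP j t)) \<le> DP j t / 2"
    and "norm ((F ^^ j) z - of_real ((P ^^ j) t) - of_real (DP j t) * (z - of_real t))
          \<le> DP j t / 2 * norm (z - of_real t)"
proof -
  define r where "r = rad L * D t"
  have "(\<forall>i<j. \<bar>Im ((F ^^ i) z)\<bar> < e) \<and> norm (dF j z - of_real (DP j t)) \<le> DP j t / 2 \<and>
      norm ((F ^^ j) z - of_real ((P ^^ j) t) - of_real (DP j t) * (z - of_real t))
        \<le> DP j t / 2 * norm (z - of_real t)"
    if "norm (z - of_real t) \<le> r" "j \<le> L * Q" for z
    using that
  proof (induction j arbitrary: z rule: less_induct)
    case (less j)
    have close: "norm ((F ^^ i) w - of_real ((P ^^ i) t)) \<le> 2 * DP i t * r"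
      if "i < j" "norm (w - of_real t) \<le> r" for i w
    proof -
      have "norm ((F ^^ i) w - of_real ((P ^^ i) t) - of_real (DP i t) * (w - of_real t))
          \<le> DP i t / 2 * norm (w - of_real t)"
        using less.IH[of i w] that less.prems by simp
      then have "norm ((F ^^ i) w - of_real ((P ^^ i) t))
          \<le> DP i t / 2 * norm (w - of_real t) + norm (of_real (DP i t) * (w - of_real t))"
        using norm_triangle_sub[of "(F ^^ i) w - of_real ((P ^^ i) t)" "of_real (DP i t) * (w - of_real t)"]
        by linarith
      also have "\<dots> = 3 / 2 * DP i t * norm (w - of_real t)"
        using DP_pos[of i t] by (simp add: norm_mult)
      also have "\<dots> \<le> 2 * DP i t * r"
        using that(2) DP_pos[of i t] by (intro mult_mono) auto
      finally show ?thesis .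
    qed
    have strip: "\<bar>Im ((F ^^ i) w)\<bar> < e" if "i < j" "norm (w - of_real t) \<le> r" for i w
    proof -
      have "DP i t * D t \<le> (\<Sum>i<L * Q. DP i t * D t)"
        using that(1) less.prems DP_pos D_pos
        by (intro member_le_sum[where f = "\<lambda>i. DP i t * D t"]) (auto intro: less_imp_le)
      also have "\<dots> \<le> orbit_length_bound L" unfolding orbit_length_bound_def by (rule sum_DP_D_le)
      finally have "2 * DP i t * r \<le> 2 * rad L * orbit_length_bound L"
        unfolding r_def using rad_pos[of L] by (simp add: mult_left_mono ac_simps)
      moreover have "\<bar>Im ((F ^^ i) w)\<bar> \<le> norm ((F ^^ i) w - of_real ((P ^^ i) t))"
        using abs_Im_le_cmod[of "(F ^^ i) w - of_real ((P ^^ i) t)"] by simp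
      ultimately show ?thesis using close[OF that] rad_bounds(1)[of L] by linarith
    qed
    have deriv_close: "norm (dF j w - of_real (DP j t)) \<le> DP j t / 2"
      if w: "norm (w - of_real t) \<le> r" for w
    proof -
      \<comment> \<open>Relative error of the \<open>i\<close>-th factor of \<open>dF j w\<close>.
        The product of \<open>1 + norm (g i)\<close> stays below \<open>3 / 2\<close>, so the
        product of \<open>1 + g i\<close> differs from 1 by at most \<open>1 / 2\<close>.\<close>
      define g where "g i = deriv F ((F ^^ i) w) / of_real (P' ((P ^^ i) t)) - 1" for i
      have g: "norm (g i) \<le> \<kappa> * (2 * DP i t * r)" if i: "i < j" for i
      proof -
        let ?p = "P' ((P ^^ i) t)"
        have p: "0 < ?p" by (rule P'_pos)
        have "g i = (deriv F ((F ^^ i) w) - of_real ?p) / of_real ?p"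
          using p unfolding g_def by (simp add: diff_divide_distrib)
        then have "norm (g i) = norm (deriv F ((F ^^ i) w) - of_real ?p) / ?p"
          using p by (simp add: norm_divide)
        also have "\<dots> \<le> (\<kappa> * ?p * norm ((F ^^ i) w - of_real ((P ^^ i) t))) / ?p"
          using p by (intro divide_right_mono F_deriv_lip strip i w) auto
        also have "\<dots> = \<kappa> * norm ((F ^^ i) w - of_real ((P ^^ i) t))"
          using p by simp
        also have "\<dots> \<le> \<kappa> * (2 * DP i t * r)"
          by (intro mult_left_mono close i w \<kappa>_nonneg)
        finally show ?thesis .
      qed
      have "(\<Prod>i<j. 1 + norm (g i)) \<le> (\<Prod>i<j. exp (\<kappa> * (2 * DP i t * r)))"
      proof (intro prod_mono conjI)
        fix i assume "i \<in> {..<j}"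
        then have "1 + norm (g i) \<le> 1 + \<kappa> * (2 * DP i t * r)" using g by simp
        also have "\<dots> \<le> exp (\<kappa> * (2 * DP i t * r))" by (rule exp_ge_add_one_self)
        finally show "1 + norm (g i) \<le> exp (\<kappa> * (2 * DP i t * r))" .
      qed simp
      also have "\<dots> = exp (\<Sum>i<j. \<kappa> * (2 * DP i t * r))" by (simp add: exp_sum)
      also have "(\<Sum>i<j. \<kappa> * (2 * DP i t * r)) = \<kappa> * (2 * rad L * (\<Sum>i<j. DP i t * D t))"
        unfolding r_def by (simp add: sum_distrib_left ac_simps)
      also have "(\<Sum>i<j. DP i t * D t) \<le> (\<Sum>i<L * Q. DP i t * D t)"
        using less.prems DP_pos D_pos by (intro sum_mono2) (auto intro: less_imp_le)
      also have "\<dots> \<le> orbit_length_bound L" unfolding orbit_length_bound_def by (rule sum_DP_D_le)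
      also have "exp (\<kappa> * (2 * rad L * orbit_length_bound L)) \<le> exp (1 / 3)" using rad_bounds(2) by simp
      also have "\<dots> \<le> 3 / 2"
        using exp_bound[of "1 / 3"] by (simp add: power2_eq_square)
      finally have pr: "(\<Prod>i<j. 1 + norm (g i)) \<le> 3 / 2"
        using \<kappa>_nonneg rad_pos[of L] by (simp add: mult_left_mono)
      have "dF j w = of_real (DP j t) * (\<Prod>i<j. 1 + g i)"
        unfolding dF_def DP_def g_def using P'_pos
        by (simp add: less_imp_neq[symmetric] flip: prod.distrib)
      moreover have diff_one: "of_real (DP j t) * p - of_real (DP j t) = of_real (DP j t) * (p - 1)" for p :: complex
        by (simp add: algebra_simps)
      ultimately have "norm (dF j w - of_real (DP j t)) = DP j t * norm ((\<Prod>i<j. 1 + g i) - 1)"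
        using DP_pos[of j t] by (simp only: diff_one norm_mult) simp
      also have "\<dots> \<le> DP j t * (1 / 2)"
        using norm_prod_minus1_le_prod_minus1[of g "{..<j}"] pr DP_pos[of j t]
        by (intro mult_left_mono) auto
      finally show ?thesis by simp
    qed
    \<comment> \<open>Mean value inequality for \<open>F ^^ j\<close> minus its linear part, whose
      derivative is small by \<open>deriv_close\<close>.\<close>
    have "norm (((F ^^ j) z - of_real (DP j t) * z) - ((F ^^ j) (of_real t) - of_real (DP j t) * of_real t))
        \<le> DP j t / 2 * norm (z - of_real t)"
    proof (rule field_differentiable_bound[of "cball (of_real t) r"])
      fix w :: complex assume "w \<in> cball (of_real t) r"
      then have w: "norm (w - of_real t) \<le> r" by (simp add: dist_norm norm_minus_commute)
      show "((\<lambda>w. (F ^^ j) w - of_real (DP j t) * w) has_field_derivative dF j w - of_real (DP j t))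
          (at w within cball (of_real t) r)"
        by (rule has_field_derivative_at_within)
          (auto intro!: derivative_eq_intros F_iter_deriv strip w)
      show "norm (dF j w - of_real (DP j t)) \<le> DP j t / 2" by (rule deriv_close[OF w])
    qed (use less.prems in \<open>auto simp: dist_norm norm_minus_commute intro: order.trans[OF norm_ge_zero]\<close>)
    then show ?case
      using deriv_close[OF less.prems(1)] strip[OF _ less.prems(1)]
      by (simp add: F_iter_real algebra_simps)
  qed
  from this[of z] assms show "\<And>i. i < j \<Longrightarrow> \<bar>Im ((F ^^ i) z)\<bar> < e"
    and "norm (dF j z - of_real (DP j t)) \<le> DP j t / 2"
    and "norm ((F ^^ j) z - of_real ((P ^^ j) t) - of_real (DP j t) * (z - of_real t))
          \<le> DP j t / 2 * norm (z - of_real t)"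
    by (simp_all add: r_def)
qed

end

section \<open>Area estimate for the derivatives in the exterior coordinate\<close>

locale exterior_strip = circle_strip +
  fixes H :: "complex \<Rightarrow> complex" and B :: real
  assumes H_hol: "H holomorphic_on lower_strip"
    and H_inj: "\<And>w w'. w \<in> lower_strip \<Longrightarrow> w' \<in> lower_strip \<Longrightarrow> H w = H w' \<Longrightarrow> \<exists>s::int. w = w' + of_int s"
    and H_shift: "\<And>w. w \<in> lower_strip \<Longrightarrow> H (w + 1) = H w"
    and H_bdd: "\<And>w. w \<in> lower_strip \<Longrightarrow> norm (H w) \<le> B"
begin

lemma H_shift_int: "w \<in> lower_strip \<Longrightarrow> H (w + of_int s) = H w"
  using int_translate[of lower_strip H 0 w s] H_shift by simp

end

lemma sum_le_sqrt_card_mult: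
  fixes a :: "nat \<Rightarrow> real"
  assumes "(\<Sum>i<n. (a i)\<^sup>2) \<le> c\<^sup>2" "0 \<le> c"
  shows "(\<Sum>i<n. a i) \<le> sqrt n * c"
proof -
  have "(\<Sum>i<n. a i)\<^sup>2 \<le> (\<Sum>i<n. 1\<^sup>2) * (\<Sum>i<n. (a i)\<^sup>2)"
    using Cauchy_Schwarz_ineq_sum[of "\<lambda>_. 1" a "{..<n}"] by simp
  also have "\<dots> \<le> n * c\<^sup>2"
    using assms(1) by (simp add: mult_left_mono)
  finally show ?thesis
    using assms(2) power2_le_imp_le[of "\<Sum>i<n. a i" "sqrt n * c"] by (simp add: power_mult_distrib)
qed

lemma sum_radius_squared_le:
  fixes b :: "nat \<Rightarrow> complex"
  assumes r: "\<And>i. i < n \<Longrightarrow> 0 \<le> r i" and B: "0 \<le> B"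
    and sub: "\<And>i. i < n \<Longrightarrow> ball (b i) (r i) \<subseteq> cball 0 B"
    and disj: "\<And>i j. i < n \<Longrightarrow> j < n \<Longrightarrow> i \<noteq> j \<Longrightarrow> ball (b i) (r i) \<inter> ball (b j) (r j) = {}"
  shows "(\<Sum>i<n. (r i)\<^sup>2) \<le> B\<^sup>2"
proof -
  have meas: "measure lborel (ball c \<rho>) = pi * \<rho>\<^sup>2" if "0 \<le> \<rho>" for c :: complex and \<rho> :: real
    using that content_ball[of \<rho> c] by (simp add: unit_ball_vol_2)
  have fm: "ball c \<rho> \<in> fmeasurable lborel" for c :: complex and \<rho> :: real
    by (rule fmeasurableI) (use emeasure_lborel_ball_finite[of c \<rho>] in simp_all)
  have "pi * (\<Sum>i<n. (r i)\<^sup>2) = (\<Sum>i<n. measure lborel (ball (b i) (r i)))"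
    unfolding sum_distrib_left by (rule sum.cong) (simp_all add: meas r)
  also have "\<dots> = measure lborel (\<Union>i<n. ball (b i) (r i))"
  proof (rule measure_UNION'[symmetric])
    show "pairwise (\<lambda>i j. disjnt (ball (b i) (r i)) (ball (b j) (r j))) {..<n}"
      unfolding pairwise_def disjnt_def using disj by (meson lessThan_iff)
  qed (simp_all add: fm)
  also have "\<dots> \<le> measure lborel (cball (0::complex) B)"
  proof (rule measure_mono_fmeasurable)
    show "(\<Union>i<n. ball (b i) (r i)) \<subseteq> cball 0 B" using sub by blast
    show "(\<Union>i<n. ball (b i) (r i)) \<in> sets lborel" by (simp add: borel_open open_UN)
    show "cball (0::complex) B \<in> fmeasurable lborel"
      by (rule fmeasurableI) (use emeasure_lborel_cball_finite[of "0::complex" B] in simp_all)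
  qed
  also have "\<dots> = pi * B\<^sup>2"
    using B content_cball[of B "0::complex"] by (simp add: unit_ball_vol_2)
  finally show ?thesis by simp
qed

locale exterior_strip_return = circle_strip_return + exterior_strip
begin

lemma height_pos: "0 < height L"
  using rad_pos by (simp add: height_def)

lemma F_iter_in_lower_strip:
  assumes "j < L * Q" "norm (z - of_real t) \<le> rad L * D t" "Im z < 0"
  shows "(F ^^ j) z \<in> lower_strip"
proof -
  have strip: "\<bar>Im ((F ^^ i) z)\<bar> < e" if "i < L * Q" for i
    using orbit_disc(1)[OF order_refl assms(2) that] .
  then have "Im ((F ^^ j) z) < 0"
    using assms by (intro F_iter_lower) auto
  then show ?thesis using strip[OF assms(1)] by auto
qed

lemma ball_subset_disc:
  assumes "0 < y" "y \<le> height L * D t" "w \<in> ball (Complex t (- y)) (y / 2)"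
  shows "Im w < 0" "norm (w - of_real t) \<le> 3 / 2 * y" "norm (w - of_real t) \<le> rad L * D t"
proof -
  have w: "norm (w - Complex t (- y)) < y / 2"
    using assms(3) by (simp add: dist_norm norm_minus_commute)
  then show "Im w < 0"
    using abs_Im_le_cmod[of "w - Complex t (- y)"] assms(1) by simp
  have "norm (Complex t (- y) - of_real t) = y"
    using assms(1) by (simp add: cmod_def)
  then show 1: "norm (w - of_real t) \<le> 3 / 2 * y"
    using w norm_triangle_ineq[of "w - Complex t (- y)" "Complex t (- y) - of_real t"] by simp
  have "height L * D t \<le> rad L / 2 * D t"
    using D_pos[of t] by (intro mult_right_mono) (auto simp: height_def)
  then show "norm (w - of_real t) \<le> rad L * D t"
    using 1 assms(2) mult_pos_pos[OF rad_pos[of L] D_pos[of t]] by linarith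
qed

text \<open>Equal values of \<open>H\<close> mean equal points modulo 1, so two real orbit points
  would be close to each other modulo 1. Both times lie in one block, and
  \<open>separated_centres\<close>, started at \<open>(P ^^ (k * Q)) t\<close>, keeps these orbit
  points too far apart.\<close>

lemma images_disjoint:
  assumes y: "0 < y" "y \<le> height L * D t" and "k < L" "i < Q" "j < Q" "i \<noteq> j"
    and w: "w \<in> ball (Complex t (- y)) (y / 2)" "w' \<in> ball (Complex t (- y)) (y / 2)"
  shows "H ((F ^^ (i + k * Q)) w) \<noteq> H ((F ^^ (j + k * Q)) w')"
proof
  let ?I = "i + k * Q" and ?J = "j + k * Q"
  have "Suc k * Q \<le> L * Q" using \<open>k < L\<close> by (intro mult_le_mono1) simp
  then have IJ: "?I < L * Q" "?J < L * Q" using assms(4,5) by simp_all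
  assume "H ((F ^^ ?I) w) = H ((F ^^ ?J) w')"
  then obtain s :: int where s: "(F ^^ ?I) w = (F ^^ ?J) w' + of_int s"
    using H_inj[OF F_iter_in_lower_strip[OF IJ(1)] F_iter_in_lower_strip[OF IJ(2)]]
      ball_subset_disc[OF y w(1)] ball_subset_disc[OF y w(2)] by blast
  \<comment> \<open>One factor \<open>3 / 2\<close> bounds the distance of \<open>v\<close> from
    \<open>t\<close> in units of \<open>y\<close>, the other is the distortion from
    \<open>orbit_disc\<close>.\<close>
  have close: "\<bar>Re ((F ^^ l) v) - (P ^^ l) t\<bar> \<le> 9 / 4 * (DP l t * y)"
    if "l < L * Q" "v \<in> ball (Complex t (- y)) (y / 2)" for l v
  proof -
    note v = ball_subset_disc[OF y that(2)]
    have "norm ((F ^^ l) v - of_real ((P ^^ l) t) - of_real (DP l t) * (v - of_real t))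
        \<le> DP l t / 2 * norm (v - of_real t)"
      using orbit_disc(3)[of l L v t] that(1) v(3) by simp
    then have "norm ((F ^^ l) v - of_real ((P ^^ l) t))
        \<le> DP l t / 2 * norm (v - of_real t) + norm (of_real (DP l t) * (v - of_real t))"
      using norm_triangle_sub[of "(F ^^ l) v - of_real ((P ^^ l) t)" "of_real (DP l t) * (v - of_real t)"]
      by linarith
    also have "\<dots> = 3 / 2 * DP l t * norm (v - of_real t)"
      using DP_pos[of l t] by (simp add: norm_mult)
    also have "\<dots> \<le> 3 / 2 * DP l t * (3 / 2 * y)"
      using v(2) DP_pos[of l t] by (intro mult_left_mono) auto
    finally show ?thesis
      using abs_Re_le_cmod[of "(F ^^ l) v - of_real ((P ^^ l) t)"] by simp
  qed
  have DP_le: "DP l t * y \<le> exp (- (4 * \<kappa>)) * D ((P ^^ l) t) / 5" if "l < L * Q" for l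
  proof -
    have "DP l t * y \<le> DP l t * (exp (- (2 * \<kappa> * real L)) * exp (- (4 * \<kappa>)) / 5 * D t)"
    proof -
      have "height L * D t \<le> exp (- (2 * \<kappa> * real L)) * exp (- (4 * \<kappa>)) / 5 * D t"
        using D_pos[of t] by (intro mult_right_mono) (auto simp: height_def)
      then show ?thesis using y(2) DP_pos[of l t] by (intro mult_left_mono) auto
    qed
    also have "\<dots> = exp (- (4 * \<kappa>)) / 5 * (exp (- (2 * \<kappa> * real L)) * (DP l t * D t))" by simp
    also have "\<dots> \<le> exp (- (4 * \<kappa>)) / 5 * D ((P ^^ l) t)"
      using that by (intro mult_left_mono DP_D_bounds(1)) auto
    finally show ?thesis by simp
  qed
  have "(exp (- (4 * \<kappa>)) * D ((P ^^ ?I) t) + exp (- (4 * \<kappa>)) * D ((P ^^ ?J) t)) / 2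
      \<le> \<bar>(P ^^ ?I) t - ((P ^^ ?J) t + of_int s)\<bar>"
    using separated_centres[of i j 0 s "(P ^^ (k * Q)) t"] assms(4-6)
    unfolding iter_add[symmetric] by (simp add: distrib_left)
  moreover have "Re ((F ^^ ?I) w) = Re ((F ^^ ?J) w') + of_int s" unfolding s by simp
  then have "\<bar>(P ^^ ?I) t - ((P ^^ ?J) t + of_int s)\<bar>
      \<le> 9 / 4 * (DP ?I t * y) + 9 / 4 * (DP ?J t * y)"
    using close[OF IJ(1) w(1)] close[OF IJ(2) w(2)] by linarith
  moreover have "0 < exp (- (4 * \<kappa>)) * D ((P ^^ ?I) t)" "0 < exp (- (4 * \<kappa>)) * D ((P ^^ ?J) t)"
    using D_pos by simp_all
  \<comment> \<open>This is where the 5 in \<open>height\<close> comes from: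
    \<open>9 / 4 * (1 / 5)\<close> is below \<open>1 / 2\<close>.\<close>
  moreover have False
    if "(a + b) / 2 \<le> d" "d \<le> 9 / 4 * u + 9 / 4 * v" "0 < a" "0 < b" "u \<le> a / 5" "v \<le> b / 5"
    for a b d u v :: real
    using that by simp
  ultimately show False
    using DP_le[OF IJ(1)] DP_le[OF IJ(2)] by blast
qed

lemma HF_holomorphic:
  assumes "0 < y" "y \<le> height L * D t" "j < L * Q"
  shows "(H \<circ> (F ^^ j)) holomorphic_on ball (Complex t (- y)) (y / 2)"
proof (rule holomorphic_on_compose)
  note bs = ball_subset_disc[OF assms(1,2)]
  have "((F ^^ j) has_field_derivative dF j w) (at w)" if "w \<in> ball (Complex t (- y)) (y / 2)" for w
    using orbit_disc(1)[of j L w t] bs[OF that] assms(3) by (intro F_iter_deriv) auto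
  then show "(F ^^ j) holomorphic_on ball (Complex t (- y)) (y / 2)"
    by (meson field_differentiable_def field_differentiable_at_within holomorphic_on_def)
  show "H holomorphic_on (F ^^ j) ` ball (Complex t (- y)) (y / 2)"
    using F_iter_in_lower_strip[OF assms(3)] bs by (intro holomorphic_on_subset[OF H_hol]) blast
qed

lemma B_nonneg: "0 \<le> B"
  using H_bdd[of "Complex 0 (- (e / 2))"] e_pos by (auto intro: order.trans[OF norm_ge_zero])

text \<open>Within a block, the Bloch discs are disjoint subsets of \<open>cball 0 B\<close>, so
  their squared radii sum to at most \<open>B\<^sup>2\<close>, and Cauchy-Schwarz gives
  \<open>sqrt Q * B\<close> for the radii themselves. Disjointness is only known within a block, so
  the bounds for the \<open>L\<close> blocks are added.\<close>

lemma sum_derivatives_le: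
  assumes y: "0 < y" "y \<le> height L * D t"
  shows "(\<Sum>j<L * Q. norm (deriv (H \<circ> (F ^^ j)) (Complex t (- y)))) \<le> 24 / y * (real L * sqrt Q * B)"
proof -
  let ?u = "Complex t (- y)"
  \<comment> \<open>The Bloch radius for a ball of radius \<open>y / 2\<close>, with
    \<open>1 / 12\<close> as the constant in Bloch's theorem.\<close>
  define a where "a j = y / 24 * norm (deriv (H \<circ> (F ^^ j)) ?u)" for j
  have a_nonneg: "0 \<le> a j" for j using y(1) by (simp add: a_def)
  have block: "(\<Sum>i<Q. a (i + k * Q)) \<le> sqrt Q * B" if "k < L" for k
  proof (rule sum_le_sqrt_card_mult[OF _ B_nonneg])
    have "Suc k * Q \<le> L * Q" using that by (intro mult_le_mono1) simp
    then have I: "i + k * Q < L * Q" if "i < Q" for i using that by simp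
    have "\<exists>b. ball b (a (i + k * Q)) \<subseteq> (H \<circ> (F ^^ (i + k * Q))) ` ball ?u (y / 2)" if "i < Q" for i
    proof -
      have "0 < y / 2" "a (i + k * Q) \<le> y / 2 * norm (deriv (H \<circ> (F ^^ (i + k * Q))) ?u) / 12"
        using y(1) by (simp_all add: a_def)
      from Bloch[OF HF_holomorphic[OF y I[OF that]] this] show ?thesis by metis
    qed
    then obtain b where b: "\<And>i. i < Q \<Longrightarrow> ball (b i) (a (i + k * Q)) \<subseteq> (H \<circ> (F ^^ (i + k * Q))) ` ball ?u (y / 2)"
      by metis
    show "(\<Sum>i<Q. (a (i + k * Q))\<^sup>2) \<le> B\<^sup>2"
    proof (rule sum_radius_squared_le[of Q "\<lambda>i. a (i + k * Q)" B b])
      fix i assume i: "i < Q"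
      have "norm (H ((F ^^ (i + k * Q)) w)) \<le> B" if "w \<in> ball ?u (y / 2)" for w
        using F_iter_in_lower_strip[OF I[OF i]] ball_subset_disc[OF y that] by (intro H_bdd) auto
      then have "(H \<circ> (F ^^ (i + k * Q))) ` ball ?u (y / 2) \<subseteq> cball 0 B" by auto
      then show "ball (b i) (a (i + k * Q)) \<subseteq> cball 0 B" using b[OF i] by blast
    next
      fix i j assume "i < Q" "j < Q" "i \<noteq> j"
      then have "(H \<circ> (F ^^ (i + k * Q))) ` ball ?u (y / 2) \<inter> (H \<circ> (F ^^ (j + k * Q))) ` ball ?u (y / 2) = {}"
        using images_disjoint[OF y \<open>k < L\<close>, of i j] by auto
      then show "ball (b i) (a (i + k * Q)) \<inter> ball (b j) (a (j + k * Q)) = {}"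
        using b[of i] b[of j] \<open>i < Q\<close> \<open>j < Q\<close> by blast
    qed (use a_nonneg B_nonneg in auto)
  qed
  have "(\<Sum>j<k * Q. a j) \<le> real k * (sqrt Q * B)" if "k \<le> L" for k
    using that
  proof (induction k)
    case (Suc k)
    have "(\<Sum>j<Suc k * Q. a j) = (\<Sum>j<k * Q. a j) + (\<Sum>i<Q. a (i + k * Q))"
      using sum_lessThan_add[of a "k * Q" Q] by (simp add: add.commute)
    also have "\<dots> \<le> real k * (sqrt Q * B) + sqrt Q * B"
      using Suc block[of k] by (intro add_mono) auto
    finally show ?case by (simp add: algebra_simps)
  qed simp
  from this[OF order_refl] have "y / 24 * (\<Sum>j<L * Q. norm (deriv (H \<circ> (F ^^ j)) ?u)) \<le> real L * sqrt Q * B"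
    by (simp add: a_def sum_distrib_left)
  then show ?thesis using y(1) by (simp add: field_simps)
qed

end

section \<open>Birkhoff sums along the barrier curve\<close>

lemma norm_sum_shift_diff_le:
  fixes a :: "nat \<Rightarrow> 'a::real_normed_vector"
  assumes "\<And>j. j < n + k \<Longrightarrow> norm (a j) \<le> M"
  shows "norm ((\<Sum>j<n. a j) - (\<Sum>j<n. a (j + k))) \<le> 2 * real k * M"
proof -
  have "(\<Sum>j<n. a j) + (\<Sum>j<k. a (j + n)) = (\<Sum>j<k. a j) + (\<Sum>j<n. a (j + k))"
    using sum_lessThan_add[of a n k] sum_lessThan_add[of a k n] by (simp add: add.commute)
  then have "(\<Sum>j<n. a j) - (\<Sum>j<n. a (j + k)) = (\<Sum>j<k. a j) - (\<Sum>j<k. a (j + n))"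
    by (simp add: algebra_simps)
  also have "norm \<dots> \<le> norm (\<Sum>j<k. a j) + norm (\<Sum>j<k. a (j + n))"
    by (rule norm_triangle_ineq4)
  also have "\<dots> \<le> real k * M + real k * M"
    using assms sum_norm_bound[of "{..<k}" a M] sum_norm_bound[of "{..<k}" "\<lambda>j. a (j + n)" M]
    by (intro add_mono) auto
  finally show ?thesis by (simp add: ac_simps)
qed

locale observable_strip = exterior_strip +
  fixes \<phi> :: "complex \<Rightarrow> complex" and W :: "complex set" and M M' :: real
  assumes W_open: "open W" and \<phi>_hol: "\<phi> holomorphic_on W"
    and H_W: "\<And>w. w \<in> lower_strip \<Longrightarrow> H w \<in> W"
    and \<phi>_bdd: "\<And>w. w \<in> lower_strip \<Longrightarrow> norm (\<phi> (H w)) \<le> M"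
    and \<phi>'_bdd: "\<And>w. w \<in> lower_strip \<Longrightarrow> norm (deriv \<phi> (H w)) \<le> M'"
begin

definition "S N w = (\<Sum>j<N. \<phi> (H ((F ^^ j) w)))"

lemma M_nonneg: "0 \<le> M" "0 \<le> M'"
  using \<phi>_bdd[of "Complex 0 (- (e / 2))"] \<phi>'_bdd[of "Complex 0 (- (e / 2))"] e_pos
  by (auto intro: order.trans[OF norm_ge_zero])

end

locale observable_strip_return = exterior_strip_return + observable_strip
begin

lemma S_deriv_le:
  assumes y: "0 < y" "y \<le> height K * D t" and N: "N \<le> K * Q"
  obtains d where "(S N has_field_derivative d) (at (Complex t (- y)))"
    "norm d \<le> M' * (24 / y * (real K * sqrt Q * B))"
proof -
  let ?u = "Complex t (- y)"
  have u: "?u \<in> ball ?u (y / 2)" using y by simp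
  note bs = ball_subset_disc[OF y u]
  have low: "(F ^^ j) ?u \<in> lower_strip" if "j < K * Q" for j
    using F_iter_in_lower_strip[OF that bs(3,1)] .
  define d where "d j = deriv \<phi> (H ((F ^^ j) ?u)) * deriv (H \<circ> (F ^^ j)) ?u" for j
  have "((\<lambda>w. \<phi> (H ((F ^^ j) w))) has_field_derivative d j) (at ?u)" if "j < N" for j
  proof -
    have j: "j < K * Q" using that N by simp
    have 1: "((H \<circ> (F ^^ j)) has_field_derivative deriv (H \<circ> (F ^^ j)) ?u) (at ?u)"
      using HF_holomorphic[OF y j] u by (intro holomorphic_derivI) auto
    have "(\<phi> has_field_derivative deriv \<phi> ((H \<circ> (F ^^ j)) ?u)) (at ((H \<circ> (F ^^ j)) ?u))"
      using \<phi>_hol W_open H_W[OF low[OF j]] by (intro holomorphic_derivI) auto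
    from DERIV_chain[OF this 1] show ?thesis by (simp add: o_def d_def)
  qed
  then have "(S N has_field_derivative (\<Sum>j<N. d j)) (at ?u)"
    unfolding S_def[abs_def] by (intro DERIV_sum) auto
  moreover have "norm (\<Sum>j<N. d j) \<le> M' * (24 / y * (real K * sqrt Q * B))"
  proof -
    have "norm (\<Sum>j<N. d j) \<le> (\<Sum>j<N. M' * norm (deriv (H \<circ> (F ^^ j)) ?u))"
    proof (rule sum_norm_le)
      fix j assume "j \<in> {..<N}"
      then have "norm (deriv \<phi> (H ((F ^^ j) ?u))) \<le> M'" using low N by (intro \<phi>'_bdd) auto
      then show "norm (d j) \<le> M' * norm (deriv (H \<circ> (F ^^ j)) ?u)"
        unfolding d_def norm_mult by (rule mult_right_mono) simp
    qed
    also have "\<dots> \<le> (\<Sum>j<K * Q. M' * norm (deriv (H \<circ> (F ^^ j)) ?u))"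
      using N M_nonneg by (intro sum_mono2) auto
    also have "\<dots> = M' * (\<Sum>j<K * Q. norm (deriv (H \<circ> (F ^^ j)) ?u))"
      by (simp add: sum_distrib_left)
    also have "\<dots> \<le> M' * (24 / y * (real K * sqrt Q * B))"
      by (intro mult_left_mono sum_derivatives_le y M_nonneg)
    finally show ?thesis .
  qed
  ultimately show ?thesis using that by blast
qed

lemma barrier_scale_pos: "0 < barrier_scale K"
  using height_pos[of K] by (simp add: barrier_scale_def)

lemma barrier_scale_le: "barrier_scale K \<le> 1 / 2" "barrier_scale K \<le> height K" "barrier_scale K \<le> rad K"
proof -
  have "exp (- (6 * \<kappa>)) \<le> 1" "exp (- (18 * \<kappa>)) \<le> 1" using \<kappa>_nonneg by simp_all
  moreover have "height K * exp (- (18 * \<kappa>)) \<le> height K * 1"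
    using height_pos[of K] \<kappa>_nonneg by (intro mult_left_mono) auto
  moreover have "barrier_scale K \<le> exp (- (6 * \<kappa>)) / 2" "barrier_scale K \<le> height K * exp (- (18 * \<kappa>)) / 3"
    by (simp_all add: barrier_scale_def)
  ultimately show "barrier_scale K \<le> 1 / 2" "barrier_scale K \<le> height K"
    using height_pos[of K] by linarith+
  moreover have "height K \<le> rad K" using rad_pos[of K] by (auto simp: height_def min_le_iff_disj)
  ultimately show "barrier_scale K \<le> rad K" by simp
qed

text \<open>The depth inherits continuity and period 1 from \<open>D\<close>, so these points form a
  curve that closes up modulo 1.\<close>

definition "barrier K x = Complex x (- (barrier_scale K * D x))"

lemma below_barrier:
  assumes "0 < y" "y \<le> barrier_scale K * D x" "j < K * Q"
  shows "(F ^^ j) (Complex x (- y)) \<in> lower_strip"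
proof (rule F_iter_in_lower_strip[OF assms(3)])
  have "barrier_scale K * D x \<le> rad K * D x" using barrier_scale_le(3) D_pos[of x] by (intro mult_right_mono) auto
  then show "norm (Complex x (- y) - of_real x) \<le> rad K * D x"
    using assms(1,2) by (simp add: cmod_def)
qed (use assms in auto)

lemma D_lipschitz: "D v - D t \<le> (exp (4 * \<kappa>) + 1) * \<bar>t - v\<bar>"
  using G_lipschitz(2)[of v t] unfolding D_def by (simp add: distrib_right abs_minus_commute)

text \<open>By \<open>hitting\<close>, the orbit of \<open>\<xi>\<close> enters the window at
  \<open>x0\<close> at some time \<open>j < Q\<close>. At that time the barrier point of
  \<open>\<xi>\<close> has moved to \<open>w\<close>, at a depth comparable to that of the barrier
  point of \<open>x0\<close>, and a segment of length comparable to \<open>D x0\<close> joins the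
  two. The first error term is the time shift by \<open>j\<close>, the second the variation along
  the segment. The barrier point is followed for up to \<open>N + j\<close> steps, hence
  \<open>K = Suc L\<close>.\<close>

lemma barrier_compare:
  assumes "0 < L" and K: "K = Suc L" and N: "N = L * Q"
  shows "norm (S N (barrier K \<xi>) - S N (barrier K x0))
    \<le> 2 * real Q * M + 240 * exp (20 * \<kappa>) / barrier_scale K * M' * real K * B * sqrt Q"
proof -
  define c where "c = barrier_scale K"
  define b where "b = exp (2 * \<kappa>)"
  have c: "0 < c" "c \<le> 1 / 2" using barrier_scale_pos barrier_scale_le by (auto simp: c_def)
  have b: "1 \<le> b" "0 < b" using \<kappa>_nonneg by (simp_all add: b_def)
  have exps: "exp (- (2 * \<kappa>)) = 1 / b" "exp (4 * \<kappa>) = b ^ 2" "exp (8 * \<kappa>) = b ^ 4"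
    "exp (- (8 * \<kappa>)) = 1 / b ^ 4" "exp (20 * \<kappa>) = b ^ 10" "exp (- (6 * \<kappa>)) = 1 / b ^ 3"
    "exp (- (18 * \<kappa>)) = 1 / b ^ 9"
    by (simp_all add: b_def exp_minus exp_of_nat_mult[symmetric] inverse_eq_divide)
  obtain j s where js: "j < Q" "(P ^^ j) \<xi> + of_int s \<in> closed_segment x0 (G (G x0))"
    using hitting by blast
  define v where "v = (P ^^ j) \<xi> + of_int s"
  define w where "w = (F ^^ j) (barrier K \<xi>) + of_int s"
  define R where "R = DP j \<xi> * D \<xi>"
  define D0 where "D0 = D x0"
  have pos: "0 < R" "0 < D0" "0 < D v" "0 < D \<xi>" using DP_pos D_pos by (simp_all add: R_def D0_def)
  have Dv: "D0 / b ^ 4 \<le> D v" "D v \<le> b ^ 4 * D0"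
    using D_window[OF js(2)] by (simp_all add: exps D0_def v_def)
  have "D v = D ((P ^^ j) \<xi>)" by (simp add: v_def D_shift)
  moreover have e1: "exp (- (2 * \<kappa> * real 1)) = 1 / b" "exp (2 * \<kappa> * real 1) = b"
    by (simp_all add: exps b_def)
  ultimately have "1 / b * R \<le> D v" and R2: "D v \<le> b * R"
    using DP_D_bounds[of j 1 \<xi>] js(1) unfolding R_def e1 by simp_all
  then have R: "R \<le> b * D v" "D v \<le> b * R"
    using b by (simp_all add: field_simps)
  have norm_bar: "norm (barrier K \<xi> - of_real \<xi>) = c * D \<xi>"
    using c pos by (simp add: barrier_def cmod_def c_def)
  have disc: "norm (barrier K \<xi> - of_real \<xi>) \<le> rad K * D \<xi>"
    unfolding norm_bar using barrier_scale_le(3) pos by (simp add: c_def)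
  have "j \<le> K * Q" using js(1) K by simp
  \<comment> \<open>Linear approximation of \<open>F ^^ j\<close> at \<open>\<xi>\<close>: the
    barrier point lands near depth \<open>c * R\<close>, where \<open>R\<close> is comparable to
    \<open>D v\<close>.\<close>
  have "norm ((F ^^ j) (barrier K \<xi>) - of_real ((P ^^ j) \<xi>) - of_real (DP j \<xi>) * (barrier K \<xi> - of_real \<xi>))
      \<le> DP j \<xi> / 2 * (c * D \<xi>)"
    using orbit_disc(3)[OF \<open>j \<le> K * Q\<close> disc] unfolding norm_bar .
  moreover have "(F ^^ j) (barrier K \<xi>) - of_real ((P ^^ j) \<xi>) - of_real (DP j \<xi>) * (barrier K \<xi> - of_real \<xi>)
      = w - Complex v (- (c * R))"
    by (simp add: complex_eq_iff w_def v_def barrier_def c_def R_def)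
  ultimately have w: "norm (w - Complex v (- (c * R))) \<le> c * R / 2"
    by (simp add: R_def ac_simps)
  have Re_w: "\<bar>Re w - v\<bar> \<le> c * R / 2" and Im_w: "\<bar>Im w + c * R\<bar> \<le> c * R / 2"
    using w abs_Re_le_cmod[of "w - Complex v (- (c * R))"] abs_Im_le_cmod[of "w - Complex v (- (c * R))"]
    by simp_all
  have R0: "R \<le> b ^ 5 * D0" "D0 / b ^ 5 \<le> R"
  proof -
    have "b * D v \<le> b * (b ^ 4 * D0)" using Dv b by (intro mult_left_mono) auto
    then show "R \<le> b ^ 5 * D0" using R(1) by (simp add: eval_nat_numeral ac_simps)
    have "D0 / b ^ 4 \<le> b * R" using Dv(1) R(2) by simp
    then show "D0 / b ^ 5 \<le> R" using b by (simp add: field_simps eval_nat_numeral)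
  qed
  \<comment> \<open>Lower bound for the depth along the segment from \<open>barrier K x0\<close> to
    \<open>w\<close>.\<close>
  define y0 where "y0 = c * D0 / (2 * b ^ 5)"
  have "0 < y0" using c pos b by (simp add: y0_def)
  have c_small: "c \<le> 1 / (2 * b ^ 3)" "c \<le> height K / (3 * b ^ 9)"
    by (simp_all add: c_def barrier_scale_def exps)
  \<comment> \<open>An abscissa of the segment lies in the window, where \<open>D\<close> is
    comparable to \<open>D0\<close>, or between \<open>v\<close> and \<open>Re w\<close>, a distance
    so short that the Lipschitz bound on \<open>D\<close> costs at most half of
    \<open>D v\<close>.\<close>
  have D_seg: "D0 / (2 * b ^ 4) \<le> D t" if t: "t \<in> closed_segment x0 (Re w)" for t
  proof -
    have "t \<in> closed_segment x0 v \<or> \<bar>t - v\<bar> \<le> \<bar>Re w - v\<bar>"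
      using t by (auto simp: closed_segment_eq_real_ivl split: if_splits)
    then show ?thesis
    proof
      assume "t \<in> closed_segment x0 v"
      moreover have "closed_segment x0 v \<subseteq> closed_segment x0 (G (G x0))"
        using js(2) by (simp add: subset_closed_segment v_def)
      ultimately have "D0 / b ^ 4 \<le> D t"
        using D_window(1)[of t x0] by (auto simp: exps D0_def)
      moreover have "D0 / (2 * b ^ 4) \<le> D0 / b ^ 4" using pos b by (simp add: field_simps)
      ultimately show ?thesis by linarith
    next
      assume "\<bar>t - v\<bar> \<le> \<bar>Re w - v\<bar>"
      then have tv: "\<bar>t - v\<bar> \<le> c * R / 2" using Re_w by linarith
      have "(b ^ 2 + 1) * \<bar>t - v\<bar> \<le> (2 * b ^ 2) * (c * R / 2)"
        using tv b by (intro mult_mono) (auto simp: power_increasing[of 0 2 b, simplified])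
      also have "\<dots> = b ^ 2 * c * R" by simp
      also have "\<dots> \<le> b ^ 2 * c * (b * D v)" using R b c by (intro mult_left_mono) auto
      also have "\<dots> = c * (b ^ 3 * D v)" by (simp add: eval_nat_numeral)
      also have "\<dots> \<le> 1 / (2 * b ^ 3) * (b ^ 3 * D v)"
        using c_small b pos by (intro mult_right_mono) auto
      also have "\<dots> = D v / 2" using b by simp
      finally have "(b ^ 2 + 1) * \<bar>t - v\<bar> \<le> D v / 2" .
      then have "D v / 2 \<le> D t"
        using D_lipschitz[of v t] unfolding exps by linarith
      moreover have "D0 / (2 * b ^ 4) \<le> D v / 2" using Dv(1) by simp
      ultimately show ?thesis by linarith
    qed
  qed
  have b_pow: "1 \<le> b ^ n" for n using b by simp
  have seg_ex: "\<exists>d. (S N has_field_derivative d) (at z) \<and> norm d \<le> M' * (24 / y0 * (real K * sqrt Q * B))"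
    if z: "z \<in> closed_segment (barrier K x0) w" for z
  proof -
    obtain u where u: "0 \<le> u" "u \<le> 1" and zu: "z = (1 - u) *\<^sub>R barrier K x0 + u *\<^sub>R w"
      using z by (auto simp: closed_segment_def)
    define y where "y = - Im z"
    have zy: "z = Complex (Re z) (- y)" by (simp add: y_def complex_eq_iff)
    have Re_z: "Re z \<in> closed_segment x0 (Re w)"
      using u unfolding closed_segment_def by (auto simp: zu barrier_def)
    have y: "y = (1 - u) * (c * D0) + u * (- Im w)"
      by (simp add: y_def zu barrier_def c_def D0_def)
    have lo: "y0 \<le> c * D0" "y0 \<le> - Im w"
    proof -
      have "c * D0 * 1 \<le> c * D0 * (2 * b ^ 5)"
        using c pos b_pow[of 5] by (intro mult_left_mono) auto
      then show "y0 \<le> c * D0" using b by (simp add: y0_def field_simps)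
      have "c * (D0 / b ^ 5) \<le> c * R" using R0 c by (intro mult_left_mono) auto
      then have "y0 \<le> c * R / 2" by (simp add: y0_def)
      then show "y0 \<le> - Im w" using Im_w by linarith
    qed
    \<comment> \<open>Upper bound for the depth; by \<open>D_seg\<close> it is admissible at every
      abscissa of the segment.\<close>
    define y1 where "y1 = height K * (D0 / (2 * b ^ 4))"
    have y1: "3 / 2 * c * (b ^ 5 * D0) \<le> y1"
    proof -
      have "c * (3 / 2 * b ^ 5 * D0) \<le> height K / (3 * b ^ 9) * (3 / 2 * b ^ 5 * D0)"
        using c_small b pos by (intro mult_right_mono) auto
      also have "\<dots> = y1" using b by (simp add: y1_def field_simps eval_nat_numeral)
      finally show ?thesis by (simp add: ac_simps)
    qed
    have hi: "c * D0 \<le> y1" "- Im w \<le> y1"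
    proof -
      have "c * D0 * 1 \<le> c * D0 * (3 / 2 * b ^ 5)"
        using c pos b_pow[of 5] by (intro mult_left_mono) auto
      then show "c * D0 \<le> y1" using y1 by (simp add: ac_simps)
      have "3 / 2 * c * R \<le> 3 / 2 * c * (b ^ 5 * D0)" using R0 c by (intro mult_left_mono) auto
      then show "- Im w \<le> y1" using Im_w y1 by linarith
    qed
    have "(1 - u) * y0 + u * y0 \<le> y" "y \<le> (1 - u) * y1 + u * y1"
      unfolding y using lo hi u by (intro add_mono mult_left_mono; simp)+
    then have yy: "y0 \<le> y" "y \<le> y1" by (simp_all add: algebra_simps)
    have "y1 \<le> height K * D (Re z)"
      unfolding y1_def using D_seg[OF Re_z] height_pos[of K] by (intro mult_left_mono) auto
    with yy have "y \<le> height K * D (Re z)" by linarith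
    moreover have "N \<le> K * Q" by (simp add: N K)
    moreover have "0 < y" using yy \<open>0 < y0\<close> by linarith
    ultimately obtain d where d: "(S N has_field_derivative d) (at z)"
      "norm d \<le> M' * (24 / y * (real K * sqrt Q * B))"
      using S_deriv_le[of y K "Re z" N] zy by metis
    have "M' * (24 / y * (real K * sqrt Q * B)) \<le> M' * (24 / y0 * (real K * sqrt Q * B))"
      using yy \<open>0 < y0\<close> M_nonneg B_nonneg
      by (intro mult_left_mono mult_right_mono divide_left_mono) auto
    then show ?thesis using d by (intro exI[of _ d]) auto
  qed
  have var: "norm (S N w - S N (barrier K x0)) \<le> M' * (24 / y0 * (real K * sqrt Q * B)) * norm (w - barrier K x0)"
  proof (rule field_differentiable_bound[of "closed_segment (barrier K x0) w" "S N" "deriv (S N)"])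
    fix z assume z: "z \<in> closed_segment (barrier K x0) w"
    from seg_ex[OF z] obtain d where d: "(S N has_field_derivative d) (at z)"
      "norm d \<le> M' * (24 / y0 * (real K * sqrt Q * B))" by blast
    then have "deriv (S N) z = d" by (simp add: DERIV_imp_deriv)
    with d show "(S N has_field_derivative deriv (S N) z) (at z within closed_segment (barrier K x0) w)"
      "norm (deriv (S N) z) \<le> M' * (24 / y0 * (real K * sqrt Q * B))"
      by (simp_all add: has_field_derivative_at_within)
  qed auto
  have len: "norm (w - barrier K x0) \<le> 5 * b ^ 5 * D0"
  proof -
    have "D (G x0) \<le> b ^ 4 * D0"
      using D_window(2)[OF G_in_window] by (simp add: exps D0_def)
    moreover have "\<bar>v - x0\<bar> \<le> D (G x0) + D0"
      using js(2) unfolding v_def[symmetric] D_def D0_def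
      by (auto simp: closed_segment_eq_real_ivl split: if_splits)
    ultimately have vx: "\<bar>v - x0\<bar> \<le> b ^ 4 * D0 + D0" by linarith
    have "norm (Complex v (- (c * R)) - barrier K x0) \<le> \<bar>v - x0\<bar> + \<bar>c * D0 - c * R\<bar>"
      using cmod_le[of "Complex v (- (c * R)) - barrier K x0"] by (simp add: barrier_def c_def D0_def)
    moreover have "norm (w - barrier K x0)
        \<le> norm (w - Complex v (- (c * R))) + norm (Complex v (- (c * R)) - barrier K x0)"
      using norm_triangle_ineq[of "w - Complex v (- (c * R))" "Complex v (- (c * R)) - barrier K x0"] by simp
    moreover have "\<bar>c * D0 - c * R\<bar> \<le> c * D0 + c * R"
      using c pos by (simp add: abs_le_iff)
    moreover have "c * D0 \<le> D0" "c * R \<le> R"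
      using c pos by simp_all
    moreover have "b ^ 4 * D0 \<le> b ^ 5 * D0" "D0 \<le> b ^ 5 * D0"
      using b pos b_pow[of 5] by (simp_all add: power_increasing)
    ultimately show ?thesis using w R0(1) vx by linarith
  qed
  have "0 \<le> M' * (24 / y0 * (real K * sqrt Q * B))"
    using M_nonneg B_nonneg \<open>0 < y0\<close> by simp
  note order.trans[OF var mult_left_mono[OF len this]]
  \<comment> \<open>The constant is \<open>24 * 2 * 5\<close>: from
    \<open>sum_derivatives_le\<close>, from the 2 in \<open>y0\<close> and from the length of the
    segment.\<close>
  also have "M' * (24 / y0 * (real K * sqrt Q * B)) * (5 * b ^ 5 * D0)
      = 240 * b ^ 10 / c * M' * real K * B * sqrt Q"
    using pos b c unfolding y0_def by (simp add: field_simps eval_nat_numeral)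
  finally have 1: "norm (S N w - S N (barrier K x0)) \<le> 240 * b ^ 10 / c * M' * real K * B * sqrt Q" .
  have low: "(F ^^ i) (barrier K \<xi>) \<in> lower_strip" if "i < K * Q" for i
    unfolding barrier_def using that c pos by (intro below_barrier) (auto simp: c_def)
  \<comment> \<open>The orbit of \<open>w\<close> is that of the barrier point of
    \<open>\<xi>\<close> from time \<open>j\<close> on, up to an integer translation under which
    \<open>H\<close> is invariant.\<close>
  have "S N w = (\<Sum>i<N. \<phi> (H ((F ^^ (i + j)) (barrier K \<xi>))))"
    unfolding S_def
  proof (rule sum.cong)
    fix i assume i: "i \<in> {..<N}"
    then have ij: "i' + j < K * Q" if "i' \<le> i" for i' using js(1) that by (simp add: N K)
    have "(F ^^ i) w = (F ^^ (i + j)) (barrier K \<xi>) + of_int s"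
      unfolding w_def funpow_add comp_apply
    proof (rule F_iter_shift)
      fix i' assume "i' < i"
      then show "\<bar>Im ((F ^^ i') ((F ^^ j) (barrier K \<xi>)))\<bar> < e"
        using low[OF ij[of i']] by (simp add: funpow_add)
    qed
    then show "\<phi> (H ((F ^^ i) w)) = \<phi> (H ((F ^^ (i + j)) (barrier K \<xi>)))"
      using H_shift_int low ij[of i] by simp
  qed simp
  moreover have "norm ((\<Sum>i<N. \<phi> (H ((F ^^ i) (barrier K \<xi>)))) - (\<Sum>i<N. \<phi> (H ((F ^^ (i + j)) (barrier K \<xi>)))))
      \<le> 2 * real j * M"
    using js(1) low by (intro norm_sum_shift_diff_le \<phi>_bdd) (auto simp: N K)
  moreover have "2 * real j * M \<le> 2 * real Q * M"
    using js(1) M_nonneg by (intro mult_right_mono) auto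
  ultimately have 2: "norm (S N (barrier K \<xi>) - S N w) \<le> 2 * real Q * M"
    by (simp add: S_def)
  show ?thesis
    using norm_triangle_ineq[of "S N (barrier K \<xi>) - S N w" "S N w - S N (barrier K x0)"] 1 2
    unfolding exps c_def by simp
qed

end

context observable_strip
begin

text \<open>\<open>L\<close> is chosen first, so that a shift by \<open>Q\<close> costs at most half
  the allowed error over \<open>L Q\<close> steps. The constant \<open>C\<close> is then fixed
  before \<open>Q\<close>, which is taken so large that \<open>C * sqrt Q\<close> costs at most the
  other half. The value \<open>a\<close> is the sum at the barrier point of 0.\<close>

lemma exists_barrier:
  assumes "0 < \<eta>"
  obtains N :: nat and c :: "real \<Rightarrow> real" and a :: complex
  where "0 < N" "continuous_on UNIV c" "\<And>x. 0 < c x" "\<And>x. c (x + 1) = c x"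
    "\<And>x y j. 0 < y \<Longrightarrow> y \<le> c x \<Longrightarrow> j < N \<Longrightarrow> (F ^^ j) (Complex x (- y)) \<in> lower_strip"
    "\<And>x. norm (S N (Complex x (- c x)) - a) \<le> \<eta> * real N"
proof -
  obtain L0 :: nat where L0: "4 * M / \<eta> \<le> real L0" using real_arch_simple by blast
  define L where "L = Suc L0"
  have L: "0 < L" "2 * M \<le> \<eta> / 2 * real L"
    using L0 assms by (auto simp: L_def field_simps)
  define K where "K = Suc L"
  define C where "C = 240 * exp (20 * \<kappa>) / barrier_scale K * M' * real K * B"
  obtain Q0 :: nat where Q0: "(2 * C / \<eta>)\<^sup>2 \<le> real Q0" using real_arch_simple by blast
  obtain q Q p p' where ret: "circle_return P P' \<rho> \<kappa> q Q p p'" and QQ: "Q0 \<le> Q"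
    using exists_return_times by blast
  interpret observable_strip_return P P' \<rho> \<kappa> F e q Q p p' H B \<phi> W M M'
    by intro_locales (use ret in \<open>simp add: circle_return_def\<close>)
  have QL: "0 < Q" using q_less by simp
  have "(2 * C / \<eta>)\<^sup>2 \<le> real Q" using Q0 QQ by (meson of_nat_le_iff order.trans)
  then have "2 * C / \<eta> \<le> sqrt Q" by (rule real_le_rsqrt)
  then have "C \<le> \<eta> / 2 * sqrt Q" using assms by (simp add: field_simps)
  then have "C * sqrt Q \<le> \<eta> / 2 * sqrt Q * sqrt Q" by (rule mult_right_mono) simp
  also have "\<dots> = \<eta> / 2 * real Q * 1" by simp
  also have "\<dots> \<le> \<eta> / 2 * real Q * real L" using L(1) assms by (intro mult_left_mono) auto
  finally have C_le: "C * sqrt Q \<le> \<eta> / 2 * (real L * real Q)" by (simp add: ac_simps)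
  have M_le: "2 * real Q * M \<le> \<eta> / 2 * (real L * real Q)"
    using mult_left_mono[OF L(2), of "real Q"] by (simp add: ac_simps)
  show ?thesis
  proof (rule that)
    show "0 < L * Q" using L QL by simp
    show "continuous_on UNIV (\<lambda>x. barrier_scale K * D x)" by (intro continuous_intros D_continuous)
    show "0 < barrier_scale K * D x" for x using barrier_scale_pos D_pos by simp
    show "barrier_scale K * D (x + 1) = barrier_scale K * D x" for x using D_shift[of x 1] by simp
    show "(F ^^ j) (Complex x (- y)) \<in> lower_strip" if "0 < y" "y \<le> barrier_scale K * D x" "j < L * Q" for x y j
      using below_barrier[OF that(1,2)] that(3) by (simp add: K_def)
    show "norm (S (L * Q) (Complex x (- (barrier_scale K * D x))) - S (L * Q) (barrier K 0)) \<le> \<eta> * real (L * Q)" for x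
      using barrier_compare[OF L(1) K_def refl, of x 0] C_le M_le
      unfolding barrier_def[of K x] C_def by simp
  qed
qed

end

section \<open>Exterior Riemann maps\<close>

text \<open>The covering that lifts circle maps to the line. Its modulus exceeds 1 exactly below the
  real axis, so the exterior of the disc becomes a lower half-plane.\<close>

definition E :: "complex \<Rightarrow> complex" where
  "E w = exp (2 * of_real pi * \<i> * w)"

lemma norm_E: "norm (E w) = exp (- 2 * pi * Im w)"
  by (simp add: E_def)

lemma norm_E_gt_1_iff: "1 < norm (E w) \<longleftrightarrow> Im w < 0"
  by (simp add: norm_E mult_less_0_iff)

lemma E_of_real: "E (of_real x) = cis (2 * pi * x)"
  by (simp add: E_def cis_conv_exp ac_simps)

lemma E_eq_iff: "E w = E w' \<longleftrightarrow> (\<exists>n::int. w = w' + of_int n)"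
proof -
  have "E w = E w' \<longleftrightarrow> (\<exists>n::int. 2 * of_real pi * \<i> * w = 2 * of_real pi * \<i> * w' + (of_int (2 * n) * pi) * \<i>)"
    unfolding E_def exp_eq ..
  also have "\<dots> \<longleftrightarrow> (\<exists>n::int. (2 * of_real pi * \<i>) * w = (2 * of_real pi * \<i>) * (w' + of_int n))"
    by (simp add: algebra_simps)
  also have "\<dots> \<longleftrightarrow> (\<exists>n::int. w = w' + of_int n)"
    by (subst mult_cancel_left) simp
  finally show ?thesis .
qed

lemma E_shift: "E (w + of_int n) = E w"
  using E_eq_iff by blast

lemma E_nonzero: "E w \<noteq> 0"
  by (simp add: E_def)

lemma E_surj: assumes "\<zeta> \<noteq> 0" obtains w where "\<zeta> = E w"
proof
  show "\<zeta> = E (Ln \<zeta> / (2 * of_real pi * \<i>))"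
    using assms by (simp add: E_def)
qed

lemma E_holomorphic: "E holomorphic_on S"
  unfolding E_def[abs_def] by (intro holomorphic_intros)

lemma E_open_map: "open S \<Longrightarrow> open (E ` S)"
proof (rule open_mapping_thm[of E UNIV S])
  show "\<not> E constant_on UNIV"
  proof
    assume "E constant_on UNIV"
    then obtain c where "\<And>x. E x = c" unfolding constant_on_def by blast
    from this[of 0] this[of "1 / 2"] show False by (simp add: E_def)
  qed
qed (auto intro: E_holomorphic)

locale exterior_map =
  fixes K :: "complex set" and h :: "complex \<Rightarrow> complex"
  assumes K_compact: "compact K" and h_ext: "exterior_riemann_map K h"
begin

abbreviation "Ext \<equiv> {\<zeta>::complex. 1 < norm \<zeta>}"

lemma open_Ext: "open Ext"
  by (intro open_Collect_less continuous_intros)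

lemma h_hol: "h holomorphic_on Ext" and h_bij: "bij_betw h Ext (- K)"
  and h_inf: "filterlim h at_infinity at_infinity"
  using h_ext by (auto simp: exterior_riemann_map_def)

lemma h_inj: "inj_on h Ext" and h_image: "h ` Ext = - K"
  using h_bij by (auto simp: bij_betw_def)

lemma h_open_map: "open S \<Longrightarrow> S \<subseteq> Ext \<Longrightarrow> open (h ` S)"
  by (rule open_mapping_thm3) (auto intro: holomorphic_on_subset[OF h_hol] inj_on_subset[OF h_inj])

lemma h_eventually_large: obtains R where "\<And>\<zeta>. R \<le> norm \<zeta> \<Longrightarrow> b < norm (h \<zeta>)"
proof -
  have "eventually (\<lambda>z::complex. b < norm z) at_infinity"
    unfolding eventually_at_infinity by (intro exI[of _ "b + 1"]) auto
  then have "eventually (\<lambda>\<zeta>. b < norm (h \<zeta>)) at_infinity"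
    using h_inf by (rule eventually_compose_filterlim)
  then show ?thesis using that unfolding eventually_at_infinity by blast
qed

text \<open>Since \<open>h\<close> tends to infinity at infinity, a convergent sequence of values
  has bounded preimages. A subsequence of these converges in the closed set \<open>X\<close>, where
  \<open>h\<close> is continuous.\<close>

lemma closed_h_image:
  assumes "closed X" "X \<subseteq> Ext"
  shows "closed (h ` X)"
  unfolding closed_sequential_limits
proof (intro allI impI, elim conjE)
  fix z l assume z: "\<forall>n. z n \<in> h ` X" and lim: "z \<longlonglongrightarrow> l"
  then have "\<forall>n. \<exists>x. x \<in> X \<and> z n = h x" by blast
  then obtain \<zeta> where \<zeta>: "\<And>n. \<zeta> n \<in> X" "\<And>n. z n = h (\<zeta> n)" by (auto dest!: choice)
  have "Bseq z" using lim by (simp add: convergentI convergent_imp_Bseq)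
  then obtain b where b: "\<And>n. norm (z n) \<le> b" by (auto simp: Bseq_def)
  obtain R where R: "\<And>\<zeta>. R \<le> norm \<zeta> \<Longrightarrow> b < norm (h \<zeta>)" using h_eventually_large by blast
  have "norm (\<zeta> n) \<le> R" for n
    using R[of "\<zeta> n"] b[of n] \<zeta>(2)[of n] by fastforce
  then have "\<zeta> n \<in> X \<inter> cball 0 R" for n using \<zeta>(1) by auto
  moreover have "compact (X \<inter> cball 0 R)" using assms(1) by (intro closed_Int_compact) auto
  ultimately obtain x r where x: "x \<in> X \<inter> cball 0 R" "strict_mono r" "(\<zeta> \<circ> r) \<longlonglongrightarrow> x"
    unfolding compact_eq_seq_compact_metric seq_compact_def by metis
  have "isCont h x"
    using x(1) assms(2) h_hol open_Ext
    by (meson IntE continuous_on_eq_continuous_at holomorphic_on_imp_continuous_on subsetD)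
  then have "(\<lambda>n. h (\<zeta> (r n))) \<longlonglongrightarrow> h x"
    using isCont_tendsto_compose[OF _ x(3)[unfolded o_def]] by blast
  moreover have "(\<lambda>n. h (\<zeta> (r n))) \<longlonglongrightarrow> l"
    using LIMSEQ_subseq_LIMSEQ[OF lim x(2)] \<zeta>(2) by (simp add: o_def)
  ultimately have "l = h x" using LIMSEQ_unique by blast
  then show "l \<in> h ` X" using x(1) by auto
qed

lemma h_inverse: obtains k where "continuous_on (- K) k" "\<And>\<zeta>. 1 < norm \<zeta> \<Longrightarrow> k (h \<zeta>) = \<zeta>"
  "\<And>z. z \<notin> K \<Longrightarrow> 1 < norm (k z)" "\<And>z. z \<notin> K \<Longrightarrow> h (k z) = z"
proof -
  obtain k where k: "k holomorphic_on h ` Ext" "\<And>z. z \<in> Ext \<Longrightarrow> deriv h z * deriv k (h z) = 1"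
    "\<And>z. z \<in> Ext \<Longrightarrow> k (h z) = z"
    using holomorphic_has_inverse[OF h_hol open_Ext h_inj] by metis
  have "1 < norm (k z) \<and> h (k z) = z" if "z \<notin> K" for z
  proof -
    have "z \<in> h ` Ext" using that by (simp add: h_image)
    then obtain \<zeta> where "\<zeta> \<in> Ext" "z = h \<zeta>" by blast
    then show ?thesis using k(3) by simp
  qed
  moreover have "continuous_on (- K) k"
    using k(1) by (simp add: h_image holomorphic_on_imp_continuous_on)
  ultimately show ?thesis using k(3) by (intro that) auto
qed

text \<open>Outside a large disc that contains \<open>K\<close> and the image of the circle of
  radius \<open>R\<close>, the inverse of \<open>h\<close> never has modulus \<open>R\<close>. This
  outer region is connected and contains images of points of large modulus, so it contains no image
  of a point of modulus below \<open>R\<close>.\<close>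

lemma bounded_h_image: "bounded (h ` {\<zeta>. 1 < norm \<zeta> \<and> norm \<zeta> < R})"
proof (cases "1 < R")
  case True
  obtain k where k: "continuous_on (- K) k" "\<And>\<zeta>. 1 < norm \<zeta> \<Longrightarrow> k (h \<zeta>) = \<zeta>"
    "\<And>z. z \<notin> K \<Longrightarrow> 1 < norm (k z)" "\<And>z. z \<notin> K \<Longrightarrow> h (k z) = z"
    using h_inverse by blast
  have "compact (h ` sphere 0 R)"
    using True by (intro compact_continuous_image holomorphic_on_imp_continuous_on holomorphic_on_subset[OF h_hol]) auto
  then have "bounded (K \<union> h ` sphere 0 R)"
    using K_compact by (simp add: compact_imp_bounded)
  then obtain b where "\<And>z. z \<in> K \<union> h ` sphere 0 R \<Longrightarrow> norm z \<le> b"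
    unfolding bounded_iff by blast
  then have b: "K \<subseteq> cball 0 b" "h ` sphere 0 R \<subseteq> cball 0 b" by auto
  have "- cball 0 b \<subseteq> - K" using b by auto
  then have "connected (k ` (- cball 0 b))"
    by (intro connected_continuous_image continuous_on_subset[OF k(1)])
      (auto intro!: connected_complement_bounded_convex)
  then have conn: "connected ((\<lambda>z. norm (k z)) ` (- cball 0 b))"
    using connected_continuous_image[of "k ` (- cball 0 b)" norm] by (simp add: image_image continuous_on_norm_id)
  obtain R' where R': "\<And>\<zeta>. R' \<le> norm \<zeta> \<Longrightarrow> b < norm (h \<zeta>)" using h_eventually_large by blast
  define \<zeta>0 :: complex where "\<zeta>0 = of_real (max R' R + 1)"
  have \<zeta>0: "norm \<zeta>0 = max R' R + 1" using True by (simp add: \<zeta>0_def)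
  have "h ` {\<zeta>. 1 < norm \<zeta> \<and> norm \<zeta> < R} \<subseteq> cball 0 b"
  proof (rule ccontr)
    assume "\<not> ?thesis"
    then obtain z1 where "z1 \<in> h ` {\<zeta>. 1 < norm \<zeta> \<and> norm \<zeta> < R}" "z1 \<notin> cball 0 b" by blast
    then obtain \<zeta>1 where \<zeta>1: "1 < norm \<zeta>1" "norm \<zeta>1 < R" "h \<zeta>1 \<in> - cball 0 b" by blast
    have "norm \<zeta>1 \<in> (\<lambda>z. norm (k z)) ` (- cball 0 b)"
      using \<zeta>1 k(2)[of \<zeta>1] by (intro image_eqI[of _ _ "h \<zeta>1"]) auto
    moreover have "norm \<zeta>0 \<in> (\<lambda>z. norm (k z)) ` (- cball 0 b)"
    proof (intro image_eqI[of _ _ "h \<zeta>0"])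
      have "R' \<le> norm \<zeta>0" "1 < norm \<zeta>0" unfolding \<zeta>0 using True by linarith+
      then show "norm \<zeta>0 = norm (k (h \<zeta>0))" "h \<zeta>0 \<in> - cball 0 b"
        using k(2)[of \<zeta>0] R'[of \<zeta>0] by simp_all
    qed
    ultimately have "R \<in> (\<lambda>z. norm (k z)) ` (- cball 0 b)"
      using conn \<zeta>0 \<zeta>1 unfolding is_interval_connected_1[symmetric] is_interval_1 by fastforce
    then obtain z where z: "z \<in> - cball 0 b" "norm (k z) = R" by auto
    then have "z \<notin> K" using \<open>- cball 0 b \<subseteq> - K\<close> by blast
    then have "h (k z) = z" by (rule k(4))
    moreover have "h (k z) \<in> h ` sphere 0 R" using z by simp
    ultimately show False using z b(2) by auto
  qed
  then show ?thesis using bounded_subset bounded_cball by blast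
next
  case False
  then have "{\<zeta>::complex. 1 < norm \<zeta> \<and> norm \<zeta> < R} = {}" by auto
  then show ?thesis by (metis bounded_empty image_empty)
qed

text \<open>The part of a large disc outside \<open>W\<close> is compact and disjoint from
  \<open>K\<close>, hence covered by the increasing open sets \<open>G n\<close>, the images of the
  exteriors of slightly larger discs. One of them already covers it, and by injectivity the points
  left out by that one are mapped into \<open>W\<close>, as long as their images stay in the large
  disc.\<close>

lemma collar_in_neighbourhood:
  assumes "open W" "K \<subseteq> W"
  obtains \<delta> where "0 < \<delta>" "\<And>\<zeta>. 1 < norm \<zeta> \<Longrightarrow> norm \<zeta> < 1 + \<delta> \<Longrightarrow> h \<zeta> \<in> W"
proof -
  obtain b where "\<forall>z\<in>h ` {\<zeta>. 1 < norm \<zeta> \<and> norm \<zeta> < 2}. norm z \<le> b"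
    using bounded_h_image[of 2] unfolding bounded_iff by blast
  then have b: "h ` {\<zeta>. 1 < norm \<zeta> \<and> norm \<zeta> < 2} \<subseteq> cball 0 b" by auto
  define G where "G n = h ` {\<zeta>. 1 + inverse (real (Suc n)) < norm \<zeta>}" for n
  have pos: "0 < inverse (real (Suc n))" for n by simp
  have "open (G n)" for n
    unfolding G_def
  proof (rule h_open_map)
    show "open {\<zeta>::complex. 1 + inverse (real (Suc n)) < norm \<zeta>}"
      by (intro open_Collect_less continuous_intros)
    show "{\<zeta>. 1 + inverse (real (Suc n)) < norm \<zeta>} \<subseteq> Ext"
      using pos[of n] by (auto intro: less_trans[rotated])
  qed
  moreover have "compact (cball 0 b - W)" using assms(1) by (simp add: compact_diff)
  moreover have "cball 0 b - W \<subseteq> (\<Union>n. G n)"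
  proof
    fix z assume "z \<in> cball 0 b - W"
    then have "z \<in> h ` Ext" using assms(2) h_image by auto
    then obtain \<zeta> where \<zeta>: "1 < norm \<zeta>" "z = h \<zeta>" by auto
    obtain n where "inverse (real (Suc n)) < norm \<zeta> - 1"
      using reals_Archimedean[of "norm \<zeta> - 1"] \<zeta> by auto
    then have "z \<in> G n" unfolding G_def using \<zeta> by auto
    then show "z \<in> (\<Union>n. G n)" by blast
  qed
  ultimately obtain I where I: "finite I" "cball 0 b - W \<subseteq> (\<Union>n\<in>I. G n)"
    by (metis compactE_image subset_UNIV)
  define N where "N = Max (insert 0 I)"
  have sub: "cball 0 b - W \<subseteq> G N"
  proof
    fix z assume "z \<in> cball 0 b - W"
    then obtain n where n: "n \<in> I" "z \<in> G n" using I by auto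
    then have "n \<le> N" unfolding N_def using I by simp
    then have "inverse (real (Suc N)) \<le> inverse (real (Suc n))"
      by (intro le_imp_inverse_le) auto
    moreover obtain \<zeta> where \<zeta>: "1 + inverse (real (Suc n)) < norm \<zeta>" "z = h \<zeta>"
      using n(2) unfolding G_def by blast
    ultimately have "1 + inverse (real (Suc N)) < norm \<zeta>" by linarith
    then show "z \<in> G N" unfolding G_def \<zeta>(2) by blast
  qed
  have le1: "inverse (real (Suc N)) \<le> 1" by (simp add: field_simps)
  show ?thesis
  proof (rule that[of "inverse (real (Suc N))"])
    fix \<zeta> :: complex assume \<zeta>: "1 < norm \<zeta>" "norm \<zeta> < 1 + inverse (real (Suc N))"
    show "h \<zeta> \<in> W"
    proof (rule ccontr)
      assume "h \<zeta> \<notin> W"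
      have "norm \<zeta> < 2" using \<zeta>(2) le1 by linarith
      then have "h \<zeta> \<in> cball 0 b" using b \<zeta>(1) by blast
      with \<open>h \<zeta> \<notin> W\<close> have "h \<zeta> \<in> G N" using sub by blast
      then obtain \<zeta>' where "1 + inverse (real (Suc N)) < norm \<zeta>'" "h \<zeta> = h \<zeta>'"
        unfolding G_def by auto
      moreover have "1 < norm \<zeta>'" using calculation(1) pos[of N] by linarith
      ultimately have "\<zeta> = \<zeta>'" using \<zeta>(1) inj_onD[OF h_inj] by blast
      then show False using \<zeta>(2) \<open>1 + _ < norm \<zeta>'\<close> by simp
    qed
  qed simp
qed

end

lemma connected_int_valued_const:
  fixes f :: "'a::topological_space \<Rightarrow> complex"
  assumes "connected S" "continuous_on S f" "\<And>x. x \<in> S \<Longrightarrow> f x \<in> \<int>" "S \<noteq> {}"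
  obtains n :: int where "\<And>x. x \<in> S \<Longrightarrow> f x = of_int n"
proof -
  have "f constant_on S"
  proof (rule continuous_discrete_range_constant[OF assms(1,2)])
    fix x assume x: "x \<in> S"
    have "1 \<le> norm (f y - f x)" if "y \<in> S" "f y \<noteq> f x" for y
    proof -
      have "f y - f x \<in> \<int>" using assms(3) x that by auto
      then obtain k :: int where "f y - f x = of_int k" by (rule Ints_cases)
      moreover have "k \<noteq> 0" using calculation that(2) by auto
      ultimately have "f y - f x = of_int k" "k \<noteq> 0" by auto
      then show ?thesis by (simp add: norm_of_int)
    qed
    then show "\<exists>e>0. \<forall>y. y \<in> S \<and> f y \<noteq> f x \<longrightarrow> e \<le> norm (f y - f x)"
      by (intro exI[of _ 1]) auto
  qed
  then obtain c where c: "\<And>x. x \<in> S \<Longrightarrow> f x = c" by (auto simp: constant_on_def)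
  obtain x0 where "x0 \<in> S" using assms(4) by blast
  then have "c \<in> \<int>" using c assms(3) by metis
  then obtain n :: int where "c = of_int n" by (auto elim: Ints_cases)
  then show ?thesis using that c by blast
qed

lemma strip_in_periodic_neighbourhood:
  assumes "open T" "\<And>x. of_real x \<in> T" "\<And>w n. w \<in> T \<Longrightarrow> w + of_int n \<in> T"
  obtains \<delta> where "0 < \<delta>" "\<And>w. \<bar>Im w\<bar> < \<delta> \<Longrightarrow> w \<in> T"
proof -
  have "compact (complex_of_real ` {0..1})"
    by (intro compact_continuous_image continuous_intros) auto
  then obtain \<delta> where \<delta>: "0 < \<delta>" "(\<Union>x\<in>complex_of_real ` {0..1}. ball x \<delta>) \<subseteq> T"
    using compact_subset_open_imp_ball_epsilon_subset[of "complex_of_real ` {0..1}" T] assms(1,2) by auto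
  show ?thesis
  proof (rule that[OF \<delta>(1)])
    fix w :: complex assume w: "\<bar>Im w\<bar> < \<delta>"
    define v where "v = w + of_int (- \<lfloor>Re w\<rfloor>)"
    have "Re v \<in> {0..1}" unfolding v_def by simp linarith
    moreover have "norm (of_real (Re v) - v) = \<bar>Im w\<bar>"
      by (simp add: cmod_def v_def)
    ultimately have "v \<in> T" using \<delta>(2) w by (force simp: dist_norm)
    then have "v + of_int \<lfloor>Re w\<rfloor> \<in> T" by (rule assms(3))
    then show "w \<in> T" by (simp add: v_def)
  qed
qed

section \<open>Lifting the circle map to a strip\<close>

lemma open_horizontal_strip: "open {w. \<bar>Im w\<bar> < d}"
  by (intro open_Collect_less continuous_intros)

lemma convex_horizontal_strip: "convex {w. \<bar>Im w\<bar> < d}"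
proof -
  have "{w. \<bar>Im w\<bar> < d} = {w. Im w < d} \<inter> {w. - d < Im w}" by auto
  then show ?thesis
    by (metis convex_Int convex_halfspace_Im_lt convex_halfspace_Im_gt)
qed

locale circle_correspondence = exterior_map +
  fixes f g :: "complex \<Rightarrow> complex" and U :: "complex set" and \<epsilon> \<rho> :: real
  assumes U_open: "open U" and K_U: "K \<subseteq> U" and f_hol: "f holomorphic_on U" and f_K: "f ` K = K"
    and \<epsilon>_pos: "0 < \<epsilon>"
    and g_eq: "\<And>\<zeta>. 1 < norm \<zeta> \<Longrightarrow> norm \<zeta> < 1 + \<epsilon> \<Longrightarrow>
        h \<zeta> \<in> U \<and> f (h \<zeta>) \<notin> K \<and> g \<zeta> = inv_into {\<zeta>. 1 < norm \<zeta>} h (f (h \<zeta>))"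
    and g_hol: "g holomorphic_on {\<zeta>. 1 - \<epsilon> < norm \<zeta> \<and> norm \<zeta> < 1 + \<epsilon>}"
    and g_diffeo: "analytic_circle_diffeo g"
    and g_orient: "circle_orientation_preserving g"
    and g_rot: "has_rotation_number g \<rho>" and \<rho>_irrational: "\<rho> \<notin> \<rat>"
begin

text \<open>The definitions supply two lifts: an increasing one and one with rotation number
  \<open>\<rho>\<close>. They differ by a constant integer, so the second is increasing too. Its
  degree \<open>d\<close> is positive by monotonicity, and degree 2 or more would make
  \<open>g\<close> take one value twice on the circle.\<close>

lemma real_lift:
  obtains P where "\<And>x. g (E (of_real x)) = E (of_real (P x))" "continuous_on UNIV P"
    "strict_mono P" "\<And>x. P (x + 1) = P x + 1" "\<And>x. (\<lambda>n. ((P ^^ n) x - x) / real n) \<longlonglongrightarrow> \<rho>"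
proof -
  obtain P1 where P1: "continuous_on UNIV P1" "\<And>x. g (cis (2 * pi * x)) = cis (2 * pi * P1 x)" "strict_mono P1"
    using g_orient by (auto simp: circle_orientation_preserving_def circle_lift_def)
  obtain P where P: "continuous_on UNIV P" "\<And>x. g (cis (2 * pi * x)) = cis (2 * pi * P x)"
    "\<And>x. (\<lambda>n. ((P ^^ n) x - x) / real n) \<longlonglongrightarrow> \<rho>"
    using g_rot by (auto simp: has_rotation_number_def circle_lift_def)
  have int: "complex_of_real (a - b) \<in> \<int>" if "cis (2 * pi * a) = cis (2 * pi * b)" for a b
    using that unfolding E_of_real[symmetric] E_eq_iff by auto
  have int1: "complex_of_real (P x - P1 x) \<in> \<int>" for x
    using P(2)[of x] P1(2)[of x] by (intro int) simp
  obtain n :: int where n: "complex_of_real (P x - P1 x) = of_int n" for x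
  proof (rule connected_int_valued_const[of UNIV "\<lambda>x. complex_of_real (P x - P1 x)"])
    show "continuous_on UNIV (\<lambda>x. complex_of_real (P x - P1 x))"
      by (intro continuous_intros P P1)
  qed (use int1 in auto)
  have "P x = P1 x + of_int n" for x
  proof -
    have "P x - P1 x = of_int n" using n[of x] by (metis of_real_eq_iff of_real_of_int_eq)
    then show ?thesis by simp
  qed
  then have mono: "strict_mono P" using P1(3) by (simp add: strict_mono_def)
  have int2: "complex_of_real (P (x + 1) - P x) \<in> \<int>" for x
  proof (rule int)
    have "cis (2 * pi * (x + 1)) = cis (2 * pi * x)"
      by (simp add: distrib_left cis_mult[symmetric])
    then show "cis (2 * pi * P (x + 1)) = cis (2 * pi * P x)" by (metis P(2))
  qed
  obtain d :: int where d': "complex_of_real (P (x + 1) - P x) = of_int d" for x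
  proof (rule connected_int_valued_const[of UNIV "\<lambda>x. complex_of_real (P (x + 1) - P x)"])
    show "continuous_on UNIV (\<lambda>x. complex_of_real (P (x + 1) - P x))"
      by (intro continuous_intros P continuous_on_compose2[OF P(1)]) auto
  qed (use int2 in auto)
  have d: "P (x + 1) = P x + of_int d" for x
  proof -
    have "P (x + 1) - P x = of_int d" using d'[of x] by (metis of_real_eq_iff of_real_of_int_eq)
    then show ?thesis by simp
  qed
  have "P 0 < P 1" using mono by (simp add: strict_mono_def)
  then have "0 < d" using d[of 0] by simp
  moreover have "\<not> 2 \<le> d"
  proof
    assume "2 \<le> d"
    then have lt: "P 0 + 1 < P 1" using d[of 0] by simp
    then obtain x where x: "0 \<le> x" "x \<le> 1" "P x = P 0 + 1"
      using IVT'[of P 0 "P 0 + 1" 1] continuous_on_subset[OF P(1)] by auto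
    then have x': "0 < x" "x < 1" using lt by (auto simp: less_le)
    have "cis (2 * pi * P x) = cis (2 * pi * P 0)"
      by (simp add: x(3) distrib_left cis_mult[symmetric])
    then have "g (cis (2 * pi * x)) = g (cis (2 * pi * 0))" unfolding P(2) .
    moreover have "inj_on g (sphere 0 1)"
      using g_diffeo by (auto simp: analytic_circle_diffeo_def bij_betw_def)
    ultimately have "cis (2 * pi * x) = cis (2 * pi * 0)" by (auto dest: inj_onD)
    then obtain m :: int where "x = of_int m"
      unfolding E_of_real[symmetric] E_eq_iff by (auto simp: complex_eq_iff)
    then show False using x' by auto
  qed
  ultimately have "d = 1" by linarith
  then show ?thesis using that[of P] P mono d by (simp add: E_of_real)
qed

text \<open>\<open>g \<circ> E\<close> has no zero on a thin strip around the real line, so it has a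
  logarithm there. This gives a lift that differs from \<open>P\<close> on the reals by a constant
  integer, which is subtracted.\<close>

lemma complex_lift:
  assumes "0 < \<delta>"
  obtains P F e where "0 < e" "exp (2 * pi * e) \<le> 1 + \<delta>" "exp (2 * pi * e) \<le> 1 + \<epsilon>"
    "F holomorphic_on {w. \<bar>Im w\<bar> < e}"
    "\<And>w. \<bar>Im w\<bar> < e \<Longrightarrow> g (E w) = E (F w)" "\<And>w. \<bar>Im w\<bar> < e \<Longrightarrow> F (w + 1) = F w + 1"
    "\<And>x. F (of_real x) = of_real (P x)"
    "continuous_on UNIV P" "strict_mono P" "\<And>x. P (x + 1) = P x + 1"
    "\<And>x. (\<lambda>n. ((P ^^ n) x - x) / real n) \<longlonglongrightarrow> \<rho>"
proof -
  obtain P where P: "\<And>x. g (E (of_real x)) = E (of_real (P x))" "continuous_on UNIV P"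
    "strict_mono P" "\<And>x. P (x + 1) = P x + 1" "\<And>x. (\<lambda>n. ((P ^^ n) x - x) / real n) \<longlonglongrightarrow> \<rho>"
    using real_lift by blast
  \<comment> \<open>Chosen so that \<open>E\<close> maps the strip of half-width \<open>e1\<close>
    into the annulus where \<open>g\<close> is holomorphic, and no further out than
    \<open>1 + \<delta>\<close>.\<close>
  define e1 where "e1 = ln (1 + min \<delta> \<epsilon>) / (2 * pi)"
  have e1: "0 < e1" "exp (2 * pi * e1) = 1 + min \<delta> \<epsilon>"
    using assms \<epsilon>_pos by (simp_all add: e1_def)
  have E_annulus: "E w \<in> {\<zeta>. 1 - \<epsilon> < norm \<zeta> \<and> norm \<zeta> < 1 + \<epsilon>}" if "\<bar>Im w\<bar> < e1" for w
  proof -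
    have "2 * pi * (- Im w) < 2 * pi * e1" "2 * pi * Im w < 2 * pi * e1"
      using that by (intro mult_strict_left_mono; simp)+
    then have lt: "exp (- 2 * pi * Im w) < exp (2 * pi * e1)" "exp (2 * pi * Im w) < exp (2 * pi * e1)"
      by simp_all
    have "exp (2 * pi * e1) \<le> 1 + \<epsilon>" unfolding e1(2) by simp
    with lt have "exp (- 2 * pi * Im w) < 1 + \<epsilon>" "exp (2 * pi * Im w) < 1 + \<epsilon>"
      by linarith+
    then have up: "norm (E w) < 1 + \<epsilon>" and "1 < (1 + \<epsilon>) * norm (E w)"
      by (simp_all add: norm_E exp_minus field_simps)
    note this(2)
    \<comment> \<open>A modulus of at most \<open>1 - \<epsilon>\<close> would make
      \<open>(1 + \<epsilon>) * (1 - \<epsilon>)\<close> exceed 1.\<close>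
    moreover have "(1 + \<epsilon>) * norm (E w) \<le> (1 + \<epsilon>) * (1 - \<epsilon>)" if "norm (E w) \<le> 1 - \<epsilon>"
      using that \<epsilon>_pos by (intro mult_left_mono) auto
    moreover have "(1 + \<epsilon>) * (1 - \<epsilon>) \<le> 1" by (simp add: algebra_simps)
    ultimately show ?thesis using up by fastforce
  qed
  have gE_hol: "(\<lambda>w. g (E w)) holomorphic_on {w. \<bar>Im w\<bar> < e1}"
    by (rule holomorphic_on_compose_gen[OF E_holomorphic g_hol, unfolded o_def])
      (use E_annulus in blast)
  define T where "T = {w \<in> {w. \<bar>Im w\<bar> < e1}. g (E w) \<in> - {0}}"
  have "open T" unfolding T_def
    using continuous_open_preimage[OF holomorphic_on_imp_continuous_on[OF gE_hol] open_horizontal_strip,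
        OF open_Compl[OF closed_singleton[of 0]]]
    by (simp add: Int_def vimage_def)
  obtain e where e: "0 < e" "\<And>w. \<bar>Im w\<bar> < e \<Longrightarrow> w \<in> T"
  proof (rule strip_in_periodic_neighbourhood[OF \<open>open T\<close>])
    show "of_real x \<in> T" for x using e1(1) by (simp add: T_def P(1) E_nonzero)
    show "w + of_int n \<in> T" if "w \<in> T" for w n using that by (simp add: T_def E_shift)
  qed blast
  define S where "S = {w. \<bar>Im w\<bar> < e}"
  have S: "open S" "convex S" "0 \<in> S" "S \<subseteq> {w. \<bar>Im w\<bar> < e1}" "\<And>w. w \<in> S \<Longrightarrow> g (E w) \<noteq> 0"
    using open_horizontal_strip convex_horizontal_strip e by (auto simp: S_def T_def)
  obtain l where l: "l holomorphic_on S" "\<And>w. w \<in> S \<Longrightarrow> exp (l w) = g (E w)"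
    using holomorphic_logarithm_exists[OF S(2,1) holomorphic_on_subset[OF gE_hol S(4)] S(5,3)] by blast
  define F0 where "F0 w = l w / (2 * of_real pi * \<i>)" for w
  have F0_hol: "F0 holomorphic_on S" unfolding F0_def by (intro holomorphic_intros l) auto
  have F0: "E (F0 w) = g (E w)" if "w \<in> S" for w
    using l(2)[OF that] by (simp add: E_def F0_def)
  have real_S: "of_real x \<in> S" for x using e(1) by (simp add: S_def)
  have "F0 (of_real x) - of_real (P x) \<in> \<int>" for x
  proof -
    have "E (F0 (of_real x)) = E (of_real (P x))" using F0[OF real_S] P(1) by simp
    then show ?thesis unfolding E_eq_iff by auto
  qed
  moreover have "continuous_on UNIV (\<lambda>x. F0 (of_real x) - of_real (P x))"
    using real_S by (intro continuous_intros P(2) continuous_on_compose2[OF holomorphic_on_imp_continuous_on[OF F0_hol]]) auto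
  ultimately obtain n :: int where n: "F0 (of_real x) - of_real (P x) = of_int n" for x
    using connected_int_valued_const[of UNIV "\<lambda>x. F0 (of_real x) - of_real (P x)"] by auto
  define F where "F w = F0 w - of_int n" for w
  have F_hol: "F holomorphic_on S" unfolding F_def by (intro holomorphic_intros F0_hol)
  have F_real: "F (of_real x) = of_real (P x)" for x
    using n[of x] by (simp add: F_def algebra_simps)
  have F_E: "g (E w) = E (F w)" if "w \<in> S" for w
    using F0[OF that] E_shift[of "F0 w" "- n"] by (simp add: F_def)
  have S_shift: "w + 1 \<in> S" if "w \<in> S" for w using that by (simp add: S_def)
  have "F (w + 1) - F w \<in> \<int>" if "w \<in> S" for w
  proof -
    have "E (F (w + 1)) = E (F w)"
      using F_E[OF that] F_E[OF S_shift[OF that]] E_shift[of w 1] by simp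
    then show ?thesis unfolding E_eq_iff by auto
  qed
  moreover have "continuous_on S (\<lambda>w. F (w + 1) - F w)"
    using S_shift by (intro continuous_intros holomorphic_on_imp_continuous_on[OF F_hol]
        continuous_on_compose2[OF holomorphic_on_imp_continuous_on[OF F_hol]]) auto
  ultimately obtain m :: int where m: "\<And>w. w \<in> S \<Longrightarrow> F (w + 1) - F w = of_int m"
    using connected_int_valued_const[of S "\<lambda>w. F (w + 1) - F w"] S(2,3) convex_connected by blast
  have "F (of_real 0 + 1) - F (of_real 0) = 1"
    using F_real[of 1] F_real[of 0] P(4)[of 0] by simp
  then have "of_int m = (1::complex)" using m[OF real_S[of 0]] by simp
  then have F_shift: "F (w + 1) = F w + 1" if "w \<in> S" for w
    using m[OF that] by (simp add: algebra_simps)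
  have "e \<le> e1"
  proof (rule ccontr)
    assume "\<not> e \<le> e1"
    then have "\<i> * of_real e1 \<in> S" using e1(1) by (simp add: S_def)
    then show False using S(4) e1(1) by auto
  qed
  then have "exp (2 * pi * e) \<le> exp (2 * pi * e1)" by simp
  then have "exp (2 * pi * e) \<le> 1 + \<delta>" "exp (2 * pi * e) \<le> 1 + \<epsilon>" unfolding e1(2) by simp_all
  then show ?thesis
    using that[of e F P] e(1) F_hol F_E F_shift F_real P by (simp add: S_def)
qed

end

lemma deriv_translate:
  assumes "\<Phi> holomorphic_on {w. \<bar>Im w\<bar> < d}" "\<And>w. \<bar>Im w\<bar> < d \<Longrightarrow> \<Phi> (w + 1) = \<Phi> w + c" "\<bar>Im w\<bar> < d"
  shows "deriv \<Phi> (w + 1) = deriv \<Phi> w"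
proof -
  have D: "(\<Phi> has_field_derivative deriv \<Phi> v) (at v)" if "\<bar>Im v\<bar> < d" for v
    using assms(1) open_horizontal_strip that by (intro holomorphic_derivI) auto
  have "((\<lambda>w. \<Phi> (w + 1)) has_field_derivative deriv \<Phi> (w + 1)) (at w)"
    using D[of "w + 1"] assms(3) by (simp add: DERIV_shift)
  moreover have "((\<lambda>w. \<Phi> w + c) has_field_derivative deriv \<Phi> w) (at w)"
    using D[OF assms(3)] by (auto intro!: derivative_eq_intros)
  moreover have "\<forall>\<^sub>F v in nhds w. \<Phi> (v + 1) = \<Phi> v + c"
    using eventually_nhds_in_open[OF open_horizontal_strip, of w d] assms(3)
    by (auto elim!: eventually_mono simp: assms(2))
  ultimately show ?thesis
    using DERIV_cong_ev[of w w "\<lambda>w. \<Phi> (w + 1)" "\<lambda>w. \<Phi> w + c"] DERIV_unique by blast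
qed

context circle_correspondence
begin

text \<open>The constant \<open>\<kappa>\<close> is \<open>B / m\<close>, with \<open>B\<close> a
  bound for the second derivative of \<open>F\<close> and \<open>m\<close> the minimum of
  \<open>P'\<close>; both come from periodicity and compactness, for \<open>B\<close> after halving
  the strip. Positivity of \<open>P'\<close> comes from the analytic inverse of \<open>g\<close>,
  which excludes critical points, and from the monotonicity of \<open>P\<close>.\<close>

lemma strip_system:
  assumes "0 < \<delta>"
  obtains P P' \<kappa> F e where "circle_strip P P' \<rho> \<kappa> F e" "exp (2 * pi * e) \<le> 1 + \<delta>"
    "exp (2 * pi * e) \<le> 1 + \<epsilon>" "\<And>w. \<bar>Im w\<bar> < e \<Longrightarrow> g (E w) = E (F w)"
proof -
  obtain P F e1 where e1: "0 < e1" "exp (2 * pi * e1) \<le> 1 + \<delta>" "exp (2 * pi * e1) \<le> 1 + \<epsilon>"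
    and F_hol: "F holomorphic_on {w. \<bar>Im w\<bar> < e1}"
    and F_E: "\<And>w. \<bar>Im w\<bar> < e1 \<Longrightarrow> g (E w) = E (F w)"
    and F_shift: "\<And>w. \<bar>Im w\<bar> < e1 \<Longrightarrow> F (w + 1) = F w + 1"
    and F_real: "\<And>x. F (of_real x) = of_real (P x)"
    and P: "continuous_on UNIV P" "strict_mono P" "\<And>x. P (x + 1) = P x + 1"
    "\<And>x. (\<lambda>n. ((P ^^ n) x - x) / real n) \<longlonglongrightarrow> \<rho>"
    by (rule complex_lift[OF assms]) (rule that; assumption)
  let ?S = "{w. \<bar>Im w\<bar> < e1}"
  have D: "(F has_field_derivative deriv F w) (at w)" if "\<bar>Im w\<bar> < e1" for w
    using F_hol open_horizontal_strip that by (intro holomorphic_derivI) auto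
  have dF_hol: "deriv F holomorphic_on ?S" by (rule holomorphic_deriv[OF F_hol open_horizontal_strip])
  then have ddF_hol: "deriv (deriv F) holomorphic_on ?S" by (rule holomorphic_deriv[OF _ open_horizontal_strip])
  have DD: "(deriv F has_field_derivative deriv (deriv F) w) (at w)" if "\<bar>Im w\<bar> < e1" for w
    using dF_hol open_horizontal_strip that by (intro holomorphic_derivI) auto
  define P' where "P' x = Re (deriv F (of_real x))" for x
  \<comment> \<open>\<open>F\<close> is real on the reals, so differentiating along the real
    direction identifies \<open>deriv F\<close> there with the real derivative of
    \<open>P\<close>.\<close>
  have vec: "((\<lambda>t. complex_of_real (P t)) has_vector_derivative deriv F (of_real x)) (at x)" for x
    using has_vector_derivative_real_field[OF D[of "of_real x"]] e1(1) unfolding F_real by simp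
  have P_deriv: "(P has_real_derivative P' x) (at x)" for x
    using bounded_linear.has_vector_derivative[OF bounded_linear_Re vec[of x]]
    by (simp add: P'_def has_real_derivative_iff_has_vector_derivative)
  have "Im (deriv F (of_real x)) = 0" for x
    using bounded_linear.has_vector_derivative[OF bounded_linear_Im vec[of x]]
      vector_derivative_unique_at[of "\<lambda>_. 0" 0 x "Im (deriv F (of_real x))"] by simp
  then have dF_real: "deriv F (of_real x) = of_real (P' x)" for x
    by (simp add: P'_def complex_eq_iff)
  have dF_nz: "deriv F (of_real x) \<noteq> 0" for x
  proof
    assume 0: "deriv F (of_real x) = 0"
    obtain k where k: "k analytic_on sphere 0 1" "\<And>\<zeta>. \<zeta> \<in> sphere 0 1 \<Longrightarrow> k (g \<zeta>) = \<zeta>"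
      using g_diffeo by (auto simp: analytic_circle_diffeo_def)
    have "E (of_real (P x)) \<in> sphere 0 1" by (simp add: norm_E)
    then obtain k' where k': "(k has_field_derivative k') (at (E (F (of_real x))))"
      using k(1) unfolding F_real by (meson analytic_on_imp_differentiable_at field_differentiable_def)
    have "((\<lambda>w. E (F w)) has_field_derivative E (F (of_real x)) * (2 * of_real pi * \<i> * 0)) (at (of_real x))"
      unfolding E_def using D[of "of_real x"] e1(1) 0 by (auto intro!: derivative_eq_intros)
    then have "((\<lambda>w. E (F w)) has_field_derivative 0) (at (of_real x))" by simp
    from DERIV_chain2[where f = k and g = "\<lambda>w. E (F w)", OF k' this]
    have "((\<lambda>w. k (E (F w))) has_field_derivative 0) (at (of_real x))" by simp
    then have "((\<lambda>t. k (E (F (of_real t)))) has_vector_derivative 0) (at x)"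
      by (rule has_vector_derivative_real_field)
    moreover have "k (E (F (of_real t))) = E (of_real t)" for t
      using F_E[of "of_real t"] k(2)[of "E (of_real t)"] e1(1) by (simp add: norm_E)
    ultimately have 1: "((\<lambda>t. E (of_real t)) has_vector_derivative 0) (at x)" by simp
    have "(E has_field_derivative E (of_real x) * (2 * of_real pi * \<i>)) (at (of_real x))"
      unfolding E_def[abs_def] by (auto intro!: derivative_eq_intros)
    then have "((\<lambda>t. E (of_real t)) has_vector_derivative E (of_real x) * (2 * of_real pi * \<i>)) (at x)"
      by (rule has_vector_derivative_real_field)
    with 1 have "E (of_real x) * (2 * of_real pi * \<i>) = 0"
      by (metis vector_derivative_unique_at)
    then show False by (simp add: E_nonzero)
  qed
  have P'_pos: "0 < P' x" for x
  proof -
    have "P' x \<noteq> 0" using dF_nz[of x] dF_real[of x] by auto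
    moreover have "\<not> P' x < 0"
    proof
      assume "P' x < 0"
      then obtain d where d: "0 < d" "\<And>h. 0 < h \<Longrightarrow> h < d \<Longrightarrow> P (x + h) < P x"
        using DERIV_neg_dec_right[OF P_deriv] by blast
      have "P (x + d / 2) < P x" using d by simp
      moreover have "P x < P (x + d / 2)" using P(2) d(1) by (simp add: strict_mono_less)
      ultimately show False by simp
    qed
    ultimately show ?thesis by simp
  qed
  define e where "e = e1 / 2"
  have e: "0 < e" "e < e1" using e1 by (simp_all add: e_def)
  have strip_inv: "w + of_int n \<in> ?S" if "w \<in> ?S" for w and n :: int using that by simp
  have dF_shift: "deriv F (w + 1) = deriv F w + 0" if "\<bar>Im w\<bar> < e1" for w
    using deriv_translate[OF F_hol F_shift that] by simp
  then have dF_int: "deriv F (w + of_int n) = deriv F w" if "\<bar>Im w\<bar> < e1" for w n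
    using int_translate[OF strip_inv, of "deriv F" 0 w n] that by simp
  have "deriv (deriv F) (w + 1) = deriv (deriv F) w" if "\<bar>Im w\<bar> < e1" for w
    using deriv_translate[OF dF_hol dF_shift that] by simp
  then have ddF_int: "deriv (deriv F) (w + of_int n) = deriv (deriv F) w" if "\<bar>Im w\<bar> < e1" for w n
    using int_translate[OF strip_inv, of "deriv (deriv F)" 0 w n] that by simp
  let ?C = "cbox (Complex 0 (- e)) (Complex 1 e)"
  have to_C: "w + of_int (- \<lfloor>Re w\<rfloor>) \<in> ?C" if "\<bar>Im w\<bar> \<le> e" for w
    using that by (simp add: in_cbox_complex_iff) linarith
  have C_sub: "?C \<subseteq> ?S" using e by (auto simp: in_cbox_complex_iff)
  have "compact (deriv (deriv F) ` ?C)"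
    using holomorphic_on_imp_continuous_on[OF ddF_hol] C_sub
    by (intro compact_continuous_image) (auto intro: continuous_on_subset)
  then obtain B where B: "\<forall>v\<in>deriv (deriv F) ` ?C. norm v \<le> B"
    using compact_imp_bounded bounded_iff by metis
  have ddF_le: "norm (deriv (deriv F) w) \<le> B" if "\<bar>Im w\<bar> \<le> e" for w
    using B to_C[OF that] ddF_int[of w "- \<lfloor>Re w\<rfloor>"] that e by (metis image_eqI le_less_trans)
  have "0 \<le> B" using ddF_le[of 0] e(1) by (auto intro: order.trans[OF norm_ge_zero])
  have dF_lip: "norm (deriv F w - deriv F v) \<le> B * norm (w - v)" if "\<bar>Im w\<bar> < e" "\<bar>Im v\<bar> < e" for w v
    by (rule field_differentiable_bound[OF convex_horizontal_strip[of e], of "deriv F" "deriv (deriv F)"])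
      (use that e in \<open>auto intro!: has_field_derivative_at_within DD ddF_le\<close>)
  have P'_cont: "continuous_on {0..1} P'"
    unfolding P'_def using e1(1)
    by (intro continuous_intros continuous_on_compose2[OF holomorphic_on_imp_continuous_on[OF dF_hol]]) auto
  obtain x0 where x0: "\<And>x. x \<in> {0..1} \<Longrightarrow> P' x0 \<le> P' x"
    using continuous_attains_inf[OF _ _ P'_cont] by (metis atLeastAtMost_iff compact_Icc empty_iff order_refl zero_le_one)
  define m where "m = P' x0"
  have m: "0 < m" "m \<le> P' x" for x
  proof -
    show "0 < m" by (simp add: m_def P'_pos)
    have "x + of_int (- \<lfloor>x\<rfloor>) \<in> {0..1}" by simp linarith
    then have "m \<le> P' (x + of_int (- \<lfloor>x\<rfloor>))" unfolding m_def by (rule x0)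
    also have "\<dots> = P' x" using dF_int[of "of_real x" "- \<lfloor>x\<rfloor>"] e1(1) by (simp add: P'_def)
    finally show "m \<le> P' x" .
  qed
  have P'_diff: "\<bar>P' x - P' y\<bar> \<le> B * \<bar>x - y\<bar>" for x y
    using dF_lip[of "of_real x" "of_real y"] e(1) unfolding dF_real
    by (simp add: norm_of_real flip: of_real_diff)
  have ln_le: "ln (P' x) - ln (P' y) \<le> B / m * \<bar>x - y\<bar>" for x y
  proof -
    have "ln (P' x) - ln (P' y) = ln (P' x / P' y)"
      using P'_pos by (simp add: ln_div less_imp_neq[symmetric])
    also have "\<dots> \<le> P' x / P' y - 1"
      using P'_pos[of x] P'_pos[of y] by (intro ln_le_minus_one) simp
    also have "\<dots> = (P' x - P' y) / P' y"
      using P'_pos[of y] by (simp add: field_simps)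
    also have "\<dots> \<le> (B * \<bar>x - y\<bar>) / m"
      using P'_diff[of x y] m(1) m(2)[of y] P'_pos[of y] \<open>0 \<le> B\<close> by (intro frac_le) auto
    finally show ?thesis by simp
  qed
  have "circle_strip P P' \<rho> (B / m) F e"
  proof unfold_locales
    show "F holomorphic_on {w. \<bar>Im w\<bar> < e}"
      using e by (intro holomorphic_on_subset[OF F_hol]) auto
    show "\<bar>ln (P' x) - ln (P' y)\<bar> \<le> B / m * \<bar>x - y\<bar>" for x y
      using ln_le[of x y] ln_le[of y x] by (simp add: abs_minus_commute)
    show "cmod (deriv F w - of_real (P' x)) \<le> B / m * P' x * cmod (w - of_real x)" if "\<bar>Im w\<bar> < e" for w x
    proof -
      have "cmod (deriv F w - of_real (P' x)) \<le> B * cmod (w - of_real x)"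
        using dF_lip[OF that, of "of_real x"] e(1) by (simp add: dF_real)
      also have "\<dots> \<le> B / m * P' x * cmod (w - of_real x)"
        using m(1) m(2)[of x] \<open>0 \<le> B\<close> by (intro mult_right_mono) (auto simp: field_simps mult_left_mono)
      finally show ?thesis .
    qed
    show "Im (F w) < 0" if "- e < Im w" "Im w < 0" for w
    proof -
      have w: "\<bar>Im w\<bar> < e1" using that e by linarith
      have "exp (- 2 * pi * Im w) < exp (2 * pi * e1)"
        using mult_strict_left_mono[of "- Im w" e1 "2 * pi"] that e by simp
      then have "norm (E w) < 1 + \<epsilon>" using e1(3) unfolding norm_E by linarith
      moreover have "1 < norm (E w)" using that by (simp add: norm_E_gt_1_iff)
      ultimately have Ew: "1 < norm (E w)" "norm (E w) < 1 + \<epsilon>" by auto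
      \<comment> \<open>\<open>f (h (E w))\<close> lies outside \<open>K\<close>, so its preimage
        under \<open>h\<close>, which is \<open>g (E w)\<close>, has modulus above 1.\<close>
      have "f (h (E w)) \<in> h ` Ext" using g_eq[OF Ew] by (simp add: h_image)
      then have "g (E w) \<in> Ext" using g_eq[OF Ew] by (metis inv_into_into)
      then show ?thesis using F_E[OF w] by (simp add: norm_E_gt_1_iff)
    qed
  qed (use P_deriv P'_pos P \<rho>_irrational e F_real F_shift in auto)
  moreover have "exp (2 * pi * e) \<le> exp (2 * pi * e1)" using e by simp
  then have "exp (2 * pi * e) \<le> 1 + \<delta>" "exp (2 * pi * e) \<le> 1 + \<epsilon>" using e1 by linarith+
  moreover have "g (E w) = E (F w)" if "\<bar>Im w\<bar> < e" for w using F_E[of w] that e by simp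
  ultimately show ?thesis by (rule that)
qed

end

section \<open>Linearization at interior fixed points\<close>

lemma iterate_differentiable:
  assumes "open U" "f holomorphic_on U" "\<And>i. i < j \<Longrightarrow> (f ^^ i) z \<in> U"
  shows "(f ^^ j) field_differentiable (at z)"
  using assms(3)
proof (induction j)
  case 0
  then show ?case by (simp add: id_def field_differentiable_ident)
next
  case (Suc j)
  have "f field_differentiable at ((f ^^ j) z)"
    using assms(1,2) Suc.prems[of j] by (intro holomorphic_on_imp_differentiable_at) auto
  then have "(f \<circ> (f ^^ j)) field_differentiable (at z)"
    by (intro field_differentiable_compose Suc) (use Suc.prems in auto)
  then show ?case by (simp add: o_def)
qed

lemma iterate_deriv_at_fixpoint:
  assumes "open U" "f holomorphic_on U" "a \<in> U" "f a = a"
  shows "((f ^^ j) has_field_derivative (deriv f a) ^ j) (at a)"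
proof (induction j)
  case 0
  then show ?case by (simp add: id_def)
next
  case (Suc j)
  have fixed: "(f ^^ j) a = a" using assms(4) by (induction j) auto
  have "(f has_field_derivative deriv f a) (at ((f ^^ j) a))"
    unfolding fixed using assms by (intro holomorphic_derivI) auto
  from DERIV_chain[OF this Suc] show ?case by (simp add: o_def)
qed

text \<open>The averages \<open>(1/n) \<Sum>j<n. \<lambda>\<^sup>-\<^sup>j f\<^sup>j\<close> form a normal family near 0, and every limit conjugates
  \<open>f\<close> to the rotation by \<open>\<lambda>\<close>.\<close>

lemma invariant_nbhd_imp_linearizing_map:
  assumes f: "open U" "f holomorphic_on U" "f 0 = 0" and lam: "norm (deriv f 0) = 1"
    and K: "bounded K" "K \<subseteq> U" "f ` K \<subseteq> K" and s: "0 < s" "ball 0 s \<subseteq> K"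
  obtains \<Phi> where "\<Phi> holomorphic_on ball 0 s" "\<Phi> 0 = 0" "deriv \<Phi> 0 = 1"
    "\<And>z. z \<in> ball 0 s \<Longrightarrow> f z \<in> ball 0 s \<Longrightarrow> \<Phi> (f z) = deriv f 0 * \<Phi> z"
proof -
  define l where "l = deriv f 0"
  have l: "norm l = 1" "l \<noteq> 0" using lam by (auto simp: l_def)
  define A where "A n z = (\<Sum>j<Suc n. (f ^^ j) z / l ^ j) / of_nat (Suc n)" for n z
  obtain B where B: "\<And>z. z \<in> K \<Longrightarrow> norm z \<le> B" using K(1) bounded_iff by metis
  have "0 \<in> K" using s by auto
  then have "0 \<le> B" using B[of 0] by simp
  have iter_K: "(f ^^ j) z \<in> K" if "z \<in> K" for j z
    using that K(3) by (induction j) auto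
  have A_hol: "A n holomorphic_on ball 0 s" for n
  proof -
    have "(f ^^ j) holomorphic_on ball 0 s" for j
      unfolding holomorphic_on_def
    proof
      fix z :: complex assume "z \<in> ball 0 s"
      then have "(f ^^ i) z \<in> U" for i using iter_K s(2) K(2) by blast
      then show "(f ^^ j) field_differentiable at z within ball 0 s"
        by (intro field_differentiable_at_within[OF iterate_differentiable[OF f(1,2)]])
    qed
    then show ?thesis unfolding A_def using l(2) by (intro holomorphic_intros) (auto simp del: of_nat_Suc)
  qed
  have A_bdd: "norm (A n z) \<le> B" if "z \<in> ball 0 s" for n z
  proof -
    have "norm (\<Sum>j<Suc n. (f ^^ j) z / l ^ j) \<le> of_nat (card {..<Suc n}) * B"
      using B[OF iter_K] s(2) that l(1)
      by (intro sum_norm_bound) (auto simp: norm_divide norm_power)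
    then show ?thesis
      unfolding A_def norm_divide by (simp add: norm_of_nat divide_le_eq mult.commute del: of_nat_Suc)
  qed
  obtain \<Phi> r where \<Phi>: "\<Phi> holomorphic_on ball 0 s" "strict_mono (r :: nat \<Rightarrow> nat)"
    "\<And>z. z \<in> ball 0 s \<Longrightarrow> (\<lambda>n. A (r n) z) \<longlonglongrightarrow> \<Phi> z"
    "\<And>K. compact K \<Longrightarrow> K \<subseteq> ball 0 s \<Longrightarrow> uniform_limit K (A \<circ> r) \<Phi> sequentially"
  proof (rule Montel[of "ball 0 s" "range A" A])
    show "\<exists>B. \<forall>h\<in>range A. \<forall>z\<in>K. norm (h z) \<le> B" if "K \<subseteq> ball 0 s" for K
      using A_bdd that by (intro exI[of _ B]) auto
  qed (use A_hol in auto)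
  have iter0: "(f ^^ j) 0 = 0" for j using f(3) by (induction j) auto
  have "A n 0 = 0" for n by (simp add: A_def iter0)
  then have \<Phi>0: "\<Phi> 0 = 0" using \<Phi>(3)[of 0] s(1) by (simp add: LIMSEQ_const_iff)
  have "0 \<in> U" using \<open>0 \<in> K\<close> K by auto
  \<comment> \<open>Dividing by \<open>l ^ j\<close> cancels the derivative of \<open>f ^^ j\<close>
    at 0, which is what keeps the limit from being constant.\<close>
  have dA: "deriv (A n) 0 = 1" for n
  proof (rule DERIV_imp_deriv)
    have "(A n has_field_derivative (\<Sum>j<Suc n. l ^ j / l ^ j) / of_nat (Suc n)) (at 0)"
      unfolding A_def[abs_def] l_def
      by (intro DERIV_cdivide DERIV_sum iterate_deriv_at_fixpoint[OF f(1,2) \<open>0 \<in> U\<close> f(3)])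
    then show "(A n has_field_derivative 1) (at 0)" using l(2) by (simp del: of_nat_Suc sum.lessThan_Suc)
  qed
  have "uniform_limit (cball 0 (s / 2)) (A \<circ> r) \<Phi> sequentially"
    using s(1) by (intro \<Phi>(4)) auto
  then have "uniform_limit (ball 0 (s / 2)) (A \<circ> r) \<Phi> sequentially"
    by (rule uniform_limit_on_subset) auto
  then have "(\<lambda>n. deriv ((A \<circ> r) n) 0) \<longlonglongrightarrow> deriv \<Phi> 0"
    using s(1)
    by (intro deriv_complex_uniform_limit[where A = "ball 0 (s / 2)"])
      (auto intro!: always_eventually holomorphic_on_subset[OF A_hol] simp: o_def)
  then have d\<Phi>: "deriv \<Phi> 0 = 1" by (simp add: dA LIMSEQ_const_iff)
  have "\<Phi> (f z) = l * \<Phi> z" if z: "z \<in> ball 0 s" "f z \<in> ball 0 s" for z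
  proof -
    \<comment> \<open>Applying \<open>f\<close> shifts the index by one, so the difference
      telescopes to two bounded end terms divided by \<open>Suc n\<close>.\<close>
    have eq: "A n (f z) - l * A n z = (l * ((f ^^ Suc n) z / l ^ Suc n - z)) / of_nat (Suc n)" for n
    proof -
      have "(\<Sum>j<Suc n. (f ^^ j) (f z) / l ^ j) = (\<Sum>j<Suc n. l * ((f ^^ Suc j) z / l ^ Suc j))"
        using l(2) by (intro sum.cong) (simp_all add: funpow_swap1)
      also have "\<dots> = l * (\<Sum>j<Suc n. (f ^^ Suc j) z / l ^ Suc j)"
        by (simp only: sum_distrib_left)
      finally have "(\<Sum>j<Suc n. (f ^^ j) (f z) / l ^ j) - l * (\<Sum>j<Suc n. (f ^^ j) z / l ^ j)
          = l * (\<Sum>j<Suc n. (f ^^ Suc j) z / l ^ Suc j - (f ^^ j) z / l ^ j)"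
        by (simp only: sum_subtractf right_diff_distrib)
      also have "(\<Sum>j<Suc n. (f ^^ Suc j) z / l ^ Suc j - (f ^^ j) z / l ^ j)
          = (f ^^ Suc n) z / l ^ Suc n - (f ^^ 0) z / l ^ 0"
        by (rule sum_lessThan_telescope)
      finally show ?thesis unfolding A_def by (simp add: diff_divide_distrib[symmetric] del: sum.lessThan_Suc of_nat_Suc)
    qed
    have "norm (A n (f z) - l * A n z) \<le> 2 * B / real (Suc n)" for n
    proof -
      have zK: "z \<in> K" using z s by auto
      have "norm ((f ^^ Suc n) z / l ^ Suc n - z) \<le> norm ((f ^^ Suc n) z / l ^ Suc n) + norm z"
        by (rule norm_triangle_ineq4)
      also have "\<dots> \<le> B + B"
        using B[OF iter_K[OF zK, of "Suc n"]] B[OF zK] l(1) by (simp add: norm_divide norm_power norm_mult)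
      finally show ?thesis
        unfolding eq norm_divide norm_mult norm_of_nat l(1) by (intro divide_right_mono) auto
    qed
    then have "(\<lambda>n. A n (f z) - l * A n z) \<longlonglongrightarrow> 0"
    proof (rule Lim_null_comparison[OF always_eventually, rule_format])
      show "(\<lambda>n. 2 * B / real (Suc n)) \<longlonglongrightarrow> 0"
        by (rule LIMSEQ_Suc[OF lim_const_over_n])
    qed
    then have "(\<lambda>n. A (r n) (f z) - l * A (r n) z) \<longlonglongrightarrow> 0"
      using LIMSEQ_subseq_LIMSEQ[OF _ \<Phi>(2)] by (simp add: o_def)
    moreover have "(\<lambda>n. A (r n) (f z) - l * A (r n) z) \<longlonglongrightarrow> \<Phi> (f z) - l * \<Phi> z"
      using z by (intro tendsto_intros \<Phi>(3))
    ultimately have "\<Phi> (f z) - l * \<Phi> z = 0" using LIMSEQ_unique by blast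
    then show ?thesis by simp
  qed
  then show ?thesis using that[of \<Phi>] \<Phi>(1) \<Phi>0 d\<Phi> by (simp add: l_def)
qed

text \<open>\<open>\<Phi>\<close> goes from the dynamical to the rotation coordinate, so in
  \<open>germ_linearizable\<close> it is the germ \<open>\<psi>\<close>, and its local inverse
  \<open>k\<close> is \<open>\<phi>\<close>. By contraposition, 0 is not interior to
  \<open>K\<close> when \<open>f\<close> is not linearizable.\<close>

lemma invariant_nbhd_imp_linearizable:
  assumes f: "open U" "f holomorphic_on U" "f 0 = 0" and lam: "deriv f 0 = cis (2 * pi * \<theta>)"
    and K: "bounded K" "K \<subseteq> U" "f ` K \<subseteq> K" and int: "0 \<in> interior K"
  shows "germ_linearizable \<theta> f"
proof -
  obtain s where s: "0 < s" "ball 0 s \<subseteq> K" using int by (auto simp: mem_interior)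
  have n1: "norm (deriv f 0) = 1" by (simp add: lam)
  obtain \<Phi> where \<Phi>: "\<Phi> holomorphic_on ball 0 s" "\<Phi> 0 = 0" "deriv \<Phi> 0 = 1"
    "\<And>z. z \<in> ball 0 s \<Longrightarrow> f z \<in> ball 0 s \<Longrightarrow> \<Phi> (f z) = deriv f 0 * \<Phi> z"
    by (rule invariant_nbhd_imp_linearizing_map[OF f n1 K s]) (rule that; assumption)
  have "\<exists>t>0. ball (0::complex) t \<subseteq> ball 0 s \<and> inj_on \<Phi> (ball 0 t)"
  proof (rule has_complex_derivative_locally_injective[OF \<Phi>(1) _ open_ball, of 0])
    show "0 \<in> ball 0 s" "deriv \<Phi> 0 \<noteq> 0" using s(1) \<Phi>(3) by auto
    fix r :: real assume "0 < r" "ball (0::complex) r \<subseteq> ball 0 s" "inj_on \<Phi> (ball 0 r)"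
    then show ?thesis by (intro exI[of _ r] conjI)
  qed
  then obtain t where t: "0 < t" "ball (0::complex) t \<subseteq> ball 0 s" "inj_on \<Phi> (ball 0 t)" by blast
  have \<Phi>_t: "\<Phi> holomorphic_on ball 0 t" by (rule holomorphic_on_subset[OF \<Phi>(1) t(2)])
  obtain k where k: "k holomorphic_on \<Phi> ` ball 0 t"
    "\<And>z. z \<in> ball 0 t \<Longrightarrow> deriv \<Phi> z * deriv k (\<Phi> z) = 1"
    "\<And>z. z \<in> ball 0 t \<Longrightarrow> k (\<Phi> z) = z"
    using holomorphic_has_inverse[OF \<Phi>_t open_ball t(3)] by metis
  have open_im: "open (\<Phi> ` ball 0 t)" using open_mapping_thm3[OF \<Phi>_t open_ball t(3)] .
  have im0: "0 \<in> \<Phi> ` ball 0 t" using t(1) \<Phi>(2) by (metis centre_in_ball image_eqI)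
  have k0: "k 0 = 0" using k(3)[of 0] t(1) \<Phi>(2) by simp
  have \<Phi>k: "\<Phi> (k z) = z \<and> k z \<in> ball 0 t" if "z \<in> \<Phi> ` ball 0 t" for z
    using that k(3) by auto
  have "k analytic_on {0}"
    using analytic_on_subset[of k "\<Phi> ` ball 0 t" "{0}"] analytic_on_open[OF open_im] k(1) im0 by simp
  moreover have "deriv k 0 \<noteq> 0" using k(2)[of 0] t(1) \<Phi>(2) by auto
  moreover have "\<Phi> analytic_on {0}"
    using analytic_on_subset[of \<Phi> "ball 0 t" "{0}"] analytic_on_open[OF open_ball] \<Phi>_t t(1) by simp
  moreover have ev: "\<forall>\<^sub>F z in nhds 0. z \<in> \<Phi> ` ball 0 t"
    using open_im im0 by (rule eventually_nhds_in_open)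
  then have "\<forall>\<^sub>F z in nhds 0. \<Phi> (k z) = z" by (rule eventually_mono) (use \<Phi>k in auto)
  moreover have "\<forall>\<^sub>F z in nhds 0. \<Phi> (f (k z)) = cis (2 * pi * \<theta>) * z"
  proof -
    have "isCont k 0"
      using k(1) open_im im0 by (meson continuous_on_eq_continuous_at holomorphic_on_imp_continuous_on)
    moreover have "isCont f (k 0)"
    proof -
      have "0 \<in> ball 0 s" using s(1) by simp
      then have "0 \<in> U" using s(2) K(2) by blast
      then show ?thesis
        unfolding k0 using f(1,2) by (meson continuous_on_eq_continuous_at holomorphic_on_imp_continuous_on)
    qed
    ultimately have "isCont (\<lambda>z. f (k z)) 0" by (rule isCont_o2)
    then have "((\<lambda>z. f (k z)) \<longlongrightarrow> f (k 0)) (nhds 0)"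
      using tendsto_at_iff_tendsto_nhds[of "\<lambda>z. f (k z)" 0] by (simp add: continuous_at)
    then have "\<forall>\<^sub>F z in nhds 0. f (k z) \<in> ball 0 s"
      by (rule topological_tendstoD) (simp_all add: k0 f(3) s(1))
    then show ?thesis using ev
    proof eventually_elim
      case (elim z)
      then have "k z \<in> ball 0 s" using \<Phi>k t(2) by blast
      then show ?case using \<Phi>(4)[of "k z"] elim \<Phi>k by (simp add: lam)
    qed
  qed
  ultimately show ?thesis unfolding germ_linearizable_def using k0 by blast
qed

section \<open>Birkhoff sums of holomorphic functions\<close>

lemma compact_neighbourhood:
  fixes K :: "'a::euclidean_space set"
  assumes "compact K" "open W" "K \<subseteq> W"
  obtains C V where "compact C" "C \<subseteq> W" "open V" "K \<subseteq> V" "V \<subseteq> C"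
proof -
  obtain r where r: "0 < r" "(\<Union>x\<in>K. cball x r) \<subseteq> W"
    using compact_subset_open_imp_cball_epsilon_subset[OF assms] by blast
  have eq: "(\<Union>x\<in>K. cball x r) = {x + y |x y. x \<in> K \<and> y \<in> cball 0 r}"
  proof (intro set_eqI iffI)
    fix y assume "y \<in> (\<Union>x\<in>K. cball x r)"
    then obtain x where "x \<in> K" "y \<in> cball x r" by blast
    then have "y = x + (y - x) \<and> x \<in> K \<and> y - x \<in> cball 0 r"
      by (simp add: dist_norm norm_minus_commute)
    then show "y \<in> {x + y |x y. x \<in> K \<and> y \<in> cball 0 r}" by blast
  next
    fix z assume "z \<in> {x + y |x y. x \<in> K \<and> y \<in> cball 0 r}"
    then obtain x y where "z = x + y" "x \<in> K" "y \<in> cball 0 r" by blast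
    then have "x \<in> K" "z \<in> cball x r" by (simp_all add: dist_norm)
    then show "z \<in> (\<Union>x\<in>K. cball x r)" by blast
  qed
  show ?thesis
  proof (rule that[of "\<Union>x\<in>K. cball x r" "\<Union>x\<in>K. ball x r"])
    show "compact (\<Union>x\<in>K. cball x r)"
      unfolding eq by (intro compact_sums assms compact_cball)
    show "K \<subseteq> (\<Union>x\<in>K. ball x r)" using r(1) by force
    show "(\<Union>x\<in>K. ball x r) \<subseteq> (\<Union>x\<in>K. cball x r)" by (intro UN_mono) auto
  qed (use r in auto)
qed

section \<open>The domain enclosed by the barrier curve\<close>

locale collar = exterior_map +
  fixes c :: "real \<Rightarrow> real" and b :: real
  assumes c_cont: "continuous_on UNIV c" and c_pos: "\<And>x. 0 < c x" and c_shift: "\<And>x. c (x + 1) = c x"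
    and c_less: "\<And>x. c x < b"
begin

text \<open>The domain bounded by the image of the curve
  \<open>x \<mapsto> Complex x (- c x)\<close>, encoded as a complement so that \<open>K\<close>
  belongs to it and openness reduces to \<open>closed_h_image\<close>.\<close>

definition "region = - h ` E ` {w. Im w \<le> - c (Re w)}"

lemma c_shift_int: "c (x + of_int n) = c x"
  using int_translate[of UNIV "\<lambda>w. of_real (c (Re w))" 0 "of_real x" n] c_shift by simp

lemma c_cont_Re: "continuous_on S (\<lambda>w. c (Re w))"
  by (intro continuous_on_compose2[OF c_cont] continuous_intros) auto

text \<open>By periodicity of \<open>c\<close>, the complement is the \<open>E\<close>-image of the
  open set above the curve, together with the unit disc, which supplies the point 0 that
  \<open>E\<close> omits.\<close>

lemma barrier_set_closed: "closed (E ` {w. Im w \<le> - c (Re w)})"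
  and barrier_set_subset: "E ` {w. Im w \<le> - c (Re w)} \<subseteq> Ext"
proof -
  let ?X = "E ` {w. Im w \<le> - c (Re w)}" and ?Y = "{w. - c (Re w) < Im w}"
  show sub: "?X \<subseteq> Ext"
  proof safe
    fix w assume "Im w \<le> - c (Re w)"
    then show "1 < norm (E w)" using c_pos[of "Re w"] by (simp add: norm_E_gt_1_iff)
  qed
  have "\<zeta> \<in> - ?X \<longleftrightarrow> \<zeta> \<in> E ` ?Y \<union> ball 0 1" for \<zeta>
  proof
    assume \<zeta>: "\<zeta> \<in> - ?X"
    show "\<zeta> \<in> E ` ?Y \<union> ball 0 1"
    proof (cases "\<zeta> = 0")
      case False
      then obtain w where w: "\<zeta> = E w" using E_surj by blast
      then have "\<not> Im w \<le> - c (Re w)" using \<zeta> by blast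
      then show ?thesis unfolding w by (intro UnI1 imageI) simp
    qed simp
  next
    assume "\<zeta> \<in> E ` ?Y \<union> ball 0 1"
    then show "\<zeta> \<in> - ?X"
    proof
      assume "\<zeta> \<in> ball 0 1"
      then have "\<zeta> \<notin> Ext" by simp
      then show ?thesis using sub by blast
    next
      assume "\<zeta> \<in> E ` ?Y"
      then obtain v where v: "\<zeta> = E v" "- c (Re v) < Im v" by blast
      have False if EE: "E v = E w" and w: "Im w \<le> - c (Re w)" for w
      proof -
        obtain n :: int where "v = w + of_int n" using EE[unfolded E_eq_iff] by blast
        then show False using v w c_shift_int[of "Re w" n] by simp
      qed
      then have "E v \<notin> ?X" by (metis (mono_tags, lifting) imageE mem_Collect_eq)
      then show ?thesis unfolding v(1) by (simp only: Compl_iff not_False_eq_True)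
    qed
  qed
  then have "- ?X = E ` ?Y \<union> ball 0 1" by (rule set_eqI)
  moreover have "open ?Y"
    by (intro open_Collect_less continuous_intros c_cont_Re)
  ultimately show "closed ?X"
    using E_open_map[of ?Y] by (simp add: closed_def open_Un)
qed

lemma open_region: "open region"
  unfolding region_def using closed_h_image[OF barrier_set_closed barrier_set_subset] by (simp add: open_Compl)

lemma K_subset_region: "K \<subseteq> region"
  using h_image barrier_set_subset unfolding region_def by blast

lemma region_cases:
  assumes "z \<in> region" "z \<notin> K"
  obtains w where "z = h (E w)" "Im w < 0" "- Im w < c (Re w)"
proof -
  have "z \<in> h ` Ext" using assms(2) h_image by auto
  then obtain \<zeta> where \<zeta>: "1 < norm \<zeta>" "z = h \<zeta>" by auto
  then have "\<zeta> \<noteq> 0" by auto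
  then obtain w where w: "\<zeta> = E w" using E_surj by blast
  have "Im w < 0" using \<zeta>(1) unfolding w norm_E_gt_1_iff .
  moreover have "\<not> Im w \<le> - c (Re w)" using assms(1) unfolding region_def \<zeta>(2) w by blast
  ultimately show ?thesis using that[of w] \<zeta> w by simp
qed

text \<open>Points strictly beyond the curve have an open image that misses \<open>region\<close>,
  so none of them is in its closure. Only the curve itself is left for the frontier.\<close>

lemma closure_region_cases:
  assumes "z \<in> closure region" "z \<notin> region"
  obtains x where "z = h (E (Complex x (- c x)))"
proof -
  obtain w where w: "z = h (E w)" "Im w \<le> - c (Re w)"
    using assms(2) unfolding region_def by auto
  have "Im w = - c (Re w)"
  proof (rule ccontr)
    assume "Im w \<noteq> - c (Re w)"
    then have lt: "Im w < - c (Re w)" using w(2) by simp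
    have "open {w. Im w < - c (Re w)}"
      by (intro open_Collect_less continuous_intros c_cont_Re)
    then have "open (h ` E ` {w. Im w < - c (Re w)})"
    proof (intro h_open_map E_open_map)
      show "E ` {w. Im w < - c (Re w)} \<subseteq> Ext" 
        by (rule subset_trans[OF image_mono barrier_set_subset]) auto
    qed
    moreover have "z \<in> h ` E ` {w. Im w < - c (Re w)}" using w(1) lt by blast
    ultimately have "region \<inter> h ` E ` {w. Im w < - c (Re w)} \<noteq> {}"
      using assms(1) by (metis closure_iff_nhds_not_empty inf_commute order_refl)
    then show False unfolding region_def by fastforce
  qed
  then have "w = Complex (Re w) (- c (Re w))" by (simp add: complex_eq_iff)
  then show ?thesis using that w(1) by metis
qed

lemma bounded_region: "bounded region"
proof -
  have "region \<subseteq> K \<union> h ` {\<zeta>. 1 < norm \<zeta> \<and> norm \<zeta> < exp (2 * pi * b)}"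
  proof
    fix z assume z: "z \<in> region"
    show "z \<in> K \<union> h ` {\<zeta>. 1 < norm \<zeta> \<and> norm \<zeta> < exp (2 * pi * b)}"
    proof (cases "z \<in> K")
      case False
      then obtain w where w: "z = h (E w)" "Im w < 0" "- Im w < c (Re w)"
        using region_cases[OF z] by blast
      have "2 * pi * (- Im w) < 2 * pi * b"
        using w(3) c_less[of "Re w"] by (intro mult_strict_left_mono) auto
      then have "norm (E w) < exp (2 * pi * b)" by (simp add: norm_E)
      moreover have "1 < norm (E w)" using w(2) by (simp add: norm_E_gt_1_iff)
      ultimately show ?thesis unfolding w(1) by blast
    qed simp
  qed
  then show ?thesis
    using K_compact bounded_h_image by (metis bounded_Un bounded_subset compact_imp_bounded)
qed

end

context circle_correspondence
begin

text \<open>Orbits from \<open>closure region\<close> stay in \<open>U \<inter> V\<close> for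
  \<open>N\<close> steps, so \<open>\<Sigma>\<close> is differentiable there and the maximum
  principle carries the barrier bound \<open>\<eta> / 2 * N\<close> to \<open>K\<close>. The unknown
  constant \<open>a\<close> is then removed by comparison with the fixed point 0, which costs a
  second \<open>\<eta> / 2\<close>.\<close>

lemma birkhoff_block:
  assumes "open W" "\<phi> holomorphic_on W" "K \<subseteq> W" "0 \<in> K" "f 0 = 0" "0 < \<eta>"
  obtains N where "0 < N"
    "\<And>z. z \<in> K \<Longrightarrow> norm ((\<Sum>j<N. \<phi> ((f ^^ j) z)) - of_nat N * \<phi> 0) \<le> \<eta> * real N"
proof -
  \<comment> \<open>\<open>V\<close> receives the collar outside \<open>K\<close>, and the compact
    set \<open>C\<close> between \<open>V\<close> and \<open>W\<close> provides the bounds on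
    \<open>\<phi>\<close> and its derivative.\<close>
  obtain C V where CV: "compact C" "C \<subseteq> W" "open V" "K \<subseteq> V" "V \<subseteq> C"
    using compact_neighbourhood[OF K_compact assms(1,3)] by metis
  obtain \<delta> where \<delta>: "0 < \<delta>" "\<And>\<zeta>. 1 < norm \<zeta> \<Longrightarrow> norm \<zeta> < 1 + \<delta> \<Longrightarrow> h \<zeta> \<in> V"
    using collar_in_neighbourhood[OF CV(3,4)] by metis
  obtain P P' \<kappa> F e where sys: "circle_strip P P' \<rho> \<kappa> F e" and e: "exp (2 * pi * e) \<le> 1 + \<delta>"
    "exp (2 * pi * e) \<le> 1 + \<epsilon>" and F_E: "\<And>w. \<bar>Im w\<bar> < e \<Longrightarrow> g (E w) = E (F w)"
    using strip_system[OF \<delta>(1)] by metis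
  interpret circle_strip P P' \<rho> \<kappa> F e by (rule sys)
  define H where "H w = h (E w)" for w
  have E_lower: "1 < norm (E w)" "norm (E w) < exp (2 * pi * e)" if "w \<in> lower_strip" for w
  proof -
    show "1 < norm (E w)" using that by (simp add: norm_E_gt_1_iff)
    have "2 * pi * (- Im w) < 2 * pi * e" using that by (intro mult_strict_left_mono) auto
    then show "norm (E w) < exp (2 * pi * e)" by (simp add: norm_E)
  qed
  have H_V: "H w \<in> V" if "w \<in> lower_strip" for w
    unfolding H_def using \<delta>(2) E_lower[OF that] e(1) by simp
  have H_U: "H w \<in> U" and f_H: "f (H w) = H (F w)" if w: "w \<in> lower_strip" for w
  proof -
    have *: "h (E w) \<in> U \<and> f (h (E w)) \<notin> K \<and> g (E w) = inv_into Ext h (f (h (E w)))"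
      using g_eq E_lower[OF w] e(2) by simp
    then show "H w \<in> U" by (simp add: H_def)
    have "f (h (E w)) \<in> h ` Ext" using * h_image by simp
    then have "h (inv_into Ext h (f (h (E w)))) = f (h (E w))" by (rule f_inv_into_f)
    then show "f (H w) = H (F w)" unfolding H_def using * F_E[of w] w by simp
  qed
  obtain B where B: "\<forall>z\<in>C. norm z \<le> B"
    using compact_imp_bounded[OF CV(1)] bounded_iff by metis
  have "bounded (\<psi> ` C)" if "\<psi> holomorphic_on W" for \<psi>
    using that CV(1,2)
    by (intro compact_imp_bounded compact_continuous_image holomorphic_on_imp_continuous_on)
      (auto intro: holomorphic_on_subset)
  from this[OF assms(2)] this[OF holomorphic_deriv[OF assms(2,1)]]
  have "bounded (\<phi> ` C)" "bounded (deriv \<phi> ` C)" by auto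
  then obtain M M' where M: "\<forall>z\<in>C. norm (\<phi> z) \<le> M" "\<forall>z\<in>C. norm (deriv \<phi> z) \<le> M'"
    unfolding bounded_iff by auto
  interpret observable_strip P P' \<rho> \<kappa> F e H B \<phi> W M M'
  proof unfold_locales
    show "H holomorphic_on lower_strip"
      unfolding H_def
      by (rule holomorphic_on_compose_gen[OF E_holomorphic h_hol, unfolded o_def])
        (use E_lower in blast)
    show "\<exists>s::int. w = w' + of_int s" if "w \<in> lower_strip" "w' \<in> lower_strip" "H w = H w'" for w w'
      using that E_lower h_inj unfolding H_def E_eq_iff[symmetric] by (simp add: inj_on_def)
    show "H (w + 1) = H w" for w using E_shift[of w 1] by (simp add: H_def)
    show "cmod (H w) \<le> B" if "w \<in> lower_strip" for w using B H_V[OF that] CV(5) by blast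
    show "H w \<in> W" if "w \<in> lower_strip" for w using H_V[OF that] CV by blast
    show "cmod (\<phi> (H w)) \<le> M" if "w \<in> lower_strip" for w using M(1) H_V[OF that] CV(5) by blast
    show "cmod (deriv \<phi> (H w)) \<le> M'" if "w \<in> lower_strip" for w using M(2) H_V[OF that] CV(5) by blast
  qed (fact assms)+
  obtain N c a where N: "0 < N" and c: "continuous_on UNIV c" "\<And>x. 0 < c x" "\<And>x. c (x + 1) = c x"
    and low: "\<And>x y j. 0 < y \<Longrightarrow> y \<le> c x \<Longrightarrow> j < N \<Longrightarrow> (F ^^ j) (Complex x (- y)) \<in> lower_strip"
    and a: "\<And>x. norm (S N (Complex x (- c x)) - a) \<le> \<eta> / 2 * real N"
  proof (rule exists_barrier[of "\<eta> / 2"])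
    show "0 < \<eta> / 2" using assms(6) by simp
  qed (rule that; assumption)
  \<comment> \<open>The case \<open>j = 0\<close> of \<open>low\<close>, available because
    \<open>0 < N\<close>.\<close>
  have c_e: "c x < e" for x using low[of "c x" x 0] c(2)[of x] N by simp
  interpret collar K h c e by unfold_locales (fact c c_e)+
  have iter_H: "(f ^^ j) (H w) = H ((F ^^ j) w)" if "\<And>i. i < j \<Longrightarrow> (F ^^ i) w \<in> lower_strip" for j w
    using that by (induction j) (simp_all add: f_H)
  have near: "(f ^^ j) (H (Complex x (- y))) = H ((F ^^ j) (Complex x (- y)))"
    "(f ^^ j) (H (Complex x (- y))) \<in> U \<inter> V" if "0 < y" "y \<le> c x" "j < N" for x y j
  proof -
    show *: "(f ^^ j) (H (Complex x (- y))) = H ((F ^^ j) (Complex x (- y)))"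
      using low[OF that(1,2)] that(3) by (intro iter_H) auto
    show "(f ^^ j) (H (Complex x (- y))) \<in> U \<inter> V"
      unfolding * using H_U H_V low[OF that] by blast
  qed
  have iter_K: "(f ^^ j) z \<in> K" if "z \<in> K" for j z
    using that f_K by (induction j) auto
  define \<Sigma> where "\<Sigma> z = (\<Sum>j<N. \<phi> ((f ^^ j) z)) - a" for z
  have orbit: "(f ^^ j) z \<in> U \<inter> V" if z: "z \<in> closure region" and j: "j < N" for z j
  proof (cases "z \<in> region")
    case False
    then obtain x where "z = H (Complex x (- c x))"
      using closure_region_cases[OF z] unfolding H_def by metis
    then show ?thesis using near(2)[OF c(2) order_refl j] by simp
  next
    case True
    show ?thesis
    proof (cases "z \<in> K")
      case True
      then show ?thesis using iter_K K_U CV(4) by blast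
    next
      case False
      then obtain w where w: "z = H w" "Im w < 0" "- Im w < c (Re w)"
        using region_cases[OF True] unfolding H_def by metis
      have "w = Complex (Re w) (- (- Im w))" by (simp add: complex_eq_iff)
      then show ?thesis using near(2)[of "- Im w" "Re w" j] w j by simp
    qed
  qed
  have diff: "\<Sigma> field_differentiable (at z)" if z: "z \<in> closure region" for z
  proof -
    have "(\<lambda>z. \<phi> ((f ^^ j) z)) field_differentiable (at z)" if j: "j < N" for j
    proof -
      have "(f ^^ j) field_differentiable (at z)"
        using orbit[OF z] j by (intro iterate_differentiable[OF U_open f_hol]) auto
      moreover have "\<phi> field_differentiable (at ((f ^^ j) z))"
      proof (rule holomorphic_on_imp_differentiable_at[OF assms(2,1)])
        show "(f ^^ j) z \<in> W" using orbit[OF z j] CV by blast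
      qed
      ultimately show ?thesis
        using field_differentiable_compose[of "f ^^ j" z \<phi>] by (simp add: o_def)
    qed
    then show ?thesis unfolding \<Sigma>_def
      by (intro field_differentiable_diff field_differentiable_sum field_differentiable_const) auto
  qed
  have bound: "norm (\<Sigma> z) \<le> \<eta> / 2 * real N" if "z \<in> K" for z
  proof (rule maximum_modulus_frontier[of \<Sigma> region])
    show "\<Sigma> holomorphic_on interior region"
      unfolding holomorphic_on_def
    proof
      fix v assume "v \<in> interior region"
      then have "v \<in> closure region" using closure_subset interior_subset by blast
      then show "\<Sigma> field_differentiable at v within interior region"
        by (intro field_differentiable_at_within[OF diff])
    qed
    show "continuous_on (closure region) \<Sigma>"
      using diff by (intro continuous_at_imp_continuous_on ballI field_differentiable_imp_continuous_at)
    show "bounded region" by (rule bounded_region)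
    show "z \<in> region" using that K_subset_region by blast
    fix v assume "v \<in> frontier region"
    then have "v \<in> closure region" "v \<notin> region" using open_region by (auto simp: frontier_def interior_open)
    then obtain x where x: "v = H (Complex x (- c x))"
      using closure_region_cases unfolding H_def by metis
    have "\<Sigma> v = S N (Complex x (- c x)) - a"
      unfolding \<Sigma>_def S_def x using near(1)[OF c(2) order_refl] by simp
    then show "norm (\<Sigma> v) \<le> \<eta> / 2 * real N" using a by simp
  qed
  have "(f ^^ j) 0 = 0" for j using assms(5) by (induction j) auto
  then have \<Sigma>0: "\<Sigma> 0 = of_nat N * \<phi> 0 - a" by (simp add: \<Sigma>_def)
  have "norm ((\<Sum>j<N. \<phi> ((f ^^ j) z)) - of_nat N * \<phi> 0) \<le> \<eta> * real N" if "z \<in> K" for z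
  proof -
    have "(\<Sum>j<N. \<phi> ((f ^^ j) z)) - of_nat N * \<phi> 0 = \<Sigma> z - \<Sigma> 0"
      unfolding \<Sigma>0 by (simp add: \<Sigma>_def)
    also have "norm \<dots> \<le> norm (\<Sigma> z) + norm (\<Sigma> 0)" by (rule norm_triangle_ineq4)
    finally show ?thesis using bound[OF that] bound[OF assms(4)] by simp
  qed
  then show ?thesis using that N by blast
qed

end

section \<open>Peak functions\<close>

context exterior_map
begin

lemma connected_h_image: "connected S \<Longrightarrow> S \<subseteq> Ext \<Longrightarrow> connected (h ` S)"
  by (intro connected_continuous_image holomorphic_on_imp_continuous_on holomorphic_on_subset[OF h_hol])

text \<open>\<open>D\<close> is \<open>K\<close> with the image of an annulus, whose outer radius is
  that of the preimage of a point \<open>z\<close> near \<open>a\<close> outside \<open>K\<close>.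
  Its complement is the image of the complement of a disc, hence connected; \<open>D\<close> itself
  is connected since \<open>a\<close>, not interior to \<open>K\<close>, is a limit of the image of
  the annulus. Being open and bounded as well, \<open>D\<close> is simply connected, and
  \<open>z\<close> serves as \<open>p\<close>.\<close>

lemma simply_connected_neighbourhood:
  assumes K: "connected K" "a \<in> K" "a \<notin> interior K" and "0 < \<tau>"
  obtains D p where "open D" "K \<subseteq> D" "simply_connected D" "p \<notin> D" "dist a p \<le> \<tau>"
proof -
  have "\<not> ball a \<tau> \<subseteq> K" using K(3) assms(4) by (auto simp: mem_interior)
  then obtain z where z: "z \<in> ball a \<tau>" "z \<notin> K" by blast
  then have "z \<in> h ` Ext" using h_image by simp
  then obtain \<zeta> where \<zeta>: "1 < norm \<zeta>" "z = h \<zeta>" by blast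
  define R where "R = norm \<zeta>"
  have sub: "- ball 0 R \<subseteq> Ext" using \<zeta>(1) by (auto simp: R_def)
  define D where "D = - h ` (- ball 0 R)"
  have cl: "closed (h ` (- ball 0 R))" using sub by (intro closed_h_image) auto
  have K_D: "K \<subseteq> D" using h_image sub unfolding D_def by blast
  define A where "A = {\<zeta>::complex. 1 < norm \<zeta> \<and> norm \<zeta> < R}"
  have A: "A \<subseteq> Ext" "Ext = A \<union> - ball 0 R" "A \<inter> - ball 0 R = {}"
    using \<zeta>(1) by (auto simp: A_def R_def)
  have D_eq: "D = K \<union> h ` A"
  proof -
    have "- K = h ` A \<union> h ` (- ball 0 R)" using h_image A(2) by (metis image_Un)
    moreover have "h ` A \<inter> h ` (- ball 0 R) = {}"
      using inj_on_image_Int[OF h_inj A(1) sub] A(3) by simp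
    ultimately show ?thesis unfolding D_def by blast
  qed
  have "connected (- D)"
    unfolding D_def double_compl using sub
    by (intro connected_h_image connected_complement_bounded_convex) auto
  moreover have "connected D"
  proof -
    have "connected A"
    proof -
      have "A = ball 0 R - cball 0 1" by (auto simp: A_def)
      then show ?thesis using connected_annulus(1)[where a = "0::complex" and ?r1.0 = 1 and ?r2.0 = R] by (simp add: A_def)
    qed
    then have cA: "connected (h ` A)" using A(1) by (rule connected_h_image)
    have "a \<in> closure (h ` A)"
      unfolding closure_approachable
    proof (intro allI impI)
      fix e :: real assume e: "0 < e"
      have "open D" using cl by (simp add: D_def open_Compl)
      then obtain r where r: "0 < r" "ball a r \<subseteq> D" using K_D K(2) by (meson open_contains_ball subsetD)
      have "\<not> ball a (min r e) \<subseteq> K" using K(3) r(1) e by (auto simp: mem_interior)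
      then obtain y where "y \<in> ball a (min r e)" "y \<notin> K" by blast
      moreover then have "y \<in> h ` A" using r(2) D_eq by auto
      ultimately show "\<exists>y\<in>h ` A. dist y a < e" by (auto simp: dist_commute)
    qed
    then have "connected (insert a (h ` A))"
      by (intro connected_intermediate_closure[OF cA]) (auto intro: closure_subset[THEN subsetD])
    then have "connected (K \<union> insert a (h ` A))"
      using K(1,2) by (intro connected_Un) auto
    moreover have "K \<union> insert a (h ` A) = D" using K(2) D_eq by auto
    ultimately show ?thesis by simp
  qed
  moreover have "open D" using cl by (simp add: D_def open_Compl)
  moreover have "bounded D"
    unfolding D_eq A_def using K_compact bounded_h_image by (simp add: compact_imp_bounded)
  ultimately have "simply_connected D" by (simp add: simply_connected_iff_simple)
  moreover have "z \<notin> D" unfolding D_def \<zeta>(2) by (auto simp: R_def)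
  ultimately show ?thesis
    using that[of D z] \<open>open D\<close> K_D z(1) by (simp add: less_imp_le)
qed

text \<open>With \<open>p\<close> a nearest point of the complement of \<open>D\<close> and \<open>S\<close> a branch of \<open>sqrt (z - p)\<close>, the
  values of \<open>S\<close> near 0 cover a disc around \<open>S 0\<close>, so that \<open>S\<close> stays away from \<open>- S 0\<close>.\<close>

lemma peak_function:
  assumes K: "connected K" "0 \<in> K" "0 \<notin> interior K" and "0 < r" "0 < \<epsilon>"
  obtains W T where "open W" "K \<subseteq> W" "T holomorphic_on W" "T 0 = 1 / 2"
    "\<And>z. z \<in> W \<Longrightarrow> norm (T z) \<le> 4" "\<And>z. z \<in> W \<Longrightarrow> r \<le> norm z \<Longrightarrow> norm (T z) \<le> \<epsilon>"
proof -
  define \<eta> where "\<eta> = min \<epsilon> 1"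
  have \<eta>: "0 < \<eta>" "\<eta> \<le> 1" "\<eta> \<le> \<epsilon>" using assms(5) by (auto simp: \<eta>_def)
  \<comment> \<open>Makes \<open>norm b \<le> sqrt r * (\<eta> / 4)\<close> below, as
    \<open>b\<^sup>2 = - p\<close>, against \<open>norm (S z)\<close> of at least
    \<open>3 / 4 * sqrt r\<close> where \<open>r \<le> norm z\<close>.\<close>
  define \<tau> where "\<tau> = r * (\<eta> / 4)\<^sup>2"
  have "0 < \<tau>" using assms(4) \<eta> by (simp add: \<tau>_def)
  obtain D p0 where D: "open D" "K \<subseteq> D" "simply_connected D" "p0 \<notin> D" "dist 0 p0 \<le> \<tau>"
    by (rule simply_connected_neighbourhood[OF K \<open>0 < \<tau>\<close>]) (rule that; assumption)
  have "closed (- D)" "- D \<noteq> {}" using D by auto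
  then obtain p where p: "p \<in> - D" "\<And>y. y \<in> - D \<Longrightarrow> dist 0 p \<le> dist 0 y"
    by (rule distance_attains_inf[where a = 0]) (rule that; assumption)
  have p_le: "norm p \<le> \<tau>" using p(2)[of p0] D(4,5) by simp
  have "0 \<in> D" using K(2) D(2) by blast
  then have p_nz: "p \<noteq> 0" using p(1) by auto
  have ball_D: "ball 0 (norm p) \<subseteq> D" using p(2) by force
  have "(\<lambda>z. z - p) holomorphic_on D" "\<forall>z\<in>D. z - p \<noteq> 0" using p(1) by (auto intro!: holomorphic_intros)
  then obtain S where S: "S holomorphic_on D" "\<And>z. z \<in> D \<Longrightarrow> z - p = (S z)\<^sup>2"
    using D(3) simply_connected_eq_holomorphic_sqrt[OF D(1)] by metis
  define b where "b = S 0"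
  have b: "b\<^sup>2 = - p" "b \<noteq> 0" using S(2)[OF \<open>0 \<in> D\<close>] p_nz by (auto simp: b_def)
  have quot: "(S z / b)\<^sup>2 = 1 - z / p" if "z \<in> D" for z
    using S(2)[OF that] b p_nz by (simp add: power_divide field_simps)
  have Re_pos: "0 < Re (S z / b)" if z: "z \<in> ball 0 (norm p)" for z
  proof -
    let ?q = "\<lambda>z. Re (S z / b)"
    have "continuous_on (ball 0 (norm p)) ?q"
      by (intro continuous_intros holomorphic_on_imp_continuous_on holomorphic_on_subset[OF S(1)] ball_D) (use b in auto)
    then have "connected (?q ` ball 0 (norm p))" by (rule connected_continuous_image) simp
    then have int: "is_interval (?q ` ball 0 (norm p))" by (simp add: is_interval_connected_1)
    \<comment> \<open>\<open>1 - y / p\<close> has positive real part for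
      \<open>norm y < norm p\<close>, whereas the square of a purely imaginary number has real part
      at most 0.\<close>
    have nz: "?q y \<noteq> 0" if y: "y \<in> ball 0 (norm p)" for y
    proof
      assume 0: "?q y = 0"
      have "Re ((S y / b)\<^sup>2) = - (Im (S y / b))\<^sup>2" unfolding Re_power2 using 0 by simp
      moreover have "y \<in> D" using y ball_D by blast
      ultimately have "Re (1 - y / p) \<le> 0" using quot[of y] by (metis neg_le_0_iff_le zero_le_power2)
      moreover have "norm (y / p) < 1" using y p_nz by (simp add: norm_divide)
      ultimately show False using complex_Re_le_cmod[of "y / p"] by simp
    qed
    have one: "?q 0 = 1" using b by (simp add: b_def[symmetric])
    show ?thesis
    proof (rule ccontr)
      assume "\<not> 0 < ?q z"
      then have "?q z \<le> 0" by simp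
      have i1: "?q z \<in> ?q ` ball 0 (norm p)" by (rule imageI[OF z])
      have i0: "?q 0 \<in> ?q ` ball 0 (norm p)" by (rule imageI) (use p_nz in simp)
      have "0 \<in> ?q ` ball 0 (norm p)"
        by (rule mem_is_interval_1_I[OF int i1 i0]) (use one \<open>?q z \<le> 0\<close> in linarith)+
      then obtain y where "y \<in> ball 0 (norm p)" "0 = ?q y" by (rule imageE)
      then show False using nz by metis
    qed
  qed
  \<comment> \<open>If \<open>S z\<close> were close to \<open>- b\<close>, then
    \<open>z / p = e * (2 - e)\<close> would be small, putting \<open>z\<close> in the disc where
    \<open>Re (S z / b)\<close> is positive.\<close>
  have far: "norm b / 4 \<le> norm (S z + b)" if "z \<in> D" for z
  proof (rule ccontr)
    define e where "e = S z / b + 1"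
    assume "\<not> ?thesis"
    moreover have "S z + b = b * e" using b by (simp add: e_def field_simps)
    ultimately have e: "norm e < 1 / 4" using b by (simp add: norm_mult)
    have "(e - 1)\<^sup>2 = 1 - z / p" using quot[OF that] by (simp add: e_def)
    then have "z / p = e * (2 - e)" by (simp add: power2_eq_square algebra_simps)
    then have "norm z / norm p = norm e * norm (2 - e)" by (metis norm_divide norm_mult)
    also have "\<dots> \<le> 1 / 4 * (2 + norm e)"
      using e norm_triangle_ineq4[of 2 e] by (intro mult_mono) auto
    also have "\<dots> < 1" using e by simp
    finally have "z \<in> ball 0 (norm p)" using p_nz by (simp add: field_simps)
    then have "0 < Re (S z / b)" by (rule Re_pos)
    moreover have "Re (S z / b) = Re e - 1" by (simp add: e_def)
    ultimately show False using e complex_Re_le_cmod[of e] by simp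
  qed
  define T where "T z = b / (S z + b)" for z
  show ?thesis
  proof (rule that[of D T])
    have "S z + b \<noteq> 0" if "z \<in> D" for z using far[OF that] b by auto
    then show "T holomorphic_on D" unfolding T_def by (intro holomorphic_intros S(1)) auto
    show "T 0 = 1 / 2" using b by (simp add: T_def b_def[symmetric])
    show "norm (T z) \<le> 4" if "z \<in> D" for z
    proof -
      have "0 < norm b / 4" using b by simp
      then show ?thesis using far[OF that] by (simp add: T_def norm_divide divide_le_eq)
    qed
    show "norm (T z) \<le> \<epsilon>" if z: "z \<in> D" "r \<le> norm z" for z
    proof -
      define s where "s = sqrt r"
      have s: "0 < s" "s\<^sup>2 = r" using assms(4) by (simp_all add: s_def)
      have "(norm b)\<^sup>2 \<le> (s * (\<eta> / 4))\<^sup>2"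
        using p_le b(1) unfolding \<tau>_def power_mult_distrib s(2) by (metis norm_minus_cancel norm_power)
      then have nb: "norm b \<le> s * (\<eta> / 4)"
        by (rule power2_le_imp_le) (use s \<eta> in simp)
      have "(\<eta> / 4)\<^sup>2 \<le> (1 / 4)\<^sup>2" using \<eta> by (intro power_mono) auto
      then have "norm p \<le> r * (1 / 4)\<^sup>2"
        using p_le assms(4) unfolding \<tau>_def by (meson mult_left_mono less_imp_le order.trans)
      then have "9 / 16 * r \<le> norm (z - p)"
        using z(2) norm_triangle_ineq2[of z p] assms(4) by (simp add: power2_eq_square)
      then have "(3 / 4 * s)\<^sup>2 \<le> (norm (S z))\<^sup>2"
        unfolding S(2)[OF z(1)] norm_power power_mult_distrib s(2) by (simp add: power2_eq_square)
      then have "3 / 4 * s \<le> norm (S z)" by (rule power2_le_imp_le) simp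
      moreover have "s * (\<eta> / 4) \<le> s * (1 / 4)" using s \<eta> by (intro mult_left_mono) auto
      moreover have "norm (S z) \<le> norm (S z + b) + norm b"
        using norm_triangle_ineq4[of "S z + b" b] by simp
      ultimately have low: "s / 2 \<le> norm (S z + b)" using nb by simp
      have "norm (T z) = norm b / norm (S z + b)" by (simp add: T_def norm_divide)
      also have "\<dots> \<le> (s * (\<eta> / 4)) / (s / 2)"
        using low nb s \<eta> by (intro frac_le) auto
      also have "\<dots> \<le> \<epsilon>" using s \<eta> by simp
      finally show ?thesis .
    qed
    show "open D" "K \<subseteq> D" by (fact D)+
  qed
qed

text \<open>The scales of the summands are separated, so that at each point at most one of them
  exceeds \<open>1/2 + \<epsilon>\<close>, and that one by a bounded amount.\<close>

lemma multiscale_peak_function: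
  assumes K: "connected K" "0 \<in> K" "0 \<notin> interior K" and "0 < r" "0 < \<epsilon>"
  shows "\<exists>W \<phi> r'. open W \<and> K \<subseteq> W \<and> \<phi> holomorphic_on W \<and> \<phi> 0 = of_nat n / 2 \<and> 0 < r' \<and>
    (\<forall>z\<in>K. Re (\<phi> z) \<le> real n * (1 / 2 + \<epsilon>) + 4) \<and>
    (\<forall>z\<in>K. r \<le> norm z \<longrightarrow> Re (\<phi> z) \<le> real n * \<epsilon>) \<and>
    (\<forall>z\<in>K. norm z < r' \<longrightarrow> Re (\<phi> z) \<le> real n * (1 / 2 + \<epsilon>))"
proof (induction n)
  case 0
  show ?case by (intro exI[of _ UNIV] exI[of _ "\<lambda>_. 0"] exI[of _ 1]) auto
next
  case (Suc n)
  then obtain W \<phi> r' where \<phi>: "open W" "K \<subseteq> W" "\<phi> holomorphic_on W" "\<phi> 0 = of_nat n / 2" "0 < r'"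
    "\<And>z. z \<in> K \<Longrightarrow> Re (\<phi> z) \<le> real n * (1 / 2 + \<epsilon>) + 4"
    "\<And>z. z \<in> K \<Longrightarrow> r \<le> norm z \<Longrightarrow> Re (\<phi> z) \<le> real n * \<epsilon>"
    "\<And>z. z \<in> K \<Longrightarrow> norm z < r' \<Longrightarrow> Re (\<phi> z) \<le> real n * (1 / 2 + \<epsilon>)"
    by blast
  \<comment> \<open>The next scale lies within \<open>r'\<close>: where the new summand can exceed
    \<open>\<epsilon>\<close>, the previous sum is still at most
    \<open>n * (1 / 2 + \<epsilon>)\<close>.\<close>
  have "0 < min r r'" using assms(4) \<phi>(5) by simp
  then obtain V T where T: "open V" "K \<subseteq> V" "T holomorphic_on V" "T 0 = 1 / 2"
    "\<And>z. z \<in> V \<Longrightarrow> norm (T z) \<le> 4" "\<And>z. z \<in> V \<Longrightarrow> min r r' \<le> norm z \<Longrightarrow> norm (T z) \<le> \<epsilon>"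
    by (rule peak_function[OF K _ assms(5)]) (rule that; assumption)
  have "0 \<in> V" using T(2) K(2) by blast
  then have "isCont T 0"
    using T(1,3) by (meson continuous_on_eq_continuous_at holomorphic_on_imp_continuous_on)
  then obtain d where d: "0 < d" "\<And>z. dist z 0 < d \<Longrightarrow> dist (T z) (T 0) < \<epsilon>"
    using assms(5) unfolding continuous_at_eps_delta by metis
  have T_small: "Re (T z) \<le> \<epsilon>" if "z \<in> K" "min r r' \<le> norm z" for z
    using T(6)[of z] that T(2) complex_Re_le_cmod[of "T z"] by auto
  have T_near: "Re (T z) \<le> 1 / 2 + \<epsilon>" if "norm z < d" for z
    using d(2)[of z] that complex_Re_le_cmod[of "T z - 1 / 2"] by (simp add: T(4) dist_norm)
  have T_all: "Re (T z) \<le> 4" if "z \<in> K" for z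
    using T(5)[of z] that T(2) complex_Re_le_cmod[of "T z"] by auto
  have Suc_eq: "real (Suc n) * c = real n * c + c" for c by (simp add: algebra_simps)
  show ?case
  proof (intro exI[of _ "W \<inter> V"] exI[of _ "\<lambda>z. \<phi> z + T z"] exI[of _ "min r' d"] conjI ballI impI)
    show "(\<lambda>z. \<phi> z + T z) holomorphic_on W \<inter> V"
      by (intro holomorphic_intros holomorphic_on_subset[OF \<phi>(3)] holomorphic_on_subset[OF T(3)]) auto
    show "\<phi> 0 + T 0 = of_nat (Suc n) / 2" by (simp add: \<phi>(4) T(4) add_divide_distrib)
  next
    fix z assume z: "z \<in> K"
    show "Re (\<phi> z + T z) \<le> real (Suc n) * (1 / 2 + \<epsilon>) + 4"
    proof (cases "norm z < r'")
      case True
      then show ?thesis using \<phi>(8)[OF z] T_all[OF z] assms(5) unfolding Suc_eq plus_complex.sel by linarith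
    next
      case False
      then have "Re (T z) \<le> \<epsilon>" by (intro T_small z) simp
      then show ?thesis using \<phi>(6)[OF z] unfolding Suc_eq plus_complex.sel by linarith
    qed
  next
    fix z assume "z \<in> K" "r \<le> norm z"
    then show "Re (\<phi> z + T z) \<le> real (Suc n) * \<epsilon>"
      using \<phi>(7)[of z] T_small[of z] by (simp add: algebra_simps min_le_iff_disj)
  next
    fix z assume "z \<in> K" "norm z < min r' d"
    then show "Re (\<phi> z + T z) \<le> real (Suc n) * (1 / 2 + \<epsilon>)"
      using \<phi>(8)[of z] T_near[of z] unfolding Suc_eq plus_complex.sel by simp
  next
    show "open (W \<inter> V)" using \<phi>(1) T(1) by (rule open_Int)
    show "K \<subseteq> W \<inter> V" using \<phi>(2) T(2) by blast
    show "0 < min r' d" using \<phi>(5) d(1) by simp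
  qed
qed

end

section \<open>Frequency of visits away from 0\<close>

definition far_visits :: "(complex \<Rightarrow> complex) \<Rightarrow> real \<Rightarrow> nat \<Rightarrow> complex \<Rightarrow> nat" where
  "far_visits f r N z = card {j. j < N \<and> r \<le> norm ((f ^^ j) z)}"

lemma far_visits_le: "far_visits f r N z \<le> N"
proof -
  have "card {j. j < N \<and> r \<le> norm ((f ^^ j) z)} \<le> card {..<N}" by (intro card_mono) auto
  then show ?thesis by (simp add: far_visits_def)
qed

lemma far_visits_eq_sum: "far_visits f r N z = (\<Sum>j<N. if r \<le> norm ((f ^^ j) z) then 1 else 0)"
proof -
  have "{j. j < N \<and> r \<le> norm ((f ^^ j) z)} = {j \<in> {..<N}. r \<le> norm ((f ^^ j) z)}" by auto
  then show ?thesis unfolding far_visits_def by (simp add: sum.If_cases Int_def)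
qed

lemma far_visits_add: "far_visits f r (M + N) z = far_visits f r M z + far_visits f r N ((f ^^ M) z)"
  unfolding far_visits_eq_sum sum_lessThan_add by (simp add: funpow_add)

text \<open>Orbits stay in \<open>K\<close>, so the uniform block bound adds up over consecutive
  blocks. The incomplete last block contributes at most \<open>N\<close>, which is at most
  \<open>\<gamma> / 2 * n\<close> once \<open>n\<close> reaches
  \<open>2 * N / \<gamma>\<close>.\<close>

lemma far_visits_eventually_small:
  assumes inv: "\<And>z. z \<in> K \<Longrightarrow> f z \<in> K" and "0 < N" "0 < \<gamma>"
    and block: "\<And>z. z \<in> K \<Longrightarrow> real (far_visits f r N z) \<le> \<gamma> / 2 * real N"
  shows "\<forall>\<^sub>F n in sequentially. \<forall>z\<in>K. real (far_visits f r n z) \<le> \<gamma> * real n"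
proof -
  have iter: "(f ^^ j) z \<in> K" if "z \<in> K" for j z using that inv by (induction j) auto
  have blocks: "real (far_visits f r (k * N) z) \<le> \<gamma> / 2 * real (k * N)" if "z \<in> K" for k z
    using that
  proof (induction k arbitrary: z)
    case 0
    then show ?case by (simp add: far_visits_def)
  next
    case (Suc k)
    have "real (far_visits f r (Suc k * N) z) = real (far_visits f r N z) + real (far_visits f r (k * N) ((f ^^ N) z))"
      by (simp add: far_visits_add)
    also have "\<dots> \<le> \<gamma> / 2 * real N + \<gamma> / 2 * real (k * N)"
      by (intro add_mono block Suc iter)
    finally show ?case by (simp add: algebra_simps)
  qed
  obtain n0 :: nat where n0: "2 * real N / \<gamma> \<le> real n0" using real_arch_simple by blast
  have "real (far_visits f r n z) \<le> \<gamma> * real n" if n: "n0 \<le> n" and z: "z \<in> K" for n z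
  proof -
    define k where "k = n div N"
    have n_eq: "n = k * N + n mod N" by (simp add: k_def)
    have "real (far_visits f r n z) = real (far_visits f r (k * N) z) + real (far_visits f r (n mod N) ((f ^^ (k * N)) z))"
      by (subst n_eq) (simp add: far_visits_add)
    also have "\<dots> \<le> \<gamma> / 2 * real (k * N) + real N"
    proof (intro add_mono blocks z)
      have "far_visits f r (n mod N) ((f ^^ (k * N)) z) \<le> n mod N" by (rule far_visits_le)
      also have "\<dots> \<le> N" using assms(2) by (simp add: less_imp_le)
      finally show "real (far_visits f r (n mod N) ((f ^^ (k * N)) z)) \<le> real N" by simp
    qed
    also have "\<gamma> / 2 * real (k * N) \<le> \<gamma> / 2 * real n"
      using assms(3) by (intro mult_left_mono) (simp_all add: k_def flip: of_nat_mult)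
    also have "real N \<le> \<gamma> / 2 * real n"
    proof -
      have "2 * real N / \<gamma> \<le> real n" using n0 n by (meson of_nat_le_iff order.trans)
      then show ?thesis using assms(3) by (simp add: field_simps)
    qed
    finally show ?thesis by simp
  qed
  then show ?thesis using eventually_sequentially by blast
qed

context circle_correspondence
begin

text \<open>On \<open>K\<close> the real part of \<open>\<phi>\<close> is at most \<open>a\<close>,
  and at far points it is lower than \<open>a\<close> by at least \<open>n / 2 + 4\<close>, while
  its average over \<open>N\<close> steps is at least \<open>n / 2 - 1\<close>. So far visits have
  frequency at most \<open>(n * \<epsilon> + 5) / (n / 2 + 4)\<close>.\<close>

lemma far_visits_block:
  assumes K: "connected K" "0 \<in> K" "0 \<notin> interior K" and "f 0 = 0" and "0 < r" "0 < \<gamma>"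
  obtains N where "0 < N" "\<And>z. z \<in> K \<Longrightarrow> real (far_visits f r N z) \<le> \<gamma> * real N"
proof -
  define \<epsilon> where "\<epsilon> = \<gamma> / 4"
  \<comment> \<open>Makes 5 at most \<open>\<gamma> / 4 * n\<close>, so that with
    \<open>\<epsilon> = \<gamma> / 4\<close> the sum \<open>n * \<epsilon> + 5\<close> is at most
    \<open>\<gamma> * n / 2\<close>.\<close>
  obtain n :: nat where n: "20 / \<gamma> \<le> real n" using real_arch_simple by blast
  have \<epsilon>: "0 < \<epsilon>" using assms(6) by (simp add: \<epsilon>_def)
  obtain W \<phi> where \<phi>: "open W" "K \<subseteq> W" "\<phi> holomorphic_on W" "\<phi> 0 = of_nat n / 2"
    "\<And>z. z \<in> K \<Longrightarrow> Re (\<phi> z) \<le> real n * (1 / 2 + \<epsilon>) + 4"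
    "\<And>z. z \<in> K \<Longrightarrow> r \<le> norm z \<Longrightarrow> Re (\<phi> z) \<le> real n * \<epsilon>"
    using multiscale_peak_function[OF K assms(5) \<epsilon>, of n] by blast
  obtain N where N: "0 < N"
    "\<And>z. z \<in> K \<Longrightarrow> norm ((\<Sum>j<N. \<phi> ((f ^^ j) z)) - of_nat N * \<phi> 0) \<le> 1 * real N"
    by (rule birkhoff_block[OF \<phi>(1,3,2) K(2) assms(4) zero_less_one]) (rule that; assumption)
  have "real (far_visits f r N z) \<le> \<gamma> * real N" if z: "z \<in> K" for z
  proof -
    define a where "a = real n * (1 / 2 + \<epsilon>) + 4"
    define m where "m = real (far_visits f r N z)"
    have iter: "(f ^^ j) z \<in> K" for j using z f_K by (induction j) auto
    have "Re (\<phi> ((f ^^ j) z)) \<le> a - (real n / 2 + 4) * (if r \<le> norm ((f ^^ j) z) then 1 else 0)" for j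
      using \<phi>(5,6)[OF iter[of j]] by (auto simp: a_def algebra_simps)
    then have "(\<Sum>j<N. Re (\<phi> ((f ^^ j) z)))
        \<le> (\<Sum>j<N. a - (real n / 2 + 4) * (if r \<le> norm ((f ^^ j) z) then 1 else 0))"
      by (intro sum_mono)
    also have "\<dots> = real N * a - (real n / 2 + 4) * m"
    proof -
      have "m = (\<Sum>j<N. if r \<le> norm ((f ^^ j) z) then 1 else 0)"
        unfolding m_def far_visits_eq_sum of_nat_sum by (intro sum.cong) auto
      then show ?thesis by (simp add: sum_subtractf sum_distrib_left)
    qed
    finally have up: "(\<Sum>j<N. Re (\<phi> ((f ^^ j) z))) \<le> real N * a - (real n / 2 + 4) * m" .
    have "\<bar>Re ((\<Sum>j<N. \<phi> ((f ^^ j) z)) - of_nat N * \<phi> 0)\<bar> \<le> real N"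
      using N(2)[OF z] abs_Re_le_cmod order.trans by fastforce
    then have "real N * (real n / 2) - real N \<le> (\<Sum>j<N. Re (\<phi> ((f ^^ j) z)))"
      by (simp add: \<phi>(4) abs_le_iff)
    with up have "(real n / 2 + 4) * m \<le> real N * (real n * \<epsilon> + 5)"
      by (simp add: a_def algebra_simps)
    also have "\<dots> \<le> real N * (\<gamma> * (real n / 2 + 4))"
    proof (intro mult_left_mono)
      have "5 \<le> \<gamma> / 4 * real n" using n assms(6) by (simp add: field_simps)
      moreover have "0 \<le> \<gamma> * 4" using assms(6) by simp
      ultimately show "real n * \<epsilon> + 5 \<le> \<gamma> * (real n / 2 + 4)" by (simp add: \<epsilon>_def algebra_simps)
    qed simp
    finally have "(real n / 2 + 4) * m \<le> (real n / 2 + 4) * (\<gamma> * real N)" by (simp add: ac_simps)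
    then show ?thesis unfolding m_def by (rule mult_left_le_imp_le) (simp add: add_nonneg_pos)
  qed
  then show ?thesis using that N(1) by blast
qed

end

theorem corollary1p4:
  fixes \<theta> :: real and K U :: "complex set" and f :: "complex \<Rightarrow> complex"
  assumes "\<theta> \<notin> \<rat>"
    and "compact K" and "connected K" and "0 \<in> K" and "K \<noteq> {0}" and "connected (- K)"
    and "open U" and "K \<subseteq> U" and "f holomorphic_on U" and "inj_on f U"
    and "f 0 = 0" and "deriv f 0 = cis (2 * pi * \<theta>)"
    and "f ` K = K" and "inv_into U f ` K = K"
    and "external_circle_correspondence \<theta> f U K"
    and "\<not> germ_linearizable \<theta> f"
  shows "\<forall>r>0. (\<lambda>N. SUP z\<in>K. real (card {j. j < N \<and> r \<le> norm ((f ^^ j) z)}) / real N)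
           \<longlonglongrightarrow> 0"
proof (intro allI impI)
  fix r :: real assume r: "0 < r"
  \<comment> \<open>If 0 were interior to the bounded invariant set \<open>K\<close>, the germ of
    \<open>f\<close> would be linearizable.\<close>
  have K0: "0 \<notin> interior K"
    using invariant_nbhd_imp_linearizable[OF assms(7,9,11,12) compact_imp_bounded[OF assms(2)] assms(8)]
      assms(13,16) by blast
  obtain h \<epsilon> g \<rho> where "exterior_riemann_map K h" "0 < \<epsilon>"
    "\<And>\<zeta>. 1 < norm \<zeta> \<Longrightarrow> norm \<zeta> < 1 + \<epsilon> \<Longrightarrow>
        h \<zeta> \<in> U \<and> f (h \<zeta>) \<notin> K \<and> g \<zeta> = inv_into {\<zeta>. 1 < norm \<zeta>} h (f (h \<zeta>))"
    "g holomorphic_on {\<zeta>. 1 - \<epsilon> < norm \<zeta> \<and> norm \<zeta> < 1 + \<epsilon>}" "analytic_circle_diffeo g"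
    "circle_orientation_preserving g" "has_rotation_number g \<rho>" "\<rho> \<notin> \<rat>"
    using assms(15) unfolding external_circle_correspondence_def by blast
  then interpret circle_correspondence K h f g U \<epsilon> \<rho>
    using assms(2,7,8,9,13) by unfold_locales
  have small: "\<forall>\<^sub>F n in sequentially. (SUP z\<in>K. real (far_visits f r n z) / real n) \<in> {0..\<gamma>}" if \<gamma>: "0 < \<gamma>" for \<gamma>
  proof -
    have "0 < \<gamma> / 2" using \<gamma> by simp
    then obtain N where N: "0 < N" "\<And>z. z \<in> K \<Longrightarrow> real (far_visits f r N z) \<le> \<gamma> / 2 * real N"
      using far_visits_block[OF assms(3,4) K0 assms(11) r] by metis
    have "\<forall>\<^sub>F n in sequentially. \<forall>z\<in>K. real (far_visits f r n z) \<le> \<gamma> * real n"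
      by (rule far_visits_eventually_small[OF _ N(1) \<gamma> N(2)]) (use assms(13) in auto)
    then show ?thesis
      using eventually_gt_at_top[of 0]
    proof eventually_elim
      case (elim n)
      then have le: "real (far_visits f r n z) / real n \<le> \<gamma>" if "z \<in> K" for z
        using that by (simp add: divide_le_eq)
      have up: "(SUP z\<in>K. real (far_visits f r n z) / real n) \<le> \<gamma>"
        using assms(4) le by (intro cSUP_least) auto
      have "0 \<le> real (far_visits f r n 0) / real n" by simp
      moreover have "real (far_visits f r n 0) / real n \<le> (SUP z\<in>K. real (far_visits f r n z) / real n)"
        using le by (intro cSUP_upper assms(4) bdd_aboveI2[of _ _ \<gamma>]) auto
      ultimately have "0 \<le> (SUP z\<in>K. real (far_visits f r n z) / real n)" by (rule order.trans)
      with up show ?case by simp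
    qed
  qed
  show "(\<lambda>N. SUP z\<in>K. real (card {j. j < N \<and> r \<le> norm ((f ^^ j) z)}) / real N) \<longlonglongrightarrow> 0"
    unfolding far_visits_def[symmetric]
  proof (rule tendstoI)
    fix e :: real assume "0 < e"
    then have "0 < e / 2" by simp
    from small[OF this]
    show "\<forall>\<^sub>F n in sequentially. dist (SUP z\<in>K. real (far_visits f r n z) / real n) 0 < e"
      by (rule eventually_mono) (use \<open>0 < e\<close> in auto)
  qed
qed

end
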